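(* Let $n\ge 2$ and let $S$ be a $C^{\infty}$-hypersurface in the Heisenberg group $\mathbb H^n$, endowed with the restriction $d$ of a left-invariant homogeneous distance of $\mathbb H^n$. Then $S$ is $(\mathbb H^{n-1}\times\mathbb R)$-rectifiable in the sense of Pauls, even with bi-Lipschitz maps; that is, there exist countably many subsets $U_i\subseteq \mathbb H^{n-1}\times\mathbb R$ and maps $f_i:U_i\to (S,d)$, $i\in\mathbb N$, each of which is bi-Lipschitz onto its image, such that $$\mathcal H^{2n+1}\Big(S\setminus\bigcup_{i\in\mathbb N}f_i(U_i)\Big)=0 .$$
   Context: A Carnot group is a simply connected nilpotent Lie group whose Lie algebra has a stratification $\mathfrak g=V_1\oplus\dots\oplus V_s$ with $V_{i+1}=[V_1,V_i]$, $V_s\neq\{0\}$, $[V_1,V_s]=\{0\}$; dilations $\delta_\lambda$ act as $\lambda^i$ on $V_i$. A left-invariant homogeneous distance satisfies $d(hg_1,hg_2)=d(g_1,g_2)$ and $d(\delta_\lambda g_1,\delta_\lambda g_2)=\lambda d(g_1,g_2)$; any two are bi-Lipschitz equivalent. The Heisenberg group $\mathbb H^n$ is the Carnot group of step 2 with $V_1=\mathrm{span}\{X_1,\dots,X_{2n}\}$, $V_2=\mathrm{span}\{Y\}$, whose only nonzero brackets of basis vectors (up to skew-symmetry) are $[X_j,X_{n+j}]=Y$, $1\le j\le n$. The product $\mathbb H^{n-1}\times\mathbb R$ is a Carnot group with first stratum $V_1(\mathfrak h^{n-1})\oplus\mathbb R$ (where $\mathfrak h^{n-1}$ is the Lie algebra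 of $\mathbb H^{n-1}$) and second stratum $V_2(\mathfrak h^{n-1})$; it has Hausdorff dimension $2n+1$ and is endowed with a left-invariant homogeneous distance. A $C^\infty$-hypersurface is a nonempty subset that near each of its points is the zero set of a $C^\infty$ function with nonvanishing gradient on it; characteristic points (points where the horizontal bundle is contained in the tangent space) are allowed. $\mathcal H^{2n+1}$ is the Hausdorff measure with respect to $d$. Pauls' notion: for a homogeneous subgroup $\mathbb G$ of a Carnot group, of Hausdorff dimension $Q$, a subset $E$ of a Carnot group is $\mathbb G$-rectifiable if it is covered, up to an $\mathcal H^Q$-null set, by countably many Lipschitz images of subsets of $\mathbb G$. *)

theory Defs
  imports "HOL-Analysis.Analysis"
begin

section \<open>Heisenberg groups and their product with the line\<close>

text \<open>
  Exponential coordinates identify a Carnot group with its Lie algebra; in step at most 2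
  the Baker-Campbell-Hausdorff formula gives the product \<open>p + q + 1/2 [p, q]\<close>.
  A point \<open>(x, y, t)\<close> below is the element
  \<open>\<Sum>j. x\<^sub>j X\<^sub>j + \<Sum>j. y\<^sub>j X\<^bsub>n+j\<^esub> + t Y\<close>, with \<open>n = CARD('n)\<close>.
\<close>

type_synonym 'n heis = "(real ^ 'n) \<times> (real ^ 'n) \<times> real"

definition bch2 :: "('a \<Rightarrow> 'a \<Rightarrow> 'a) \<Rightarrow> 'a \<Rightarrow> 'a \<Rightarrow> 'a::real_vector" where
  "bch2 br p q = p + q + (1 / 2) *\<^sub>R br p q"

fun heis_bracket :: "'n::finite heis \<Rightarrow> 'n heis \<Rightarrow> 'n heis" where
  "heis_bracket (x, y, t) (x', y', t') = (0, 0, x \<bullet> y' - y \<bullet> x')"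

definition heis_mult :: "'n::finite heis \<Rightarrow> 'n heis \<Rightarrow> 'n heis" where
  "heis_mult = bch2 heis_bracket"

fun heis_dil :: "real \<Rightarrow> 'n::finite heis \<Rightarrow> 'n heis" where
  "heis_dil r (x, y, t) = (r *\<^sub>R x, r *\<^sub>R y, r\<^sup>2 * t)"

text \<open>The additional real coordinate commutes with everything and lies in the first stratum.\<close>

type_synonym 'm heis_line = "'m heis \<times> real"

fun heis_line_bracket :: "'m::finite heis_line \<Rightarrow> 'm heis_line \<Rightarrow> 'm heis_line" where
  "heis_line_bracket (p, a) (q, b) = (heis_bracket p q, 0)"

definition heis_line_mult :: "'m::finite heis_line \<Rightarrow> 'm heis_line \<Rightarrow> 'm heis_line" where
  "heis_line_mult = bch2 heis_line_bracket"

fun heis_line_dil :: "real \<Rightarrow> 'm::finite heis_line \<Rightarrow> 'm heis_line" where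
  "heis_line_dil r (p, a) = (heis_dil r p, r * a)"

lemma heis_bracket_basis:
  fixes i j :: "'n::finite"
  shows "heis_bracket (axis i 1, 0, 0) (0, axis j 1, 0) = (0, 0, if i = j then 1 else 0)"
    and "heis_bracket (axis i 1, 0, 0) (axis j 1, 0, 0) = 0"
    and "heis_bracket (0, axis i 1, 0) (0, axis j 1, 0) = 0"
    and "heis_bracket (0, 0, 1) p = 0"
  by (cases p; auto simp: inner_axis_axis zero_prod_def)+

lemma heis_mult_eq:
  "heis_mult (x, y, t) (x', y', t') =
     (x + x', y + y', t + t' + (x \<bullet> y' - y \<bullet> x') / 2)"
  by (simp add: heis_mult_def bch2_def)

lemma heis_line_mult_eq:
  "heis_line_mult (p, a) (q, b) = (heis_mult p q, a + b)"
  by (simp add: heis_line_mult_def heis_mult_def bch2_def)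

lemma heis_mult_group:
  "heis_mult (heis_mult p q) r = heis_mult p (heis_mult q r)"
  "heis_mult 0 p = p" "heis_mult (- p) p = 0"
  by (cases p; cases q; cases r;
      simp add: heis_mult_eq zero_prod_def inner_add_left inner_add_right inner_commute
        add_divide_distrib diff_divide_distrib)+

lemma heis_dil_mult: "heis_dil r (heis_mult p q) = heis_mult (heis_dil r p) (heis_dil r q)"
  by (cases p; cases q; simp add: heis_mult_eq scaleR_add_right algebra_simps power2_eq_square)


section \<open>Left-invariant homogeneous distances\<close>

text \<open>
  No compatibility with the Euclidean topology is required: for the groups above
  it follows from left invariance and homogeneity.
\<close>

definition left_inv_homogeneous_dist ::
    "('a \<Rightarrow> 'a \<Rightarrow> 'a) \<Rightarrow> (real \<Rightarrow> 'a \<Rightarrow> 'a) \<Rightarrow> ('a \<Rightarrow> 'a \<Rightarrow> real) \<Rightarrow> bool" where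
  "left_inv_homogeneous_dist mul dil d \<longleftrightarrow>
     Metric_space UNIV d \<and>
     (\<forall>h p q. d (mul h p) (mul h q) = d p q) \<and>
     (\<forall>r>0. \<forall>p q. d (dil r p) (dil r q) = r * d p q)"

definition bi_Lipschitz_on ::
    "('a \<Rightarrow> 'a \<Rightarrow> real) \<Rightarrow> ('b \<Rightarrow> 'b \<Rightarrow> real) \<Rightarrow> 'a set \<Rightarrow> ('a \<Rightarrow> 'b) \<Rightarrow> bool" where
  "bi_Lipschitz_on d d' U f \<longleftrightarrow>
     (\<exists>L\<ge>1. \<forall>p\<in>U. \<forall>q\<in>U. d p q / L \<le> d' (f p) (f q) \<and> d' (f p) (f q) \<le> L * d p q)"


section \<open>Hausdorff measure of a distance\<close>

definition dist_diam :: "('a \<Rightarrow> 'a \<Rightarrow> real) \<Rightarrow> 'a set \<Rightarrow> ennreal" where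
  "dist_diam d A = (SUP p\<in>A. SUP q\<in>A. ennreal (d p q))"

text \<open>
  Meant for \<open>s > 0\<close>: since \<open>0 powr 0 = 0\<close>, exponent \<open>0\<close> does not give counting measure.
  Sets of infinite diameter are excluded by the bound \<open>\<delta>\<close>. No normalizing
  constant is used.
\<close>

definition hausdorff_content ::
    "('a \<Rightarrow> 'a \<Rightarrow> real) \<Rightarrow> real \<Rightarrow> real \<Rightarrow> 'a set \<Rightarrow> ennreal" where
  "hausdorff_content d s \<delta> A =
     (INF C\<in>{C :: nat \<Rightarrow> 'a set. A \<subseteq> (\<Union>i. C i) \<and> (\<forall>i. dist_diam d (C i) \<le> ennreal \<delta>)}.
        \<Sum>i. ennreal (enn2real (dist_diam d (C i)) powr s))"

definition hausdorff_measure ::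
    "('a \<Rightarrow> 'a \<Rightarrow> real) \<Rightarrow> real \<Rightarrow> 'a set \<Rightarrow> ennreal" where
  "hausdorff_measure d s A = (SUP \<delta>\<in>{0<..}. hausdorff_content d s \<delta> A)"


section \<open>Smooth hypersurfaces\<close>

text \<open>All directional derivatives of order at most \<open>k\<close> exist and are continuous
  (for \<open>U\<close> open, the class \<open>C\<^sup>k\<close>).\<close>

primrec Ck_on :: "nat \<Rightarrow> 'a::euclidean_space set \<Rightarrow> ('a \<Rightarrow> real) \<Rightarrow> bool" where
  "Ck_on 0 U f \<longleftrightarrow> continuous_on U f"
| "Ck_on (Suc k) U f \<longleftrightarrow>
     (\<forall>p\<in>U. f differentiable (at p)) \<and>
     (\<forall>v. Ck_on k U (\<lambda>p. frechet_derivative f (at p) v))"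

definition smooth_on :: "'a::euclidean_space set \<Rightarrow> ('a \<Rightarrow> real) \<Rightarrow> bool" where
  "smooth_on U f \<longleftrightarrow> (\<forall>k. Ck_on k U f)"

definition smooth_hypersurface :: "'a::euclidean_space set \<Rightarrow> bool" where
  "smooth_hypersurface S \<longleftrightarrow>
     S \<noteq> {} \<and>
     (\<forall>p\<in>S. \<exists>U f. open U \<and> p \<in> U \<and> smooth_on U f \<and>
        S \<inter> U = {q \<in> U. f q = 0} \<and>
        (\<forall>q \<in> S \<inter> U. frechet_derivative f (at q) \<noteq> (\<lambda>v. 0)))"

end

theory Submission
  imports Defs
begin

text \<open>
  Every homogeneous distance satisfies \<open>d\<^sup>2 \<approx> |\<Delta>x|\<^sup>2 + |\<Delta>y|\<^sup>2 + |\<tau>|\<close>, where \<open>\<tau>\<close> is the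
  vertical coordinate of \<open>p\<^sup>-\<^sup>1q\<close>. Near a point of \<open>S = {f = 0}\<close> with
  \<open>X\<^sub>k f \<noteq> 0\<close>, the horizontal vector field with components \<open>(Yf, -Xf) / X\<^sub>k f\<close> spans
  the characteristic direction of the horizontal distribution of \<open>S\<close>. For two of its trajectories
  in \<open>S\<close> the derivative of \<open>\<tau>\<close> is a combination of \<open>Xf \<bullet> \<Delta>x + Yf \<bullet> \<Delta>y\<close> at the two
  points, which the Taylor expansion of \<open>f\<close> bounds by the gauge; Gronwall's inequality then shows that
  the flow distorts the gauge by a bounded factor only. Flowing down to the slice \<open>y\<^sub>k = h\<close>, which
  projects to \<open>\<H>\<^bsup>n-1\<^esup>\<close>, and recording \<open>y\<^sub>k\<close> gives a bi-Lipschitz chart with values in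
  \<open>\<H>\<^bsup>n-1\<^esup> \<times> \<real>\<close>.

  Characteristic points form a null set: between two nearby ones \<open>|\<tau>| \<lesssim> |\<Delta>x|\<^sup>2 + |\<Delta>y|\<^sup>2\<close>,
  so locally their distance is bounded by that of their projections to the \<open>2n\<close>-dimensional
  Euclidean space of horizontal coordinates.
\<close>

section \<open>Homogeneous distances and the gauge\<close>

text \<open>The obstacle is the mismatch of orders: \<open>tau\<close> must stay of second order in
  the horizontal increment. Along two trajectories of a general horizontal Lipschitz field,
  \<open>tau\<close> changes at a rate given by the symplectic pairing of the increment with the
  velocities, which is only of first order, so Gronwall's inequality for \<open>gauge2\<close>
  fails. The field used here is rotated from the horizontal gradient of \<open>f\<close>; the
  pairing becomes the horizontal differential of \<open>f\<close>, and equality of the two values of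
  \<open>f\<close> makes it second order. Dividing by the component \<open>A p $ k\<close> gives
  every trajectory the same unit speed in \<open>y_k\<close>. Two points of equal height thus reach
  the slice at the same time and can be compared throughout. For different heights the higher point
  is first moved to the lower height; the move costs at most a multiple of the height difference,
  which the real coordinate of the chart records. The slice has one coordinate more than the target,
  namely \<open>x_k\<close>.\<close>

abbreviation hx :: "'n::finite heis \<Rightarrow> real ^ 'n" where "hx p \<equiv> fst p"
abbreviation hy :: "'n::finite heis \<Rightarrow> real ^ 'n" where "hy p \<equiv> fst (snd p)"
abbreviation ht :: "'n::finite heis \<Rightarrow> real" where "ht p \<equiv> snd (snd p)"

text \<open>The vertical coordinate of \<open>p\<^sup>-\<^sup>1q\<close>.\<close>

definition tau :: "'n::finite heis \<Rightarrow> 'n heis \<Rightarrow> real" where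
  "tau p q = ht q - ht p - (hx p \<bullet> hy q - hy p \<bullet> hx q) / 2"

definition hdist2 :: "'n::finite heis \<Rightarrow> 'n heis \<Rightarrow> real" where
  "hdist2 p q = (norm (hx q - hx p))\<^sup>2 + (norm (hy q - hy p))\<^sup>2"

text \<open>A squared quasi-distance, of homogeneity degree \<open>2\<close> under the dilations.\<close>

definition gauge2 :: "'n::finite heis \<Rightarrow> 'n heis \<Rightarrow> real" where
  "gauge2 p q = hdist2 p q + \<bar>tau p q\<bar>"

definition line_gauge2 :: "'m::finite heis_line \<Rightarrow> 'm heis_line \<Rightarrow> real" where
  "line_gauge2 u v = gauge2 (fst u) (fst v) + (snd v - snd u)\<^sup>2"

lemma tau_swap: "tau q p = - tau p q"
  by (simp add: tau_def inner_commute field_simps)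

lemma hdist2_swap: "hdist2 q p = hdist2 p q"
  by (simp add: hdist2_def norm_minus_commute)

lemma gauge2_swap: "gauge2 q p = gauge2 p q"
  by (simp add: gauge2_def hdist2_swap[of q] tau_swap[of q])

lemma hdist2_nonneg [simp]: "0 \<le> hdist2 p q"
  by (simp add: hdist2_def)

lemma gauge2_nonneg [simp]: "0 \<le> gauge2 p q"
  by (simp add: gauge2_def)

text \<open>Exhibits \<open>gauge2\<close> as a function of the left quotient alone, the form that
  \<open>homogeneous_gauge_compare\<close> requires.\<close>

lemma gauge2_eq_heis_mult:
  "gauge2 p q = (case heis_mult (- p) q of (x, y, t) \<Rightarrow> (norm x)\<^sup>2 + (norm y)\<^sup>2 + \<bar>t\<bar>)"
  by (cases p; cases q) (simp add: heis_mult_eq gauge2_def hdist2_def tau_def inner_commute field_simps)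

text \<open>The quotient of \<open>p\<close> and \<open>r\<close> is the product of the quotients of
  \<open>p\<close>, \<open>q\<close> and of \<open>q\<close>, \<open>r\<close>; the last term is
  half of their bracket.\<close>

lemma tau_trans:
  "tau p r = tau p q + tau q r
     + ((hx q - hx p) \<bullet> (hy r - hy q) - (hy q - hy p) \<bullet> (hx r - hx q)) / 2"
  by (simp add: tau_def inner_diff_left inner_diff_right inner_commute field_simps)

lemma omega_bound:
  fixes a b c e :: "'a::real_inner"
  shows "\<bar>a \<bullet> c - b \<bullet> e\<bar> \<le> ((norm a)\<^sup>2 + (norm b)\<^sup>2 + (norm c)\<^sup>2 + (norm e)\<^sup>2) / 2"
proof -
  have "\<bar>a \<bullet> c\<bar> \<le> norm a * norm c" "\<bar>b \<bullet> e\<bar> \<le> norm b * norm e"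
    by (simp_all add: Cauchy_Schwarz_ineq2)
  moreover have "norm a * norm c \<le> ((norm a)\<^sup>2 + (norm c)\<^sup>2) / 2"
    "norm b * norm e \<le> ((norm b)\<^sup>2 + (norm e)\<^sup>2) / 2"
    using sum_squares_bound[of "norm a" "norm c"] sum_squares_bound[of "norm b" "norm e"] by auto
  moreover have "\<bar>a \<bullet> c - b \<bullet> e\<bar> \<le> \<bar>a \<bullet> c\<bar> + \<bar>b \<bullet> e\<bar>"
    by (rule abs_triangle_ineq4)
  ultimately show ?thesis unfolding add_divide_distrib by argo
qed

lemma norm_add_sq:
  fixes a b :: "'a::real_normed_vector"
  shows "(norm (a + b))\<^sup>2 \<le> 2 * (norm a)\<^sup>2 + 2 * (norm b)\<^sup>2"
proof -
  have "(norm (a + b))\<^sup>2 \<le> (norm a + norm b)\<^sup>2"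
    by (simp add: norm_triangle_ineq power_mono)
  also have "\<dots> \<le> 2 * (norm a)\<^sup>2 + 2 * (norm b)\<^sup>2"
    using sum_squares_bound[of "norm a" "norm b"] by (simp add: power2_sum)
  finally show ?thesis .
qed

text \<open>Squaring costs the horizontal part a factor 2 and the bracket in
  \<open>tau_trans\<close> adds 1/4, so 9/4, rounded up to 3.\<close>

lemma gauge2_triangle: "gauge2 p r \<le> 3 * (gauge2 p q + gauge2 q r)"
proof -
  have "hdist2 p r \<le> 2 * hdist2 p q + 2 * hdist2 q r"
    using norm_add_sq[of "hx q - hx p" "hx r - hx q"] norm_add_sq[of "hy q - hy p" "hy r - hy q"]
    by (simp add: hdist2_def)
  moreover have "\<bar>tau p r\<bar> \<le> \<bar>tau p q\<bar> + \<bar>tau q r\<bar> + (hdist2 p q + hdist2 q r) / 4"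
    using omega_bound[of "hx q - hx p" "hy r - hy q" "hy q - hy p" "hx r - hx q"]
    unfolding tau_trans[of p r q] hdist2_def abs_le_iff by (auto simp: field_simps)
  moreover have "hdist2 p q \<ge> 0" "hdist2 q r \<ge> 0" by simp_all
  ultimately show ?thesis
    unfolding gauge2_def by argo
qed

text \<open>Covers both groups at once. The bound \<open>upper\<close>, to be proved for each group
  separately, yields continuity of the distance from 0; compactness of the unit sphere of
  \<open>g\<close> then gives the reverse bound there, and dilations spread it to all
  points.\<close>

lemma homogeneous_gauge_compare:
  fixes d :: "'a::euclidean_space \<Rightarrow> 'a \<Rightarrow> real" and g :: "'a \<Rightarrow> real"
  assumes d: "left_inv_homogeneous_dist mul dil d"
    and inv: "\<And>p. mul (- p) p = 0" "\<And>p. mul 0 p = p"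
    and dil0: "\<And>r. dil r 0 = 0"
    and dil1: "\<And>r p. r > 0 \<Longrightarrow> dil (inverse r) (dil r p) = p"
    and contmul: "\<And>p. continuous_on UNIV (\<lambda>q. mul (- p) q)"
    and contg: "continuous_on UNIV g"
    and gdil: "\<And>r p. r > 0 \<Longrightarrow> g (dil r p) = r\<^sup>2 * g p"
    and g0: "g 0 = 0" and gpos: "\<And>p. p \<noteq> 0 \<Longrightarrow> g p > 0"
    and bdd: "bounded {p. g p = 1}"
    and upper: "\<And>p. (d 0 p)\<^sup>2 \<le> K * g p"
  shows "\<exists>C\<ge>1. \<forall>p q. g (mul (- p) q) \<le> C * (d p q)\<^sup>2 \<and> (d p q)\<^sup>2 \<le> C * g (mul (- p) q)"
proof -
  interpret Metric_space UNIV d using d by (simp add: left_inv_homogeneous_dist_def)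
  have li: "d (mul h p) (mul h q) = d p q" for h p q
    using d by (simp add: left_inv_homogeneous_dist_def)
  have hom: "r > 0 \<Longrightarrow> d (dil r p) (dil r q) = r * d p q" for r p q
    using d by (simp add: left_inv_homogeneous_dist_def)
  have d0: "d p q = d 0 (mul (- p) q)" for p q
    using li[of "-p" p q] inv by simp
  have gnn: "g p \<ge> 0" for p using g0 gpos[of p] by (cases "p = 0") auto
  define N where "N = d 0"
  \<comment> \<open>By the triangle inequality \<open>N\<close> varies by at most
    \<open>d p q\<close>, and \<open>upper\<close> squeezes this to 0 as \<open>q\<close> tends to
    \<open>p\<close>.\<close>
  have contN: "continuous_on UNIV N"
  proof (subst continuous_on_eq_continuous_at[OF open_UNIV], rule ballI)
    fix p :: 'a
    have "isCont (\<lambda>q. sqrt (K * g (mul (- p) q))) p"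
      using contmul[of p] contg
      by (intro continuous_intros isCont_o2[of p "mul (- p)" g]) (auto simp: continuous_on_eq_continuous_at)
    then have lim: "(\<lambda>q. sqrt (K * g (mul (- p) q))) \<midarrow>p\<rightarrow> 0"
      using inv g0 by (simp add: isCont_def)
    have "norm (N q - N p) \<le> sqrt (K * g (mul (- p) q))" for q
    proof -
      have "\<bar>N q - N p\<bar> \<le> d p q"
        unfolding N_def using triangle[of 0 p q] triangle[of 0 q p] commute[of p q] by auto
      also have "\<dots> \<le> sqrt (K * g (mul (- p) q))"
        using upper[of "mul (- p) q"] d0[of p q] by (simp add: real_le_rsqrt)
      finally show ?thesis by simp
    qed
    then have "(\<lambda>q. N q - N p) \<midarrow>p\<rightarrow> 0"
      by (intro Lim_null_comparison[OF _ lim]) auto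
    then show "isCont N p" by (simp add: isCont_def LIM_zero_iff)
  qed
  have "closed {p. g p = 1}"
    using continuous_closed_vimage[of "{1}" g] contg
    by (simp add: continuous_on_eq_continuous_at vimage_def)
  then have comp: "compact {p. g p = 1}" using bdd compact_eq_bounded_closed by blast
  obtain c where c: "c > 0" "\<And>p. g p = 1 \<Longrightarrow> c \<le> N p"
  proof (cases "{p. g p = 1} = {}")
    case True then show ?thesis using that[of 1] by auto
  next
    case False
    obtain m where m: "g m = 1" "\<And>p. g p = 1 \<Longrightarrow> N m \<le> N p"
      using continuous_attains_inf[OF comp False continuous_on_subset[OF contN subset_UNIV]] by auto
    have "m \<noteq> 0" using m g0 by auto
    then have "N m > 0" unfolding N_def by auto
    then show ?thesis using that m by blast
  qed
  have low: "c\<^sup>2 * g p \<le> (N p)\<^sup>2" for p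
  proof (cases "p = 0")
    case False
    \<comment> \<open>Dilating by \<open>1 / r\<close> moves \<open>p\<close> to the unit sphere of
      \<open>g\<close>, where \<open>N\<close> is at least \<open>c\<close>.\<close>
    define r where "r = sqrt (g p)"
    have r: "r > 0" "r\<^sup>2 = g p" using gpos[OF False] gnn by (auto simp: r_def)
    have "g (dil (inverse r) p) = 1" using gdil[of "inverse r" p] r by (simp add: power_inverse) (metis r(1) left_inverse less_irrefl zero_less_power)
    then have "c \<le> N (dil (inverse r) p)" by (rule c)
    also have "\<dots> = inverse r * N p"
      using hom[of "inverse r" 0 p] r by (simp add: N_def dil0)
    finally have "c * r \<le> N p" using r by (simp add: field_simps)
    then have "(c * r)\<^sup>2 \<le> (N p)\<^sup>2" using c r by (intro power_mono) auto
    then show ?thesis using r by (simp add: power_mult_distrib)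
  qed (simp add: g0)
  define C where "C = max 1 (max K (1 / c\<^sup>2))"
  have "g (mul (- p) q) \<le> C * (d p q)\<^sup>2 \<and> (d p q)\<^sup>2 \<le> C * g (mul (- p) q)" for p q
  proof
    have "g (mul (- p) q) \<le> 1 / c\<^sup>2 * (d p q)\<^sup>2"
      using low[of "mul (- p) q"] c d0[of p q] by (simp add: N_def field_simps)
    also have "\<dots> \<le> C * (d p q)\<^sup>2" by (intro mult_right_mono) (auto simp: C_def)
    finally show "g (mul (- p) q) \<le> C * (d p q)\<^sup>2" .
    have "(d p q)\<^sup>2 \<le> K * g (mul (- p) q)" using upper d0[of p q] by simp
    also have "\<dots> \<le> C * g (mul (- p) q)" by (intro mult_right_mono) (auto simp: C_def gnn)
    finally show "(d p q)\<^sup>2 \<le> C * g (mul (- p) q)" .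
  qed
  then show ?thesis by (intro exI[of _ C]) (auto simp: C_def)
qed

text \<open>Here \<phi> embeds a vector space as a commutative subgroup on which dilations act by
  scaling, so the distance from 0 becomes a seminorm: subadditive by left invariance, homogeneous by
  dilation, and even by left translation with the inverse.\<close>

lemma one_parameter_bound:
  fixes \<phi> :: "'v::real_vector \<Rightarrow> 'a::zero"
  assumes d: "left_inv_homogeneous_dist mul dil d"
    and "\<phi> 0 = 0" "\<And>u v. mul (\<phi> u) (\<phi> v) = \<phi> (u + v)" "\<And>r u. r > 0 \<Longrightarrow> dil r (\<phi> u) = \<phi> (r *\<^sub>R u)"
    and mul0: "\<And>p. mul p 0 = p"
  shows "d 0 (\<phi> (u + v)) \<le> d 0 (\<phi> u) + d 0 (\<phi> v)"
    "d 0 (\<phi> (c *\<^sub>R u)) \<le> \<bar>c\<bar> * d 0 (\<phi> u)"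
proof -
  interpret Metric_space UNIV d using d by (simp add: left_inv_homogeneous_dist_def)
  have li: "d (mul h p) (mul h q) = d p q" for h p q
    using d by (simp add: left_inv_homogeneous_dist_def)
  have hom: "r > 0 \<Longrightarrow> d (dil r p) (dil r q) = r * d p q" for r p q
    using d by (simp add: left_inv_homogeneous_dist_def)
  have "d (\<phi> u) (\<phi> (u + v)) = d 0 (\<phi> v)"
    using li[of "\<phi> u" 0 "\<phi> v"] assms by simp
  then show "d 0 (\<phi> (u + v)) \<le> d 0 (\<phi> u) + d 0 (\<phi> v)"
    using triangle[of 0 "\<phi> u" "\<phi> (u + v)"] by simp
  have pos: "d 0 (\<phi> (c *\<^sub>R u)) = c * d 0 (\<phi> u)" if "c > 0" for c u
    using hom[OF that, of "\<phi> 0" "\<phi> u"] assms(2) assms(4)[OF that, of 0] assms(4)[OF that, of u] by simp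
  have neg: "d 0 (\<phi> (- u)) = d 0 (\<phi> u)" for u
    using li[of "\<phi> (-u)" "\<phi> u" 0] mul0 assms(2) assms(3)[of "-u" u] commute by simp
  consider "c > 0" | "c = 0" | "c < 0" by linarith
  then show "d 0 (\<phi> (c *\<^sub>R u)) \<le> \<bar>c\<bar> * d 0 (\<phi> u)"
    using pos[of c u] pos[of "-c" u] neg[of "c *\<^sub>R u"] assms(2) by cases auto
qed

text \<open>A seminorm on a finite-dimensional space is bounded by the Euclidean norm: expand in the
  basis.\<close>

lemma one_parameter_norm_bound:
  fixes \<phi> :: "real ^ 'n::finite \<Rightarrow> 'a::zero"
  assumes d: "left_inv_homogeneous_dist mul dil d"
    and "\<phi> 0 = 0" "\<And>u v. mul (\<phi> u) (\<phi> v) = \<phi> (u + v)" "\<And>r u. r > 0 \<Longrightarrow> dil r (\<phi> u) = \<phi> (r *\<^sub>R u)"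
    and mul0: "\<And>p. mul p 0 = p"
  shows "d 0 (\<phi> u) \<le> (\<Sum>b\<in>Basis. d 0 (\<phi> b)) * norm u"
proof -
  interpret Metric_space UNIV d using d by (simp add: left_inv_homogeneous_dist_def)
  have sub: "d 0 (\<phi> (\<Sum>b\<in>B. h b)) \<le> (\<Sum>b\<in>B. d 0 (\<phi> (h b)))" if "finite B" for B and h :: "real^'n \<Rightarrow> real^'n"
    using that
  proof (induction B)
    case (insert b B)
    have "d 0 (\<phi> (h b + (\<Sum>b\<in>B. h b))) \<le> d 0 (\<phi> (h b)) + d 0 (\<phi> (\<Sum>b\<in>B. h b))"
      by (rule one_parameter_bound(1)[OF assms])
    then show ?case using insert by simp
  qed (simp add: assms(2))
  have "d 0 (\<phi> u) \<le> (\<Sum>b\<in>Basis. d 0 (\<phi> ((u \<bullet> b) *\<^sub>R b)))"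
    using sub[OF finite_Basis, of "\<lambda>b. (u \<bullet> b) *\<^sub>R b"] by (simp add: euclidean_representation)
  also have "\<dots> \<le> (\<Sum>b\<in>Basis. norm u * d 0 (\<phi> b))"
  proof (intro sum_mono)
    fix b :: "real^'n" assume b: "b \<in> Basis"
    have "d 0 (\<phi> ((u \<bullet> b) *\<^sub>R b)) \<le> \<bar>u \<bullet> b\<bar> * d 0 (\<phi> b)"
      by (rule one_parameter_bound(2)[OF assms])
    also have "\<dots> \<le> norm u * d 0 (\<phi> b)"
      using Basis_le_norm[OF b, of u] by (intro mult_right_mono) auto
    finally show "d 0 (\<phi> ((u \<bullet> b) *\<^sub>R b)) \<le> norm u * d 0 (\<phi> b)" .
  qed
  finally show ?thesis by (simp add: sum_distrib_left mult.commute)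
qed

lemma heis_dist_upper:
  fixes d :: "'n::finite heis \<Rightarrow> 'n heis \<Rightarrow> real"
  assumes d: "left_inv_homogeneous_dist heis_mult heis_dil d"
  shows "\<exists>K. \<forall>p. (d 0 p)\<^sup>2 \<le> K * gauge2 0 p"
proof -
  interpret Metric_space UNIV d using d by (simp add: left_inv_homogeneous_dist_def)
  have li: "d (heis_mult h p) (heis_mult h q) = d p q" for h p q
    using d unfolding left_inv_homogeneous_dist_def by blast
  have hom: "r > 0 \<Longrightarrow> d (heis_dil r p) (heis_dil r q) = r * d p q" for r p q
    using d unfolding left_inv_homogeneous_dist_def by blast
  have mul0: "heis_mult p 0 = p" for p :: "'n heis"
    by (cases p) (simp add: heis_mult_eq zero_prod_def)
  define K1 where "K1 = (\<Sum>b\<in>Basis. d 0 (b :: real^'n, 0, 0))"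
  define K2 where "K2 = (\<Sum>b\<in>Basis. d 0 (0, b :: real^'n, 0))"
  \<comment> \<open>Dilations by positive factors keep the sign of \<open>t\<close>, so both
    half-axes need a representative.\<close>
  define K3 where "K3 = max (d 0 (0, 0, 1)) (d 0 (0, 0, -1))"
  have bx: "d 0 (x, 0, 0) \<le> K1 * norm x" for x
    using one_parameter_norm_bound[OF d, of "\<lambda>x. (x, 0, 0)" x]
    by (auto simp: K1_def mul0 heis_mult_eq zero_prod_def)
  have bY: "d 0 (0, y, 0) \<le> K2 * norm y" for y
    using one_parameter_norm_bound[OF d, of "\<lambda>y. (0, y, 0)" y]
    by (auto simp: K2_def mul0 heis_mult_eq zero_prod_def)
  have bt: "d 0 (0, 0, t) \<le> K3 * sqrt \<bar>t\<bar>" for t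
  proof (cases "t = 0")
    case False
    then have r: "sqrt \<bar>t\<bar> > 0" by simp
    have "d 0 (0, 0, t) = sqrt \<bar>t\<bar> * d 0 (0, 0, sgn t)"
      using hom[OF r, of 0 "(0, 0, sgn t)"] by (simp add: zero_prod_def abs_mult_sgn)
    also have "\<dots> \<le> sqrt \<bar>t\<bar> * K3"
      using False by (intro mult_left_mono) (auto simp: K3_def sgn_if)
    finally show ?thesis by (simp add: mult.commute)
  qed (simp flip: zero_prod_def)
  have K: "K1 \<ge> 0" "K2 \<ge> 0" "K3 \<ge> 0" by (auto simp: K1_def K2_def K3_def sum_nonneg max_def)
  define K where "K = K1 + K2 + K3"
  have "(d 0 p)\<^sup>2 \<le> (9 * K\<^sup>2) * gauge2 0 p" for p
  proof -
    obtain x y t where p: "p = (x, y, t)" by (cases p)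
    define G where "G = gauge2 0 p"
    have G: "G = (norm x)\<^sup>2 + (norm y)\<^sup>2 + \<bar>t\<bar>"
      by (simp add: p G_def gauge2_def hdist2_def tau_def)
    \<comment> \<open>Chosen so that \<open>p\<close> is the product of \<open>(x, 0, 0)\<close>,
      \<open>(0, y, 0)\<close> and \<open>(0, 0, u)\<close>; left invariance then estimates the
      three factors separately.\<close>
    define u where "u = t - (x \<bullet> y) / 2"
    have "d 0 p \<le> d 0 (x, 0, 0) + d (x, 0, 0) (x, y, (x \<bullet> y) / 2) + d (x, y, (x \<bullet> y) / 2) p"
      using triangle[of 0 "(x, y, (x \<bullet> y) / 2)" p] triangle[of 0 "(x, 0, 0)" "(x, y, (x \<bullet> y) / 2)"] by simp
    also have "d (x, 0, 0) (x, y, (x \<bullet> y) / 2) = d 0 (0, y, 0)"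
      using li[of "(x, 0, 0)" 0 "(0, y, 0)"] by (simp add: mul0 heis_mult_eq)
    also have "d (x, y, (x \<bullet> y) / 2) p = d 0 (0, 0, u)"
      using li[of "(x, y, (x \<bullet> y) / 2)" 0 "(0, 0, u)"] by (simp add: mul0 heis_mult_eq p u_def)
    finally have "d 0 p \<le> K1 * norm x + K2 * norm y + K3 * sqrt \<bar>u\<bar>"
      using bx[of x] bY[of y] bt[of u] by linarith
    moreover have "norm x \<le> sqrt (2 * G)" "norm y \<le> sqrt (2 * G)"
      by (auto intro!: real_le_rsqrt simp: G)
    moreover have "sqrt \<bar>u\<bar> \<le> sqrt (2 * G)"
    proof -
      have "\<bar>x \<bullet> y\<bar> \<le> norm x * norm y" by (rule Cauchy_Schwarz_ineq2)
      then have "\<bar>x \<bullet> y\<bar> \<le> ((norm x)\<^sup>2 + (norm y)\<^sup>2) / 2"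
        using sum_squares_bound[of "norm x" "norm y"] by auto
      moreover have "(norm x)\<^sup>2 \<ge> 0" "(norm y)\<^sup>2 \<ge> 0" by auto
      ultimately have "\<bar>u\<bar> \<le> 2 * G" unfolding u_def G by argo
      then show ?thesis by simp
    qed
    ultimately have "d 0 p \<le> K * sqrt (2 * G)"
      using K unfolding K_def distrib_right
      by (smt (verit, best) mult_left_mono)
    then have "(d 0 p)\<^sup>2 \<le> (K * sqrt (2 * G))\<^sup>2" by (intro power_mono) auto
    also have "\<dots> = 2 * K\<^sup>2 * G" using gauge2_nonneg[of 0 p] by (simp add: power_mult_distrib G_def)
    also have "\<dots> \<le> 9 * K\<^sup>2 * G" using gauge2_nonneg[of 0 p] by (simp add: G_def mult_right_mono)
    finally show ?thesis by (simp add: G_def)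
  qed
  then show ?thesis by blast
qed

lemma heis_dist_gauge:
  fixes d :: "'n::finite heis \<Rightarrow> 'n heis \<Rightarrow> real"
  assumes d: "left_inv_homogeneous_dist heis_mult heis_dil d"
  shows "\<exists>C\<ge>1. \<forall>p q. gauge2 p q \<le> C * (d p q)\<^sup>2 \<and> (d p q)\<^sup>2 \<le> C * gauge2 p q"
proof -
  obtain K where K: "\<And>p. (d 0 p)\<^sup>2 \<le> K * gauge2 0 p" using heis_dist_upper[OF d] by blast
  have g: "gauge2 0 p = (norm (hx p))\<^sup>2 + (norm (hy p))\<^sup>2 + \<bar>ht p\<bar>" for p :: "'n heis"
    by (simp add: gauge2_def hdist2_def tau_def)
  have bd: "bounded {p :: 'n heis. gauge2 0 p = 1}"
    unfolding bounded_iff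
  proof (intro exI ballI)
    fix p :: "'n heis" assume "p \<in> {p. gauge2 0 p = 1}"
    then have *: "(norm (hx p))\<^sup>2 + (norm (hy p))\<^sup>2 + \<bar>ht p\<bar> = 1" by (simp add: g)
    then have "(norm (hx p))\<^sup>2 \<le> 1" "(norm (hy p))\<^sup>2 \<le> 1" "\<bar>ht p\<bar> \<le> 1"
      by (smt (verit) zero_le_power2)+
    then have "norm (hx p) \<le> 1" "norm (hy p) \<le> 1" "norm (ht p) \<le> 1"
      by (auto simp: power_le_one_iff abs_square_le_1)
    then show "norm p \<le> 3"
      using norm_Pair_le[of "hx p" "snd p"] norm_Pair_le[of "hy p" "ht p"] by simp
  qed
  have mm: "heis_mult (- p) q = (hx q - hx p, hy q - hy p, tau p q)" for p q :: "'n heis"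
    by (cases p; cases q) (simp add: heis_mult_eq tau_def diff_divide_distrib)
  have gpos: "gauge2 0 p > 0" if "p \<noteq> 0" for p :: "'n heis"
  proof -
    have "hx p \<noteq> 0 \<or> hy p \<noteq> 0 \<or> ht p \<noteq> 0" using that by (auto simp: prod_eq_iff)
    then show ?thesis unfolding g
      by (smt (verit) zero_less_power2 zero_le_power2 norm_eq_zero)
  qed
  have gdil: "gauge2 0 (heis_dil r p) = r\<^sup>2 * gauge2 0 p" for r :: real and p :: "'n heis"
    by (cases p) (simp add: g power_mult_distrib abs_mult algebra_simps)
  have dil1: "heis_dil (inverse r) (heis_dil r p) = p" if "r > 0" for r :: real and p :: "'n heis"
    using that by (cases p) (auto simp: field_simps)
  have dil0: "heis_dil r (0 :: 'n heis) = 0" for r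
    by (simp add: zero_prod_def)
  have "\<exists>C\<ge>1. \<forall>p q. gauge2 0 (heis_mult (- p) q) \<le> C * (d p q)\<^sup>2
      \<and> (d p q)\<^sup>2 \<le> C * gauge2 0 (heis_mult (- p) q)"
  proof (rule homogeneous_gauge_compare[OF d _ _ dil0 dil1 _ _ gdil _ gpos bd K])
    show "heis_mult (- p) p = 0" "heis_mult 0 p = p" for p :: "'n heis"
      by (rule heis_mult_group(3) heis_mult_group(2))+
    show "continuous_on UNIV (heis_mult (- p))" for p :: "'n heis"
      unfolding mm tau_def by (intro continuous_intros) auto
    show "continuous_on UNIV (gauge2 (0 :: 'n heis))"
      unfolding g by (intro continuous_intros)
    show "gauge2 0 (0 :: 'n heis) = 0" by (simp add: gauge2_def hdist2_def tau_def)
  qed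
  moreover have "gauge2 0 (heis_mult (- p) q) = gauge2 p q" for p q :: "'n heis"
    by (simp add: gauge2_eq_heis_mult[of p q] g split: prod.split)
  ultimately show ?thesis by simp
qed

lemma heis_line_dist_gauge:
  fixes d :: "'m::finite heis_line \<Rightarrow> 'm heis_line \<Rightarrow> real"
  assumes d: "left_inv_homogeneous_dist heis_line_mult heis_line_dil d"
  shows "\<exists>C\<ge>1. \<forall>u v. line_gauge2 u v \<le> C * (d u v)\<^sup>2 \<and> (d u v)\<^sup>2 \<le> C * line_gauge2 u v"
proof -
  interpret Metric_space UNIV d using d by (simp add: left_inv_homogeneous_dist_def)
  have li: "d (heis_line_mult h p) (heis_line_mult h q) = d p q" for h p q
    using d unfolding left_inv_homogeneous_dist_def by blast
  have hom: "r > 0 \<Longrightarrow> d (heis_line_dil r p) (heis_line_dil r q) = r * d p q" for r p q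
    using d unfolding left_inv_homogeneous_dist_def by blast
  have mul0: "heis_mult p 0 = p" "heis_mult 0 p = p" for p :: "'m heis"
    by (cases p; simp add: heis_mult_eq zero_prod_def)+
  have mul0': "heis_line_mult p 0 = p" for p :: "'m heis_line"
    by (cases p) (simp add: heis_line_mult_eq mul0 zero_prod_def[where 'a = "'m heis"])
  have dil0: "heis_dil r (0 :: 'm heis) = 0" for r
    by (simp add: zero_prod_def)
  \<comment> \<open>Restricting \<open>d\<close> to the subgroup with vanishing line coordinate
    reduces the upper bound to the Heisenberg case plus one commuting direction.\<close>
  have "left_inv_homogeneous_dist heis_mult heis_dil (\<lambda>p q. d (p, 0) (q, 0))"
    unfolding left_inv_homogeneous_dist_def
  proof (intro conjI allI impI)
    show "Metric_space UNIV (\<lambda>p q. d (p, 0) (q, 0))"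
      by unfold_locales (auto simp: commute triangle)
    show "d (heis_mult h p, 0) (heis_mult h q, 0) = d (p, 0) (q, 0)" for h p q
      using li[of "(h, 0)" "(p, 0)" "(q, 0)"] by (simp add: heis_line_mult_eq)
    show "d (heis_dil r p, 0) (heis_dil r q, 0) = r * d (p, 0) (q, 0)" if "r > 0" for r p q
      using hom[OF that, of "(p, 0)" "(q, 0)"] by simp
  qed
  from heis_dist_upper[OF this] obtain K where K: "\<And>p. (d 0 (p, 0))\<^sup>2 \<le> K * gauge2 0 p"
    unfolding zero_prod_def[where 'a = "'m heis"] by blast
  define K1 where "K1 = d 0 (0, 1)"
  define M where "M = max (2 * K) (2 * K1\<^sup>2)"
  have upper: "(d 0 u)\<^sup>2 \<le> M * line_gauge2 0 u" for u
  proof -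
    obtain p a where u: "u = (p, a)" by (cases u)
    have "d 0 (0, a) \<le> \<bar>a\<bar> * K1"
      using one_parameter_bound(2)[OF d, of "\<lambda>a. (0, a)" a 1]
      by (auto simp: K1_def mul0' mul0 heis_line_mult_eq dil0 zero_prod_def[where 'a = "'m heis"])
    moreover have "d (p, 0) (p, a) = d 0 (0, a)"
      using li[of "(p, 0)" 0 "(0, a)"] by (simp add: mul0' mul0 heis_line_mult_eq)
    ultimately have "d 0 u \<le> d 0 (p, 0) + \<bar>a\<bar> * K1"
      using triangle[of 0 "(p, 0)" u] by (simp add: u)
    then have "(d 0 u)\<^sup>2 \<le> (norm (d 0 (p, 0) + \<bar>a\<bar> * K1))\<^sup>2"
      by (auto intro: power_mono)
    also have "\<dots> \<le> 2 * (d 0 (p, 0))\<^sup>2 + 2 * (\<bar>a\<bar> * K1)\<^sup>2"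
      using norm_add_sq[of "d 0 (p, 0)" "\<bar>a\<bar> * K1"] by simp
    also have "\<dots> \<le> 2 * K * gauge2 0 p + 2 * K1\<^sup>2 * a\<^sup>2"
      using K[of p] by (simp add: power_mult_distrib)
    also have "\<dots> \<le> M * gauge2 0 p + M * a\<^sup>2"
      by (intro add_mono mult_right_mono) (auto simp: M_def)
    finally show ?thesis by (simp add: u line_gauge2_def algebra_simps)
  qed
  have g: "line_gauge2 0 u = (norm (hx (fst u)))\<^sup>2 + (norm (hy (fst u)))\<^sup>2 + \<bar>ht (fst u)\<bar> + (snd u)\<^sup>2"
    for u :: "'m heis_line"
    by (simp add: line_gauge2_def gauge2_def hdist2_def tau_def)
  have bd: "bounded {p :: 'm heis_line. line_gauge2 0 p = 1}"
    unfolding bounded_iff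
  proof (intro exI ballI)
    fix u :: "'m heis_line" assume "u \<in> {p. line_gauge2 0 p = 1}"
    then have *: "(norm (hx (fst u)))\<^sup>2 + (norm (hy (fst u)))\<^sup>2 + \<bar>ht (fst u)\<bar> + (snd u)\<^sup>2 = 1" by (simp add: g)
    then have "(norm (hx (fst u)))\<^sup>2 \<le> 1" "(norm (hy (fst u)))\<^sup>2 \<le> 1" "\<bar>ht (fst u)\<bar> \<le> 1" "(snd u)\<^sup>2 \<le> 1"
      by (smt (verit) zero_le_power2)+
    then have "norm (hx (fst u)) \<le> 1" "norm (hy (fst u)) \<le> 1" "norm (ht (fst u)) \<le> 1" "norm (snd u) \<le> 1"
      by (auto simp: power_le_one_iff abs_square_le_1)
    then show "norm u \<le> 4"
      using norm_Pair_le[of "hx (fst u)" "snd (fst u)"] norm_Pair_le[of "hy (fst u)" "ht (fst u)"]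
        norm_Pair_le[of "fst u" "snd u"] by simp
  qed
  have mm: "heis_line_mult (- u) v = ((hx (fst v) - hx (fst u), hy (fst v) - hy (fst u), tau (fst u) (fst v)), snd v - snd u)"
    for u v :: "'m heis_line"
    by (cases u; cases v) (auto simp: heis_line_mult_eq heis_mult_eq tau_def diff_divide_distrib)
  have gpos: "line_gauge2 0 u > 0" if "u \<noteq> 0" for u :: "'m heis_line"
  proof -
    have "hx (fst u) \<noteq> 0 \<or> hy (fst u) \<noteq> 0 \<or> ht (fst u) \<noteq> 0 \<or> snd u \<noteq> 0" using that by (auto simp: prod_eq_iff)
    then show ?thesis unfolding g
      by (smt (verit) zero_less_power2 zero_le_power2 norm_eq_zero)
  qed
  have gdil: "line_gauge2 0 (heis_line_dil r u) = r\<^sup>2 * line_gauge2 0 u" for r :: real and u :: "'m heis_line"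
    by (cases u) (auto simp add: g power_mult_distrib abs_mult algebra_simps)
  have dil1: "heis_line_dil (inverse r) (heis_line_dil r u) = u" if "r > 0" for r :: real and u :: "'m heis_line"
    using that by (cases u) (auto simp: field_simps)
  have lmul0: "heis_line_mult 0 u = u" for u :: "'m heis_line"
    by (cases u) (simp add: heis_line_mult_eq mul0 zero_prod_def[where 'a = "'m heis"])
  have ldil0: "heis_line_dil r (0 :: 'm heis_line) = 0" for r
    by (simp add: zero_prod_def)
  have linv: "heis_line_mult (- u) u = 0" for u :: "'m heis_line"
    by (simp add: mm tau_def zero_prod_def inner_commute)
  have "\<exists>C\<ge>1. \<forall>p q. line_gauge2 0 (heis_line_mult (- p) q) \<le> C * (d p q)\<^sup>2
      \<and> (d p q)\<^sup>2 \<le> C * line_gauge2 0 (heis_line_mult (- p) q)"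
  proof (rule homogeneous_gauge_compare[OF d linv lmul0 ldil0 dil1 _ _ gdil _ gpos bd upper])
    show "continuous_on UNIV (heis_line_mult (- u))" for u :: "'m heis_line"
      unfolding mm tau_def by (intro continuous_intros) auto
    show "continuous_on UNIV (line_gauge2 (0 :: 'm heis_line))"
      unfolding g by (intro continuous_intros)
    show "line_gauge2 0 (0 :: 'm heis_line) = 0" by (simp add: line_gauge2_def gauge2_def hdist2_def tau_def)
  qed
  moreover have "line_gauge2 0 (heis_line_mult (- u) v) = line_gauge2 u v" for u v :: "'m heis_line"
    by (simp add: mm g line_gauge2_def gauge2_def hdist2_def tau_def)
  ultimately show ?thesis by simp
qed

section \<open>Ordinary differential equations with Lipschitz fields\<close>

text \<open>Picard iteration: for \<open>L * a < 1\<close> the integral operator contracts the space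
  of bounded continuous functions in the supremum distance.\<close>

lemma lipschitz_ode_exists:
  fixes X :: "'a::euclidean_space \<Rightarrow> 'a"
  assumes L: "L-lipschitz_on UNIV X" and a: "0 \<le> a" "L * a < 1"
  shows "\<exists>c. c 0 = p \<and> (\<forall>s\<in>{0..a}. (c has_vector_derivative X (c s)) (at s within {0..a}))"
proof -
  have L0: "L \<ge> 0" using L by (rule lipschitz_on_nonneg)
  have contX: "continuous_on UNIV X" using L by (rule lipschitz_on_continuous_on)
  have cXg: "continuous_on A (\<lambda>u. X (apply_bcontfun g u))" for g :: "real \<Rightarrow>\<^sub>C 'a" and A
    by (intro continuous_on_compose2[OF contX]) auto
  have int: "(\<lambda>u. X (apply_bcontfun g u)) integrable_on {s..t}" for g :: "real \<Rightarrow>\<^sub>C 'a" and s t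
    by (intro integrable_continuous_real cXg)
  \<comment> \<open>Clamping time to the interval lets the operator act on functions defined on the
    whole line and makes the image bounded.\<close>
  define cl where "cl s = max 0 (min a s)" for s :: real
  have cl: "cl s \<in> {0..a}" "s \<in> {0..a} \<Longrightarrow> cl s = s" for s using a by (auto simp: cl_def)
  define I where "I g s = p + integral {0..cl s} (\<lambda>u. X (apply_bcontfun g u))" for g and s
  have Ib: "I g \<in> bcontfun" for g
  proof -
    have *: "continuous_on {0..a} (\<lambda>t. integral {0..t} (\<lambda>u. X (apply_bcontfun g u)))"
      by (rule indefinite_integral_continuous_1[OF int])
    have ccl: "continuous_on UNIV cl" unfolding cl_def by (intro continuous_intros)
    have cont: "continuous_on UNIV (I g)" unfolding I_def
      by (intro continuous_intros continuous_on_compose2[OF * ccl]) (use cl in auto)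
    have "compact ((\<lambda>t. p + integral {0..t} (\<lambda>u. X (apply_bcontfun g u))) ` {0..a})"
      by (intro compact_continuous_image continuous_intros *) auto
    moreover have "range (I g) \<subseteq> (\<lambda>t. p + integral {0..t} (\<lambda>u. X (apply_bcontfun g u))) ` {0..a}"
      using cl(1) by (auto simp: I_def)
    ultimately have "bounded (range (I g))" using bounded_subset compact_imp_bounded by blast
    then show ?thesis using cont by (simp add: bcontfun_def)
  qed
  define T where "T g = Bcontfun (I g)" for g
  have T: "apply_bcontfun (T g) s = I g s" for g s
    by (simp add: T_def Ib Bcontfun_inverse)
  have "dist (T g) (T h) \<le> (L * a) * dist g h" for g h
  proof (rule dist_bound)
    fix s
    have s: "cl s \<in> {0..a}" by (rule cl)
    have "dist (I g s) (I h s) = norm (integral {0..cl s} (\<lambda>u. X (apply_bcontfun g u) - X (apply_bcontfun h u)))"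
      by (simp add: I_def dist_norm Henstock_Kurzweil_Integration.integral_diff[OF int int])
    also have "\<dots> \<le> (L * dist g h) * (cl s - 0)"
    proof (rule integral_bound)
      show "continuous_on {0..cl s} (\<lambda>u. X (apply_bcontfun g u) - X (apply_bcontfun h u))"
        by (intro continuous_intros cXg)
      fix u assume "u \<in> {0..cl s}"
      have "norm (X (apply_bcontfun g u) - X (apply_bcontfun h u)) \<le> L * dist (apply_bcontfun g u) (apply_bcontfun h u)"
        using lipschitz_onD[OF L] by (simp add: dist_norm)
      also have "\<dots> \<le> L * dist g h" by (intro mult_left_mono dist_bounded L0)
      finally show "norm (X (apply_bcontfun g u) - X (apply_bcontfun h u)) \<le> L * dist g h" .
    qed (use s in auto)
    also have "\<dots> \<le> (L * dist g h) * a" using s L0 by (intro mult_left_mono) auto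
    finally show "dist (apply_bcontfun (T g) s) (apply_bcontfun (T h) s) \<le> (L * a) * dist g h"
      by (simp add: T mult_ac)
  qed
  then obtain g where g: "T g = g"
    using banach_fix_type[of "L * a" T] a L0 by auto
  have eq: "apply_bcontfun g s = p + integral {0..s} (\<lambda>u. X (apply_bcontfun g u))" if "s \<in> {0..a}" for s
    using T[of g s] that by (simp add: g I_def cl)
  show ?thesis
  proof (intro exI[of _ "apply_bcontfun g"] conjI ballI)
    show "apply_bcontfun g 0 = p" using eq[of 0] a by simp
    fix s assume s: "s \<in> {0..a}"
    have "((\<lambda>t. p + integral {0..t} (\<lambda>u. X (apply_bcontfun g u))) has_vector_derivative 0 + X (apply_bcontfun g s)) (at s within {0..a})"
      by (intro has_vector_derivative_add has_vector_derivative_const integral_has_vector_derivative cXg s)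
    then show "(apply_bcontfun g has_vector_derivative X (apply_bcontfun g s)) (at s within {0..a})"
      using has_vector_derivative_transform[OF s eq] by simp
  qed
qed
text \<open>Both \<open>exp (C * x) * E x\<close> and \<open>- (exp (- C * x) * E x)\<close> have
  nonnegative derivative. The lower estimate is what later makes the chart bi-Lipschitz rather than
  merely Lipschitz.\<close>

lemma gronwall_two_sided:
  fixes E :: "real \<Rightarrow> real"
  assumes der: "\<And>x. x \<in> {0..b} \<Longrightarrow> (E has_real_derivative E' x) (at x within {0..b})"
    and bound: "\<And>x. x \<in> {0..b} \<Longrightarrow> \<bar>E' x\<bar> \<le> C * E x"
    and s: "s \<in> {0..b}"
  shows "E s \<le> exp (C * s) * E 0" "E 0 \<le> exp (C * s) * E s"
proof -
  have mono: "F 0 \<le> F s"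
    if d: "\<And>x. x \<in> {0..b} \<Longrightarrow> (F has_real_derivative F' x) (at x within {0..b})"
      and nn: "\<And>x. x \<in> {0..b} \<Longrightarrow> 0 \<le> F' x" for F F'
  proof (rule DERIV_nonneg_imp_increasing_open[of 0 s F])
    show "0 \<le> s" using s by simp
    have "continuous_on {0..b} F" using d by (rule DERIV_continuous_on)
    then show "continuous_on {0..s} F" by (rule continuous_on_subset) (use s in auto)
    fix x assume "0 < x" "x < s"
    then have x: "0 < x" "x < b" "x \<in> {0..b}" using s by auto
    show "\<exists>y. DERIV F x :> y \<and> 0 \<le> y"
      using d[OF x(3)] nn[OF x(3)] at_within_Icc_at[OF x(1,2)] by auto
  qed
  have "exp (C * 0) * E 0 \<le> exp (C * s) * E s"
  proof (rule mono)
    fix x assume x: "x \<in> {0..b}"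
    show "((\<lambda>x. exp (C * x) * E x) has_real_derivative exp (C * x) * (C * E x + E' x)) (at x within {0..b})"
      by (auto intro!: derivative_eq_intros der[OF x] simp: algebra_simps)
    show "0 \<le> exp (C * x) * (C * E x + E' x)"
      using bound[OF x] by (intro mult_nonneg_nonneg) auto
  qed
  then show "E 0 \<le> exp (C * s) * E s" by simp
  have "- (exp (- C * 0) * E 0) \<le> - (exp (- C * s) * E s)"
  proof (rule mono)
    fix x assume x: "x \<in> {0..b}"
    show "((\<lambda>x. - (exp (- C * x) * E x)) has_real_derivative exp (- C * x) * (C * E x - E' x)) (at x within {0..b})"
      by (auto intro!: derivative_eq_intros der[OF x] simp: algebra_simps)
    show "0 \<le> exp (- C * x) * (C * E x - E' x)"
      using bound[OF x] by (intro mult_nonneg_nonneg) auto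
  qed
  then have "exp (C * s) * (exp (- C * s) * E s) \<le> exp (C * s) * E 0" by simp
  then show "E s \<le> exp (C * s) * E 0" by (simp flip: exp_add mult.assoc)
qed

section \<open>Calculus of bounded Lipschitz maps\<close>

definition bdd_lipschitz_on :: "'a::metric_space set \<Rightarrow> ('a \<Rightarrow> 'b::real_normed_vector) \<Rightarrow> bool" where
  "bdd_lipschitz_on S f \<longleftrightarrow> bounded (f ` S) \<and> (\<exists>L. L-lipschitz_on S f)"

lemma bdd_lipschitz_on_subset: "bdd_lipschitz_on S f \<Longrightarrow> T \<subseteq> S \<Longrightarrow> bdd_lipschitz_on T f"
  unfolding bdd_lipschitz_on_def by (meson bounded_subset image_mono lipschitz_on_subset)

lemma bdd_lipschitz_onE:
  assumes "bdd_lipschitz_on S f"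
  obtains K where "K > 0" "\<And>x. x \<in> S \<Longrightarrow> norm (f x) \<le> K"
    "\<And>x y. x \<in> S \<Longrightarrow> y \<in> S \<Longrightarrow> norm (f x - f y) \<le> K * dist x y"
proof -
  obtain b where b: "b > 0" "\<And>x. x \<in> S \<Longrightarrow> norm (f x) \<le> b"
    using assms unfolding bdd_lipschitz_on_def bounded_pos by auto
  obtain L where L: "L-lipschitz_on S f" using assms unfolding bdd_lipschitz_on_def by auto
  show ?thesis
  proof
    show "b + L > 0" using b lipschitz_on_nonneg[OF L] by simp
    show "norm (f x) \<le> b + L" if "x \<in> S" for x
      using b(2)[OF that] lipschitz_on_nonneg[OF L] by simp
    show "norm (f x - f y) \<le> (b + L) * dist x y" if "x \<in> S" "y \<in> S" for x y
    proof -
      have "norm (f x - f y) \<le> L * dist x y" using lipschitz_onD[OF L that] by (simp add: dist_norm)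
      also have "\<dots> \<le> (b + L) * dist x y" using b by (intro mult_right_mono) auto
      finally show ?thesis .
    qed
  qed
qed

lemma bdd_lipschitz_onI:
  assumes "\<And>x. x \<in> S \<Longrightarrow> norm (f x) \<le> K" "0 \<le> L"
    "\<And>x y. x \<in> S \<Longrightarrow> y \<in> S \<Longrightarrow> norm (f x - f y) \<le> L * dist x y"
  shows "bdd_lipschitz_on S f"
  unfolding bdd_lipschitz_on_def bounded_iff lipschitz_on_def using assms by (auto simp: dist_norm)

lemma bdd_lipschitz_on_const: "bdd_lipschitz_on S (\<lambda>x. c)"
  by (rule bdd_lipschitz_onI[where L = 0 and K = "norm c"]) auto

lemma bdd_lipschitz_on_id: "bounded S \<Longrightarrow> bdd_lipschitz_on S (\<lambda>x. x)"
  unfolding bdd_lipschitz_on_def using lipschitz_on_id by auto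

lemma (in bounded_linear) bdd_lipschitz_on:
  assumes "bdd_lipschitz_on S g" shows "bdd_lipschitz_on S (\<lambda>x. f (g x))"
proof -
  obtain K where K: "K > 0" "\<And>x. x \<in> S \<Longrightarrow> norm (g x) \<le> K"
    "\<And>x y. x \<in> S \<Longrightarrow> y \<in> S \<Longrightarrow> norm (g x - g y) \<le> K * dist x y"
    by (rule bdd_lipschitz_onE[OF assms]) blast
  obtain M where M: "M > 0" "\<And>x. norm (f x) \<le> norm x * M" using pos_bounded by blast
  show ?thesis
  proof (rule bdd_lipschitz_onI[where L = "K * M" and K = "K * M"])
    show "norm (f (g x)) \<le> K * M" if "x \<in> S" for x
      using M(2)[of "g x"] K(2)[OF that] M(1) by (smt (verit) mult_right_mono)
    show "norm (f (g x) - f (g y)) \<le> K * M * dist x y" if "x \<in> S" "y \<in> S" for x y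
    proof -
      have "norm (f (g x) - f (g y)) \<le> norm (g x - g y) * M" using M(2)[of "g x - g y"] by (simp add: diff)
      also have "\<dots> \<le> (K * dist x y) * M" using K(3)[OF that] M(1) by (intro mult_right_mono) auto
      finally show ?thesis by (simp add: mult_ac)
    qed
  qed (use K M in auto)
qed

lemma bdd_lipschitz_on_add:
  assumes "bdd_lipschitz_on S f" "bdd_lipschitz_on S g"
  shows "bdd_lipschitz_on S (\<lambda>x. f x + g x)"
  using assms lipschitz_on_add bounded_plus_comp[of f S g]
  unfolding bdd_lipschitz_on_def by blast

text \<open>The reason for pairing boundedness with the Lipschitz condition: each factor's increment
  is multiplied by the size of the other factor.\<close>

lemma (in bounded_bilinear) bdd_lipschitz_on:
  assumes "bdd_lipschitz_on S f" "bdd_lipschitz_on S g"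
  shows "bdd_lipschitz_on S (\<lambda>x. prod (f x) (g x))"
proof -
  obtain K where K: "K > 0" "\<And>x. x \<in> S \<Longrightarrow> norm (f x) \<le> K"
    "\<And>x y. x \<in> S \<Longrightarrow> y \<in> S \<Longrightarrow> norm (f x - f y) \<le> K * dist x y"
    by (rule bdd_lipschitz_onE[OF assms(1)]) blast
  obtain J where J: "J > 0" "\<And>x. x \<in> S \<Longrightarrow> norm (g x) \<le> J"
    "\<And>x y. x \<in> S \<Longrightarrow> y \<in> S \<Longrightarrow> norm (g x - g y) \<le> J * dist x y"
    by (rule bdd_lipschitz_onE[OF assms(2)]) blast
  obtain M where M: "M > 0" "\<And>a b. norm (prod a b) \<le> norm a * norm b * M" using pos_bounded by blast
  have mm: "norm (prod a b) \<le> x * y * M" if "norm a \<le> x" "norm b \<le> y" for a b x y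
  proof -
    have "norm a * norm b * M \<le> x * y * M"
      using that M(1) order_trans[OF norm_ge_zero that(1)] by (intro mult_right_mono mult_mono) auto
    then show ?thesis using M(2)[of a b] by linarith
  qed
  show ?thesis
  proof (rule bdd_lipschitz_onI[where L = "2 * (K * J * M)" and K = "K * J * M"])
    show "norm (prod (f x) (g x)) \<le> K * J * M" if "x \<in> S" for x
      using mm K(2)[OF that] J(2)[OF that] by blast
    show "norm (prod (f x) (g x) - prod (f y) (g y)) \<le> 2 * (K * J * M) * dist x y" if xy: "x \<in> S" "y \<in> S" for x y
    proof -
      have "prod (f x) (g x) - prod (f y) (g y) = prod (f x) (g x - g y) + prod (f x - f y) (g y)"
        by (simp add: diff_left diff_right)
      moreover have "norm (prod (f x) (g x - g y)) \<le> K * (J * dist x y) * M"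
        by (intro mm K(2) J(3) xy)
      moreover have "norm (prod (f x - f y) (g y)) \<le> (K * dist x y) * J * M"
        by (intro mm K(3) J(2) xy)
      ultimately show ?thesis
        using norm_triangle_ineq[of "prod (f x) (g x - g y)" "prod (f x - f y) (g y)"]
        by (simp add: mult_ac)
    qed
  qed (use K J M in auto)
qed

lemma bdd_lipschitz_on_Pair:
  assumes "bdd_lipschitz_on S f" "bdd_lipschitz_on S g"
  shows "bdd_lipschitz_on S (\<lambda>x. (f x, g x))"
proof -
  have "bdd_lipschitz_on S (\<lambda>x. (f x, 0) + (0, g x))"
    by (intro bdd_lipschitz_on_add bounded_linear.bdd_lipschitz_on[of "\<lambda>a. (a, 0)"]
        bounded_linear.bdd_lipschitz_on[of "\<lambda>a. (0, a)"] assms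
        bounded_linear_Pair bounded_linear_ident bounded_linear_zero)
  then show ?thesis by simp
qed

lemma bdd_lipschitz_on_inverse:
  fixes f :: "'a::metric_space \<Rightarrow> real"
  assumes "bdd_lipschitz_on S f" "c > 0" "\<And>x. x \<in> S \<Longrightarrow> \<bar>f x\<bar> \<ge> c"
  shows "bdd_lipschitz_on S (\<lambda>x. 1 / f x)"
proof -
  obtain K where K: "K > 0" "\<And>x. x \<in> S \<Longrightarrow> norm (f x) \<le> K"
    "\<And>x y. x \<in> S \<Longrightarrow> y \<in> S \<Longrightarrow> norm (f x - f y) \<le> K * dist x y"
    by (rule bdd_lipschitz_onE[OF assms(1)]) blast
  have nz: "f x \<noteq> 0" if "x \<in> S" for x using assms(2) assms(3)[OF that] by auto
  have b: "norm (1 / f x) \<le> 1 / c" if "x \<in> S" for x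
    using assms(2) assms(3)[OF that] by (simp add: divide_left_mono frac_le)
  show ?thesis
  proof (rule bdd_lipschitz_onI[where K = "1 / c" and L = "1 / c * (1 / c) * K"])
    fix x y assume xy: "x \<in> S" "y \<in> S"
    have "1 / f x - 1 / f y = (1 / f x) * (1 / f y) * (f y - f x)"
      using nz[OF xy(1)] nz[OF xy(2)] by (simp add: field_simps)
    then have "norm (1 / f x - 1 / f y) = norm (1 / f x) * norm (1 / f y) * norm (f x - f y)"
      by (simp only: norm_mult norm_minus_commute)
    also have "\<dots> \<le> 1 / c * (1 / c) * (K * dist x y)"
      using assms(2) by (intro mult_mono b K(3) xy) auto
    finally show "norm (1 / f x - 1 / f y) \<le> 1 / c * (1 / c) * K * dist x y" by (simp add: mult_ac)
  qed (use b assms(2) K in auto)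
qed

text \<open>Meant for a Taylor remainder along a Lipschitz curve: it permits differentiating a
  function that is known only through its expansions.\<close>

lemma quadratic_remainder_derivative:
  fixes g :: "real \<Rightarrow> real"
  assumes "\<And>x. x \<in> S \<Longrightarrow> \<bar>g x - g s\<bar> \<le> C * (x - s)\<^sup>2"
  shows "(g has_real_derivative 0) (at s within S)"
proof -
  have "((\<lambda>x. C * \<bar>x - s\<bar>) \<longlongrightarrow> C * \<bar>s - s\<bar>) (at s within S)"
    by (intro tendsto_intros)
  then have lim: "((\<lambda>x. C * \<bar>x - s\<bar>) \<longlongrightarrow> 0) (at s within S)" by simp
  have "((\<lambda>x. (g x - g s) / (x - s)) \<longlongrightarrow> 0) (at s within S)"
  proof (rule Lim_null_comparison[OF _ lim])
    show "\<forall>\<^sub>F x in at s within S. norm ((g x - g s) / (x - s)) \<le> C * \<bar>x - s\<bar>"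
      unfolding eventually_at_filter
    proof (intro always_eventually allI impI)
      fix x assume x: "x \<noteq> s" "x \<in> S"
      have "(x - s)\<^sup>2 = \<bar>x - s\<bar> * \<bar>x - s\<bar>" by (simp add: power2_eq_square)
      then have "\<bar>g x - g s\<bar> \<le> (C * \<bar>x - s\<bar>) * \<bar>x - s\<bar>" using assms[OF x(2)] by simp
      then show "norm ((g x - g s) / (x - s)) \<le> C * \<bar>x - s\<bar>"
        using x(1) by (simp add: pos_divide_le_eq)
    qed
  qed
  then show ?thesis by (simp add: has_field_derivative_iff)
qed

section \<open>The characteristic flow\<close>

lemma vector_derivative_norm_bound:
  fixes f :: "real \<Rightarrow> 'a::real_normed_vector"
  assumes "convex S" "\<And>x. x \<in> S \<Longrightarrow> (f has_vector_derivative f' x) (at x within S)"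
    "\<And>x. x \<in> S \<Longrightarrow> norm (f' x) \<le> B" "x \<in> S" "y \<in> S"
  shows "norm (f x - f y) \<le> B * norm (x - y)"
proof (rule differentiable_bound[where f' = "\<lambda>x h. h *\<^sub>R f' x", OF assms(1) _ _ assms(4,5)])
  show "(f has_derivative (\<lambda>h. h *\<^sub>R f' x)) (at x within S)" if "x \<in> S" for x
    using assms(2)[OF that] by (simp add: has_vector_derivative_def)
  show "onorm (\<lambda>h. h *\<^sub>R f' x) \<le> B" if "x \<in> S" for x
    using assms(3)[OF that] order_trans[OF norm_ge_zero assms(3)[OF that]]
    by (intro onorm_le) (simp add: mult_left_mono mult.commute[of B])
qed

lemma norm_heis_sq: "(norm (q - p))\<^sup>2 = hdist2 p q + (ht q - ht p)\<^sup>2" for p q :: "'n::finite heis"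
  by (cases p; cases q) (simp add: norm_Pair hdist2_def)

lemma comp_norm_le:
  fixes p :: "'n::finite heis" shows "norm (hx p) \<le> norm p" "norm (hy p) \<le> norm p" "\<bar>ht p\<bar> \<le> norm p"
  using norm_fst_le[of "hx p" "snd p"] norm_snd_le[of "snd p" "hx p"] norm_fst_le[of "hy p" "ht p"] norm_snd_le[of "ht p" "hy p"]
  by auto

lemma ht_diff_eq: "ht q - ht p = tau p q + (hx p \<bullet> (hy q - hy p) - hy p \<bullet> (hx q - hx p)) / 2" for p q :: "'n::finite heis"
  by (simp add: tau_def inner_diff_right inner_commute field_simps)

text \<open>
  \<open>A\<close>, \<open>B\<close> and \<open>T\<close> play the roles of the derivatives of \<open>f\<close> along the left-invariant fields
  \<open>X\<^sub>j\<close>, \<open>X\<^bsub>n+j\<^esub>\<close> and \<open>Y\<close>. The Euclidean norm in the remainder is what a \<open>C\<^sup>2\<close>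
  function provides.
\<close>

locale horizontal_taylor =
  fixes f :: "'n::finite heis \<Rightarrow> real" and A B :: "'n heis \<Rightarrow> real ^ 'n" and T :: "'n heis \<Rightarrow> real"
    and p0 :: "'n heis" and R K :: real
  assumes R: "R > 0" and K: "K \<ge> 1"
    and taylor: "\<And>p q. p \<in> cball p0 R \<Longrightarrow> q \<in> cball p0 R \<Longrightarrow>
      \<bar>f q - f p - A p \<bullet> (hx q - hx p) - B p \<bullet> (hy q - hy p) - T p * tau p q\<bar> \<le> K * (norm (q - p))\<^sup>2"
    and lipA: "bdd_lipschitz_on (cball p0 R) A" and lipB: "bdd_lipschitz_on (cball p0 R) B"
    and lipT: "bdd_lipschitz_on (cball p0 R) T"
    and bA: "\<And>p. p \<in> cball p0 R \<Longrightarrow> norm (A p) \<le> K"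
    and bB: "\<And>p. p \<in> cball p0 R \<Longrightarrow> norm (B p) \<le> K"
    and bT: "\<And>p. p \<in> cball p0 R \<Longrightarrow> \<bar>T p\<bar> \<le> K"
    and bp: "\<And>p. p \<in> cball p0 R \<Longrightarrow> norm p \<le> K"
begin

text \<open>A crude a priori bound; it converts squares of \<open>tau\<close> into multiples of its
  absolute value.\<close>

lemma tau_le:
  assumes p: "p \<in> cball p0 R" and q: "q \<in> cball p0 R"
  shows "\<bar>tau p q\<bar> \<le> 4 * K\<^sup>2"
proof -
  have n: "norm p \<le> K" "norm q \<le> K" using bp p q by auto
  have "\<bar>hx p \<bullet> hy q\<bar> \<le> K * K" "\<bar>hy p \<bullet> hx q\<bar> \<le> K * K"
    using n comp_norm_le[of p] comp_norm_le[of q] K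
    by (auto intro!: order_trans[OF Cauchy_Schwarz_ineq2] mult_mono)
  moreover have "\<bar>ht p\<bar> \<le> K" "\<bar>ht q\<bar> \<le> K" using n comp_norm_le[of p] comp_norm_le[of q] by auto
  moreover have "K \<le> K * K" using K by (simp add: mult_le_cancel_left1)
  ultimately show ?thesis unfolding tau_def power2_eq_square abs_le_iff diff_divide_distrib by argo
qed

lemma ht_diff_sq_le:
  assumes p: "p \<in> cball p0 R"
  shows "(ht q - ht p)\<^sup>2 \<le> 2 * (tau p q)\<^sup>2 + K\<^sup>2 * hdist2 p q"
proof -
  define a where "a = norm (hx q - hx p)"
  define b where "b = norm (hy q - hy p)"
  have n: "norm p \<le> K" using bp p by auto
  define m where "m = hx p \<bullet> (hy q - hy p) - hy p \<bullet> (hx q - hx p)"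
  have "\<bar>hx p \<bullet> (hy q - hy p)\<bar> \<le> K * b" "\<bar>hy p \<bullet> (hx q - hx p)\<bar> \<le> K * a"
    using n comp_norm_le[of p] K
    by (auto intro!: order_trans[OF Cauchy_Schwarz_ineq2] mult_mono simp: a_def b_def)
  then have "\<bar>m / 2\<bar> \<le> K * (a + b) / 2" by (auto simp: m_def abs_le_iff algebra_simps)
  then have "(m / 2)\<^sup>2 \<le> (K * (a + b) / 2)\<^sup>2"
    using power_mono[of "\<bar>m / 2\<bar>" "K * (a + b) / 2" 2] by (simp only: power2_abs abs_ge_zero simp_thms)
  also have "\<dots> = K\<^sup>2 * (a + b)\<^sup>2 / 4" by (simp add: power_mult_distrib power_divide)
  also have "\<dots> \<le> K\<^sup>2 * (2 * (a\<^sup>2 + b\<^sup>2)) / 4"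
    using sum_squares_bound[of a b] by (intro divide_right_mono mult_left_mono) (auto simp: power2_sum)
  also have "\<dots> = K\<^sup>2 * hdist2 p q / 2" by (simp add: hdist2_def a_def b_def)
  finally have m: "(m / 2)\<^sup>2 \<le> K\<^sup>2 * hdist2 p q / 2" .
  have "(ht q - ht p)\<^sup>2 \<le> 2 * (tau p q)\<^sup>2 + 2 * (m / 2)\<^sup>2"
    using norm_add_sq[of "tau p q" "m / 2"] by (simp only: ht_diff_eq m_def real_norm_def power2_abs)
  then show ?thesis using m by linarith
qed

text \<open>Locally the Euclidean distance is dominated by the gauge, so a Euclidean Taylor
  remainder has the order of \<open>gauge2\<close>. The 9 accommodates \<open>1 + K\<^sup>2\<close>
  for the horizontal part and the 8 produced by \<open>tau_le\<close> for the vertical part.\<close>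

lemma norm_sq_le_gauge2:
  assumes p: "p \<in> cball p0 R" and q: "q \<in> cball p0 R"
  shows "(norm (q - p))\<^sup>2 \<le> 9 * K\<^sup>2 * gauge2 p q"
proof -
  have "(tau p q)\<^sup>2 \<le> 4 * K\<^sup>2 * \<bar>tau p q\<bar>"
    using mult_right_mono[OF tau_le[OF p q], of "\<bar>tau p q\<bar>"] by (simp add: power2_eq_square)
  then have "(norm (q - p))\<^sup>2 \<le> (1 + K\<^sup>2) * hdist2 p q + 8 * K\<^sup>2 * \<bar>tau p q\<bar>"
    using ht_diff_sq_le[OF p, of q] unfolding norm_heis_sq by (simp add: algebra_simps)
  also have "\<dots> \<le> 9 * K\<^sup>2 * hdist2 p q + 9 * K\<^sup>2 * \<bar>tau p q\<bar>"
  proof (intro add_mono mult_right_mono)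
    have "1 \<le> K\<^sup>2" using K by (rule one_le_power)
    then show "1 + K\<^sup>2 \<le> 9 * K\<^sup>2" by linarith
  qed auto
  finally show ?thesis by (simp add: gauge2_def algebra_simps)
qed

text \<open>The gain of an order on a level set: the left side is linear in the increment, yet the
  expansion of \<open>f\<close> leaves only the \<open>T\<close> term, of size at most
  \<open>K ^ 3 * gauge2 p q\<close>, and the remainder, at most 9 times that.\<close>

lemma horizontal_increment_le:
  assumes p: "p \<in> cball p0 R" and q: "q \<in> cball p0 R" and eq: "f p = f q"
  shows "\<bar>A p \<bullet> (hx q - hx p) + B p \<bullet> (hy q - hy p)\<bar> \<le> 10 * K ^ 3 * gauge2 p q"
proof -
  have "\<bar>T p * tau p q\<bar> \<le> K * \<bar>tau p q\<bar>"
    using bT[OF p] by (simp add: abs_mult mult_right_mono)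
  also have "\<dots> \<le> K * gauge2 p q" using K by (intro mult_left_mono) (auto simp: gauge2_def)
  also have "\<dots> \<le> K ^ 3 * gauge2 p q"
    using self_le_power[OF K, of 3] by (intro mult_right_mono) auto
  finally have 1: "\<bar>T p * tau p q\<bar> \<le> K ^ 3 * gauge2 p q" .
  have "K * (norm (q - p))\<^sup>2 \<le> K * (9 * K\<^sup>2 * gauge2 p q)"
    using norm_sq_le_gauge2[OF p q] K by (intro mult_left_mono) auto
  also have "\<dots> = 9 * K ^ 3 * gauge2 p q" by (simp add: power2_eq_square power3_eq_cube)
  finally have 2: "K * (norm (q - p))\<^sup>2 \<le> 9 * K ^ 3 * gauge2 p q" .
  show ?thesis using 1 2 taylor[OF p q] eq by (simp add: abs_le_iff)
qed

definition vx :: "'n \<Rightarrow> 'n heis \<Rightarrow> real ^ 'n" where "vx k p = (1 / A p $ k) *\<^sub>R B p"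
definition vy :: "'n \<Rightarrow> 'n heis \<Rightarrow> real ^ 'n" where "vy k p = - ((1 / A p $ k) *\<^sub>R A p)"

text \<open>
  The field is horizontal and annihilates \<open>f\<close>, and its \<open>y\<^sub>k\<close>-component is \<open>-1\<close>, so
  \<open>y\<^sub>k\<close> parametrizes its trajectories.
\<close>

definition field :: "'n \<Rightarrow> 'n heis \<Rightarrow> 'n heis" where
  "field k p = (vx k p, vy k p, (hx p \<bullet> vy k p - hy p \<bullet> vx k p) / 2)"

text \<open>The reason for the choice of the field: pairing it symplectically with a horizontal
  vector reproduces the horizontal differential of \<open>f\<close>, up to the factor
  \<open>- 1 / A p $ k\<close>.\<close>

lemma vel_eq: "\<zeta> \<bullet> vy k p - \<eta> \<bullet> vx k p = - (A p \<bullet> \<zeta> + B p \<bullet> \<eta>) / A p $ k"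
  by (simp add: vx_def vy_def inner_commute diff_divide_distrib add_divide_distrib)

lemma field_bdd_lipschitz:
  assumes "r \<le> R" "c > 0" "\<And>p. p \<in> cball p0 r \<Longrightarrow> \<bar>A p $ k\<bar> \<ge> c"
  shows "bdd_lipschitz_on (cball p0 r) (field k)"
proof -
  have sub: "cball p0 r \<subseteq> cball p0 R" using assms(1) by (rule subset_cball)
  note A = bdd_lipschitz_on_subset[OF lipA sub] and B = bdd_lipschitz_on_subset[OF lipB sub]
  have i: "bdd_lipschitz_on (cball p0 r) (\<lambda>p. 1 / A p $ k)"
    by (intro bdd_lipschitz_on_inverse[OF _ assms(2,3)]
        bounded_linear.bdd_lipschitz_on[OF bounded_linear_vec_nth A])
  have vx: "bdd_lipschitz_on (cball p0 r) (vx k)"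
    unfolding vx_def[abs_def] by (intro bounded_bilinear.bdd_lipschitz_on[OF bounded_bilinear_scaleR] i B)
  have vy: "bdd_lipschitz_on (cball p0 r) (vy k)"
    unfolding vy_def[abs_def]
    by (intro bounded_linear.bdd_lipschitz_on[OF bounded_linear_minus[OF bounded_linear_ident]]
        bounded_bilinear.bdd_lipschitz_on[OF bounded_bilinear_scaleR] i A)
  note id = bdd_lipschitz_on_id[OF bounded_cball]
  have hx: "bdd_lipschitz_on (cball p0 r) (\<lambda>p. hx p)"
    by (rule bounded_linear.bdd_lipschitz_on[OF bounded_linear_fst id])
  have hy: "bdd_lipschitz_on (cball p0 r) (\<lambda>p. hy p)"
    by (rule bounded_linear.bdd_lipschitz_on[OF bounded_linear_fst
          bounded_linear.bdd_lipschitz_on[OF bounded_linear_snd id]])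
  have t: "bdd_lipschitz_on (cball p0 r) (\<lambda>p. ((1/2) * (hx p \<bullet> vy k p) + (-1/2) * (hy p \<bullet> vx k p)))"
    by (intro bdd_lipschitz_on_add bounded_linear.bdd_lipschitz_on[OF bounded_linear_mult_right]
        bounded_bilinear.bdd_lipschitz_on[OF bounded_bilinear_inner] hx hy vx vy)
  have "field k = (\<lambda>p. (vx k p, vy k p, ((1/2) * (hx p \<bullet> vy k p) + (-1/2) * (hy p \<bullet> vx k p))))"
    by (simp add: field_def fun_eq_iff diff_divide_distrib)
  then show ?thesis using vx vy t by (simp add: bdd_lipschitz_on_Pair)
qed

end

section \<open>Trajectories that stay in a given set\<close>

definition trajectory :: "('a::real_normed_vector \<Rightarrow> 'a) \<Rightarrow> 'a set \<Rightarrow> real \<Rightarrow> (real \<Rightarrow> 'a) \<Rightarrow> bool" where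
  "trajectory X S b c \<longleftrightarrow>
     (\<forall>s\<in>{0..b}. c s \<in> S \<and> (c has_vector_derivative X (c s)) (at s within {0..b}))"

text \<open>The field is autonomous, so a trajectory may be restarted later; this aligns two points
  of different heights.\<close>

lemma trajectory_shift:
  assumes "trajectory X S b c" "0 \<le> h" "h + b' \<le> b"
  shows "trajectory X S b' (\<lambda>s. c (s + h))"
  unfolding trajectory_def
proof (intro ballI conjI)
  fix s assume s: "s \<in> {0..b'}"
  then have sh: "s + h \<in> {0..b}" using assms by auto
  then show "c (s + h) \<in> S" using assms unfolding trajectory_def by auto
  have "(c has_vector_derivative X (c (s + h))) (at (s + h) within {0..b})"
    using assms sh unfolding trajectory_def by auto
  then have c: "(c has_vector_derivative X (c (s + h))) (at (s + h) within (\<lambda>s. s + h) ` {0..b'})"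
    by (rule has_vector_derivative_within_subset) (use assms in auto)
  have "((\<lambda>s. s + h) has_vector_derivative 1) (at s within {0..b'})"
    by (auto intro!: derivative_eq_intros)
  from vector_diff_chain_within[OF this c]
  show "((\<lambda>s. c (s + h)) has_vector_derivative X (c (s + h))) (at s within {0..b'})"
    by (simp add: o_def)
qed

lemma trajectory_restrict: "trajectory X S b c \<Longrightarrow> b' \<le> b \<Longrightarrow> trajectory X S b' c"
  using trajectory_shift[of X S b c 0 b'] by simp

text \<open>The field is extended to the whole space; a trajectory started in the half ball is too
  slow to leave the ball before time \<open>a\<close>, so it never meets the extension. The time is
  uniform in the starting point.\<close>

lemma ball_trajectory_exists:
  fixes X :: "'a::euclidean_space \<Rightarrow> 'a"
  assumes "bdd_lipschitz_on (cball p0 r) X" "r > 0"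
  shows "\<exists>a>0. \<forall>p\<in>cball p0 (r / 2). \<exists>c. trajectory X (cball p0 r) a c \<and> c 0 = p"
proof -
  obtain L where L: "L > 0" "\<And>x. x \<in> cball p0 r \<Longrightarrow> norm (X x) \<le> L"
    "\<And>x y. x \<in> cball p0 r \<Longrightarrow> y \<in> cball p0 r \<Longrightarrow> norm (X x - X y) \<le> L * dist x y"
    by (rule bdd_lipschitz_onE[OF assms(1)]) blast
  \<comment> \<open>Nearest-point projection is 1-Lipschitz, so composing with it extends the field
    with the same constant.\<close>
  define P where "P = closest_point (cball p0 r)"
  have P: "P x \<in> cball p0 r" "x \<in> cball p0 r \<Longrightarrow> P x = x" "dist (P x) (P y) \<le> dist x y" for x y
    unfolding P_def using assms(2)
    by (auto intro!: closest_point_in_set closest_point_self closest_point_lipschitz simp del: mem_cball)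
  have lip: "L-lipschitz_on UNIV (\<lambda>x. X (P x))"
    using L P by (intro lipschitz_onI) (auto simp: dist_norm[of "X _"] simp del: mem_cball
        intro!: order_trans[OF L(3)] mult_left_mono)
  \<comment> \<open>The first bound makes the integral operator a contraction, the second keeps the
    displacement \<open>L * a\<close> below \<open>r / 2\<close>.\<close>
  define a where "a = min (1 / (2 * L)) (r / (2 * L))"
  have a: "a > 0" "L * a < 1" "L * a \<le> r / 2"
    using L assms(2) by (auto simp: a_def min_def field_simps)
  have "\<exists>c. trajectory X (cball p0 r) a c \<and> c 0 = p" if p: "p \<in> cball p0 (r / 2)" for p
  proof -
    obtain c where c: "c 0 = p"
      "\<And>s. s \<in> {0..a} \<Longrightarrow> (c has_vector_derivative X (P (c s))) (at s within {0..a})"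
      using lipschitz_ode_exists[OF lip _ a(2), of p] a(1) by auto
    have "c s \<in> cball p0 r" if s: "s \<in> {0..a}" for s
    proof -
      have "norm (c s - c 0) \<le> L * norm (s - 0)"
      proof (rule vector_derivative_norm_bound[of "{0..a}" c "\<lambda>s. X (P (c s))"])
        show "norm (X (P (c t))) \<le> L" for t by (intro L P)
      qed (use s c in auto)
      also have "\<dots> \<le> L * a" using s L by (intro mult_left_mono) auto
      finally have "dist p (c s) \<le> r / 2" using a(3) c by (simp add: dist_norm norm_minus_commute)
      moreover have "dist p0 p \<le> r / 2" using p by simp
      ultimately show ?thesis using dist_triangle[of p0 "c s" p] by simp
    qed
    then have "trajectory X (cball p0 r) a c" unfolding trajectory_def using c P by fastforce
    then show ?thesis using c by blast
  qed
  then show ?thesis using a by blast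
qed
context horizontal_taylor
begin

lemma trajectory_components:
  assumes "trajectory (field k) (cball p0 r) b c" "s \<in> {0..b}"
  shows "((\<lambda>s. hx (c s)) has_vector_derivative vx k (c s)) (at s within {0..b})"
    "((\<lambda>s. hy (c s)) has_vector_derivative vy k (c s)) (at s within {0..b})"
    "((\<lambda>s. ht (c s)) has_real_derivative (hx (c s) \<bullet> vy k (c s) - hy (c s) \<bullet> vx k (c s)) / 2) (at s within {0..b})"
proof -
  have c: "(c has_vector_derivative field k (c s)) (at s within {0..b})"
    using assms by (auto simp: trajectory_def)
  note s = bounded_linear.has_vector_derivative[OF bounded_linear_snd c]
  show "((\<lambda>s. hx (c s)) has_vector_derivative vx k (c s)) (at s within {0..b})"
    using bounded_linear.has_vector_derivative[OF bounded_linear_fst c] by (simp add: field_def)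
  show "((\<lambda>s. hy (c s)) has_vector_derivative vy k (c s)) (at s within {0..b})"
    using bounded_linear.has_vector_derivative[OF bounded_linear_fst s] by (simp add: field_def)
  show "((\<lambda>s. ht (c s)) has_real_derivative (hx (c s) \<bullet> vy k (c s) - hy (c s) \<bullet> vx k (c s)) / 2) (at s within {0..b})"
    using bounded_linear.has_vector_derivative[OF bounded_linear_snd s]
    by (simp add: field_def has_real_derivative_iff_has_vector_derivative)
qed

lemma inner_has_real_derivative:
  assumes "(u has_vector_derivative u') (at s within S)" "(v has_vector_derivative v') (at s within S)"
  shows "((\<lambda>s. u s \<bullet> v s) has_real_derivative (u s \<bullet> v' + u' \<bullet> v s)) (at s within S)"
  unfolding has_real_derivative_iff_has_vector_derivative
  by (rule bounded_bilinear.has_vector_derivative[OF bounded_bilinear_inner assms])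

text \<open>Because both curves are horizontal, everything combines into the average of the
  symplectic pairings of the increment with the two velocities, to which \<open>vel_eq\<close>
  applies.\<close>

lemma tau_pair_derivative:
  assumes c: "trajectory (field k) (cball p0 r) b c" and c': "trajectory (field k) (cball p0 r) b c'"
    and s: "s \<in> {0..b}"
  shows "((\<lambda>s. tau (c s) (c' s)) has_real_derivative
     (- (A (c s) \<bullet> (hx (c' s) - hx (c s)) + B (c s) \<bullet> (hy (c' s) - hy (c s))) / A (c s) $ k +
      - (A (c' s) \<bullet> (hx (c' s) - hx (c s)) + B (c' s) \<bullet> (hy (c' s) - hy (c s))) / A (c' s) $ k) / 2)
     (at s within {0..b})"
proof -
  note a = trajectory_components[OF c s] and b = trajectory_components[OF c' s]
  have "((\<lambda>s. tau (c s) (c' s)) has_real_derivative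
     (hx (c' s) \<bullet> vy k (c' s) - hy (c' s) \<bullet> vx k (c' s)) / 2 - (hx (c s) \<bullet> vy k (c s) - hy (c s) \<bullet> vx k (c s)) / 2
     - ((hx (c s) \<bullet> vy k (c' s) + vx k (c s) \<bullet> hy (c' s)) - (hy (c s) \<bullet> vx k (c' s) + vy k (c s) \<bullet> hx (c' s))) / 2)
     (at s within {0..b})"
    unfolding tau_def by (intro DERIV_diff DERIV_cdivide inner_has_real_derivative a b)
  also have "(hx (c' s) \<bullet> vy k (c' s) - hy (c' s) \<bullet> vx k (c' s)) / 2 - (hx (c s) \<bullet> vy k (c s) - hy (c s) \<bullet> vx k (c s)) / 2
     - ((hx (c s) \<bullet> vy k (c' s) + vx k (c s) \<bullet> hy (c' s)) - (hy (c s) \<bullet> vx k (c' s) + vy k (c s) \<bullet> hx (c' s))) / 2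
     = (((hx (c' s) - hx (c s)) \<bullet> vy k (c s) - (hy (c' s) - hy (c s)) \<bullet> vx k (c s))
        + ((hx (c' s) - hx (c s)) \<bullet> vy k (c' s) - (hy (c' s) - hy (c s)) \<bullet> vx k (c' s))) / 2"
    by (simp add: inner_diff_left inner_diff_right inner_commute field_simps)
  finally show ?thesis unfolding vel_eq .
qed

lemma hdist2_pair_derivative:
  assumes c: "trajectory (field k) (cball p0 r) b c" and c': "trajectory (field k) (cball p0 r) b c'"
    and s: "s \<in> {0..b}"
  shows "((\<lambda>s. hdist2 (c s) (c' s)) has_real_derivative
     2 * ((hx (c' s) - hx (c s)) \<bullet> (vx k (c' s) - vx k (c s))) +
     2 * ((hy (c' s) - hy (c s)) \<bullet> (vy k (c' s) - vy k (c s)))) (at s within {0..b})"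
proof -
  note a = trajectory_components[OF c s] and b = trajectory_components[OF c' s]
  have dx: "((\<lambda>s. hx (c' s) - hx (c s)) has_vector_derivative vx k (c' s) - vx k (c s)) (at s within {0..b})"
    and dy: "((\<lambda>s. hy (c' s) - hy (c s)) has_vector_derivative vy k (c' s) - vy k (c s)) (at s within {0..b})"
    by (intro has_vector_derivative_diff a b)+
  from DERIV_add[OF inner_has_real_derivative[OF dx dx] inner_has_real_derivative[OF dy dy]]
  show ?thesis
    unfolding hdist2_def power2_norm_eq_inner by (rule DERIV_cong) (simp add: inner_commute)
qed

end

text \<open>\<open>small\<close> is calibrated for \<open>slice_gauge\<close>: two points of the
  ball differ by at most \<open>2 * r\<close>, and \<open>10 * K ^ 3 * (2 * r)\<close> is then at
  most half of \<open>c0\<close>.\<close>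

locale char_field = horizontal_taylor f A B T p0 R K
  for f :: "'n::finite heis \<Rightarrow> real" and A B T p0 R K +
  fixes k :: 'n and r c0 L :: real
  assumes r: "0 < r" "r \<le> R" and c0: "0 < c0" "\<And>p. p \<in> cball p0 r \<Longrightarrow> c0 \<le> \<bar>A p $ k\<bar>"
    and small: "40 * K ^ 3 * r \<le> c0"
    and L: "L > 0" "\<And>p. p \<in> cball p0 r \<Longrightarrow> norm (field k p) \<le> L"
      "\<And>p q. p \<in> cball p0 r \<Longrightarrow> q \<in> cball p0 r \<Longrightarrow> norm (field k p - field k q) \<le> L * dist p q"
begin

lemma in_R: "p \<in> cball p0 r \<Longrightarrow> p \<in> cball p0 R"
  using r by auto

lemma Ak_nz: "p \<in> cball p0 r \<Longrightarrow> A p $ k \<noteq> 0"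
  using c0 by fastforce

lemma v_bound: "p \<in> cball p0 r \<Longrightarrow> norm (vx k p) \<le> L" "p \<in> cball p0 r \<Longrightarrow> norm (vy k p) \<le> L"
  using L(2)[of p] comp_norm_le[of "field k p"] by (auto simp: field_def)

lemma v_lipschitz:
  assumes "p \<in> cball p0 r" "q \<in> cball p0 r"
  shows "norm (vx k p - vx k q) \<le> L * norm (p - q)" "norm (vy k p - vy k q) \<le> L * norm (p - q)"
  using L(3)[OF assms] comp_norm_le[of "field k p - field k q"] by (auto simp: field_def dist_norm)

lemma trajectory_mem: "trajectory (field k) (cball p0 r) b c \<Longrightarrow> s \<in> {0..b} \<Longrightarrow> c s \<in> cball p0 r"
  by (simp add: trajectory_def)

lemma trajectory_hy_k:
  assumes c: "trajectory (field k) (cball p0 r) b c" and s: "s \<in> {0..b}"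
  shows "hy (c s) $ k = hy (c 0) $ k - s"
proof -
  have "norm ((hy (c s) $ k + s) - (hy (c 0) $ k + 0)) \<le> 0 * norm (s - 0)"
  proof (rule vector_derivative_norm_bound[of "{0..b}" "\<lambda>s. hy (c s) $ k + s" "\<lambda>s. vy k (c s) $ k + 1"])
    fix s assume s: "s \<in> {0..b}"
    show "((\<lambda>s. hy (c s) $ k + s) has_vector_derivative vy k (c s) $ k + 1) (at s within {0..b})"
      by (intro has_vector_derivative_add has_vector_derivative_id
          bounded_linear.has_vector_derivative[OF bounded_linear_vec_nth trajectory_components(2)[OF c s]])
    show "norm (vy k (c s) $ k + 1) \<le> 0"
      using Ak_nz[OF trajectory_mem[OF c s]] by (simp add: vy_def)
  qed (use s in auto)
  then show ?thesis by simp
qed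

text \<open>A horizontal curve of bounded speed is Lipschitz for a homogeneous distance: the
  derivative of \<open>tau\<close> from the starting point pairs a displacement of size
  \<open>L * s\<close> with a velocity of size \<open>L\<close>, so \<open>tau\<close> grows only
  quadratically in time.\<close>

lemma trajectory_gauge2:
  assumes c: "trajectory (field k) (cball p0 r) b c" and s: "s \<in> {0..b}"
  shows "gauge2 (c 0) (c s) \<le> 3 * L\<^sup>2 * s\<^sup>2"
proof -
  have cs: "trajectory (field k) (cball p0 r) s c" using c s by (auto intro: trajectory_restrict)
  have x: "norm (hx (c u) - hx (c 0)) \<le> L * s" "norm (hy (c u) - hy (c 0)) \<le> L * s" if u: "u \<in> {0..s}" for u
  proof -
    have "norm (hx (c u) - hx (c 0)) \<le> L * norm (u - 0)"
      by (rule vector_derivative_norm_bound[of "{0..s}" "\<lambda>s. hx (c s)"])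
        (use u in \<open>auto intro!: trajectory_components[OF cs] v_bound trajectory_mem[OF cs] simp del: mem_cball\<close>)
    moreover have "norm (hy (c u) - hy (c 0)) \<le> L * norm (u - 0)"
      by (rule vector_derivative_norm_bound[of "{0..s}" "\<lambda>s. hy (c s)"])
        (use u in \<open>auto intro!: trajectory_components[OF cs] v_bound trajectory_mem[OF cs] simp del: mem_cball\<close>)
    moreover have "L * norm (u - 0) \<le> L * s" using u L by (intro mult_left_mono) auto
    ultimately show "norm (hx (c u) - hx (c 0)) \<le> L * s" "norm (hy (c u) - hy (c 0)) \<le> L * s" by auto
  qed
  have "norm (tau (c 0) (c s) - tau (c 0) (c 0)) \<le> (L * s * L) * norm (s - 0)"
  proof (rule vector_derivative_norm_bound[of "{0..s}" "\<lambda>u. tau (c 0) (c u)"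
        "\<lambda>u. ((hx (c u) - hx (c 0)) \<bullet> vy k (c u) - (hy (c u) - hy (c 0)) \<bullet> vx k (c u)) / 2"])
    fix u assume u: "u \<in> {0..s}"
    have "((\<lambda>u. tau (c 0) (c u)) has_real_derivative (hx (c u) \<bullet> vy k (c u) - hy (c u) \<bullet> vx k (c u)) / 2 - 0
       - ((hx (c 0) \<bullet> vy k (c u) + 0 \<bullet> hy (c u)) - (hy (c 0) \<bullet> vx k (c u) + 0 \<bullet> hx (c u))) / 2) (at u within {0..s})"
      unfolding tau_def by (intro DERIV_diff DERIV_cdivide inner_has_real_derivative
          trajectory_components[OF cs u] DERIV_const has_vector_derivative_const)
    then show "((\<lambda>u. tau (c 0) (c u)) has_vector_derivative
       ((hx (c u) - hx (c 0)) \<bullet> vy k (c u) - (hy (c u) - hy (c 0)) \<bullet> vx k (c u)) / 2) (at u within {0..s})"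
      unfolding has_real_derivative_iff_has_vector_derivative[symmetric]
      by (rule DERIV_cong) (simp add: inner_diff_left field_simps)
    have "\<bar>(hx (c u) - hx (c 0)) \<bullet> vy k (c u)\<bar> \<le> (L * s) * L" "\<bar>(hy (c u) - hy (c 0)) \<bullet> vx k (c u)\<bar> \<le> (L * s) * L"
      using x[OF u] v_bound[OF trajectory_mem[OF cs u]] L s
      by (auto intro!: order_trans[OF Cauchy_Schwarz_ineq2] mult_mono)
    then show "norm (((hx (c u) - hx (c 0)) \<bullet> vy k (c u) - (hy (c u) - hy (c 0)) \<bullet> vx k (c u)) / 2) \<le> L * s * L"
      by (simp add: abs_le_iff)
  qed (use s in auto)
  then have "\<bar>tau (c 0) (c s)\<bar> \<le> L\<^sup>2 * s\<^sup>2"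
    using s by (simp add: tau_def inner_commute power2_eq_square mult_ac)
  moreover have "(norm (hx (c s) - hx (c 0)))\<^sup>2 \<le> (L * s)\<^sup>2" "(norm (hy (c s) - hy (c 0)))\<^sup>2 \<le> (L * s)\<^sup>2"
    using x[of s] s by (auto intro!: power_mono)
  ultimately show ?thesis by (simp add: gauge2_def hdist2_def power_mult_distrib)
qed

text \<open>Only expansions of \<open>f\<close> are available in the locale. The difference of
  \<open>f\<close> and its expansion at \<open>c s\<close> is quadratic in time; the expansion
  itself has derivative zero, because the \<open>A\<close> and \<open>B\<close> terms cancel for
  this field and \<open>tau\<close> is stationary along a horizontal curve.\<close>

lemma trajectory_level:
  assumes c: "trajectory (field k) (cball p0 r) b c" and s: "s \<in> {0..b}"
  shows "f (c s) = f (c 0)"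
proof -
  have "((\<lambda>u. f (c u)) has_real_derivative 0) (at s within {0..b})" if s: "s \<in> {0..b}" for s
  proof -
    define h where "h u = A (c s) \<bullet> (hx (c u) - hx (c s)) + B (c s) \<bullet> (hy (c u) - hy (c s)) + T (c s) * tau (c s) (c u)" for u
    have "((\<lambda>u. f (c u) - h u) has_real_derivative 0) (at s within {0..b})"
    proof (rule quadratic_remainder_derivative)
      fix u assume u: "u \<in> {0..b}"
      have "norm (c u - c s) \<le> L * norm (u - s)"
        by (rule vector_derivative_norm_bound[of "{0..b}" c "\<lambda>s. field k (c s)"])
          (use s u c L in \<open>auto simp: trajectory_def\<close>)
      then have "(norm (c u - c s))\<^sup>2 \<le> (L * norm (u - s))\<^sup>2" by (rule power_mono) simp
      then have "K * (norm (c u - c s))\<^sup>2 \<le> K * (L * norm (u - s))\<^sup>2" using K by (intro mult_left_mono) auto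
      moreover have "f (c u) - h u - (f (c s) - h s) = f (c u) - f (c s) - A (c s) \<bullet> (hx (c u) - hx (c s))
          - B (c s) \<bullet> (hy (c u) - hy (c s)) - T (c s) * tau (c s) (c u)"
        by (simp add: h_def tau_def inner_commute)
      ultimately show "\<bar>f (c u) - h u - (f (c s) - h s)\<bar> \<le> (K * L\<^sup>2) * (u - s)\<^sup>2"
        using taylor[OF in_R[OF trajectory_mem[OF c s]] in_R[OF trajectory_mem[OF c u]]]
        by (simp add: power_mult_distrib mult.assoc)
    qed
    moreover have "(h has_real_derivative 0) (at s within {0..b})"
    proof -
      note t = trajectory_components[OF c s]
      have tau': "((\<lambda>u. tau (c s) (c u)) has_real_derivative (hx (c s) \<bullet> vy k (c s) - hy (c s) \<bullet> vx k (c s)) / 2 - 0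
       - ((hx (c s) \<bullet> vy k (c s) + 0 \<bullet> hy (c s)) - (hy (c s) \<bullet> vx k (c s) + 0 \<bullet> hx (c s))) / 2) (at s within {0..b})"
        unfolding tau_def by (intro DERIV_diff DERIV_cdivide inner_has_real_derivative
          t DERIV_const has_vector_derivative_const)
      have "(h has_real_derivative
         (A (c s) \<bullet> (vx k (c s) - 0) + 0 \<bullet> (hx (c s) - hx (c s))) +
         (B (c s) \<bullet> (vy k (c s) - 0) + 0 \<bullet> (hy (c s) - hy (c s))) +
         (0 * tau (c s) (c s) + ((hx (c s) \<bullet> vy k (c s) - hy (c s) \<bullet> vx k (c s)) / 2 - 0
       - ((hx (c s) \<bullet> vy k (c s) + 0 \<bullet> hy (c s)) - (hy (c s) \<bullet> vx k (c s) + 0 \<bullet> hx (c s))) / 2) * T (c s))) (at s within {0..b})"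
        unfolding h_def[abs_def]
        by (intro DERIV_add DERIV_mult DERIV_const tau' inner_has_real_derivative has_vector_derivative_diff
            t(1,2) has_vector_derivative_const)
      then show ?thesis
        by (rule DERIV_cong) (simp add: vx_def vy_def inner_commute)
    qed
    ultimately have "((\<lambda>u. f (c u) - h u + h u) has_real_derivative 0 + 0) (at s within {0..b})"
      by (rule DERIV_add)
    then show ?thesis by simp
  qed
  then have "norm (f (c s) - f (c 0)) \<le> 0 * norm (s - 0)"
    by (intro vector_derivative_norm_bound[of "{0..b}" _ "\<lambda>_. 0"])
      (use s in \<open>auto simp: has_real_derivative_iff_has_vector_derivative\<close>)
  then show ?thesis by simp
qed

end

section \<open>Straightening the hypersurface\<close>

text \<open>With \<open>j\<close> a bijection onto the indices other than \<open>k\<close>, this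
  forgets the \<open>k\<close>-th coordinate.\<close>

definition drop_coord :: "('m::finite \<Rightarrow> 'n::finite) \<Rightarrow> real ^ 'n \<Rightarrow> real ^ 'm" where
  "drop_coord j x = (\<chi> i. x $ j i)"

lemma drop_coord_diff: "drop_coord j (x - y) = drop_coord j x - drop_coord j y"
  by (simp add: drop_coord_def vec_eq_iff)

lemma inner_drop_coord:
  assumes "bij_betw j UNIV (UNIV - {k})"
  shows "x \<bullet> y = drop_coord j x \<bullet> drop_coord j y + x $ k * y $ k"
proof -
  have "x \<bullet> y = (\<Sum>i\<in>UNIV - {k}. x $ i * y $ i) + x $ k * y $ k"
    unfolding inner_vec_def by (subst sum.remove[of UNIV k]) (simp_all add: add.commute)
  also have "(\<Sum>i\<in>UNIV - {k}. x $ i * y $ i) = (\<Sum>i\<in>UNIV. x $ j i * y $ j i)"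
    using sum.reindex_bij_betw[OF assms, of "\<lambda>i. x $ i * y $ i"] by simp
  finally show ?thesis by (simp add: drop_coord_def inner_vec_def)
qed

lemma norm_drop_coord:
  assumes "bij_betw j UNIV (UNIV - {k})"
  shows "(norm x)\<^sup>2 = (norm (drop_coord j x))\<^sup>2 + (x $ k)\<^sup>2"
  unfolding power2_norm_eq_inner inner_drop_coord[OF assms, of x x] by (simp only: power2_eq_square)

lemma norm_drop_coord_le:
  assumes "bij_betw j UNIV (UNIV - {k})"
  shows "norm (drop_coord j x) \<le> norm x"
proof (rule power2_le_imp_le)
  show "(norm (drop_coord j x))\<^sup>2 \<le> (norm x)\<^sup>2" unfolding norm_drop_coord[OF assms, of x] by simp
qed simp

text \<open>
  The shear in the vertical coordinate compensates the terms of \<open>\<tau>\<close> containing the dropped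
  coordinates, which on the slice \<open>y\<^sub>k = h\<close> amount to \<open>h (x'\<^sub>k - x\<^sub>k) / 2\<close>.
\<close>

definition slice_map :: "('m::finite \<Rightarrow> 'n::finite) \<Rightarrow> 'n \<Rightarrow> real \<Rightarrow> 'n heis \<Rightarrow> 'm heis" where
  "slice_map j k h q = (drop_coord j (hx q), drop_coord j (hy q), ht q + h * hx q $ k / 2)"

lemma slice_tau:
  assumes j: "bij_betw j UNIV (UNIV - {k})" and "hy p $ k = h" "hy q $ k = h"
  shows "tau (slice_map j k h p) (slice_map j k h q) = tau p q"
  using assms(2,3) by (simp add: tau_def slice_map_def inner_drop_coord[OF j] field_simps)

lemma slice_hdist2:
  assumes j: "bij_betw j UNIV (UNIV - {k})" and "hy p $ k = h" "hy q $ k = h"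
  shows "hdist2 p q = hdist2 (slice_map j k h p) (slice_map j k h q) + (hx q $ k - hx p $ k)\<^sup>2"
  using assms(2,3) by (simp add: hdist2_def slice_map_def norm_drop_coord[OF j] drop_coord_diff)

context char_field
begin

text \<open>One constant serves all pairs of trajectories on a common level and all durations up to
  \<open>b\<close>. The horizontal part is controlled by the Lipschitz constant of the field, the
  vertical part by \<open>horizontal_increment_le\<close>.\<close>

lemma two_trajectories:
  assumes b: "0 \<le> b"
  shows "\<exists>M\<ge>1. \<forall>c c' b' s. b' \<le> b \<longrightarrow> trajectory (field k) (cball p0 r) b' c \<longrightarrow> trajectory (field k) (cball p0 r) b' c' \<longrightarrow>
    f (c 0) = f (c' 0) \<longrightarrow> s \<in> {0..b'} \<longrightarrow>
    gauge2 (c s) (c' s) \<le> M * gauge2 (c 0) (c' 0) \<and> gauge2 (c 0) (c' 0) \<le> M * gauge2 (c s) (c' s)"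
proof -
  \<comment> \<open>The first two summands bound the derivative of \<open>D\<close>, the last one
    that of \<open>t\<close>, both relative to \<open>g\<close>.\<close>
  define N where "N = 1 + 18 * L\<^sup>2 * K\<^sup>2 + 10 * K ^ 3 / c0"
  have N: "N \<ge> 1" using c0 K by (auto simp: N_def intro!: add_nonneg_nonneg)
  \<comment> \<open>Gronwall is applied to \<open>E\<close>, comparable to the square of
    \<open>g\<close>. For the root it suffices that \<open>M * M\<close> is at least
    \<open>2 * exp (4 * N * b)\<close>, which holds since \<open>M\<close> equals this number and is
    at least 1.\<close>
  define M where "M = 2 * exp (4 * N * b)"
  have "exp (4 * N * b) \<ge> 1" using b N by simp
  then have M1: "M \<ge> 1" unfolding M_def by linarith
  have "gauge2 (c s) (c' s) \<le> M * gauge2 (c 0) (c' 0) \<and> gauge2 (c 0) (c' 0) \<le> M * gauge2 (c s) (c' s)"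
    if b': "b' \<le> b" and c: "trajectory (field k) (cball p0 r) b' c" and c': "trajectory (field k) (cball p0 r) b' c'"
      and f0: "f (c 0) = f (c' 0)" and s: "s \<in> {0..b'}" for c c' b' s
  proof -
    define D where "D s = hdist2 (c s) (c' s)" for s
    define t where "t s = tau (c s) (c' s)" for s
    define D' where "D' s = 2 * ((hx (c' s) - hx (c s)) \<bullet> (vx k (c' s) - vx k (c s))) +
     2 * ((hy (c' s) - hy (c s)) \<bullet> (vy k (c' s) - vy k (c s)))" for s
    define t' where "t' s = (- (A (c s) \<bullet> (hx (c' s) - hx (c s)) + B (c s) \<bullet> (hy (c' s) - hy (c s))) / A (c s) $ k +
      - (A (c' s) \<bullet> (hx (c' s) - hx (c s)) + B (c' s) \<bullet> (hy (c' s) - hy (c s))) / A (c' s) $ k) / 2" for s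
    define g where "g s = gauge2 (c s) (c' s)" for s
    have g: "g s = D s + \<bar>t s\<bar>" "D s \<ge> 0" "g s \<ge> 0" for s by (simp_all add: g_def gauge2_def D_def t_def)
    \<comment> \<open>a differentiable substitute for the square of the gauge, which is not smooth at \<open>\<tau> = 0\<close>\<close>
    define E where "E s = (D s)\<^sup>2 + (t s)\<^sup>2" for s
    have Eder: "(E has_real_derivative (2 * D s * D' s + 2 * t s * t' s)) (at s within {0..b'})" if s: "s \<in> {0..b'}" for s
    proof -
      have "(D has_real_derivative D' s) (at s within {0..b'})" "(t has_real_derivative t' s) (at s within {0..b'})"
        using hdist2_pair_derivative[OF c c' s] tau_pair_derivative[OF c c' s]
        unfolding D_def[abs_def] t_def[abs_def] D'_def t'_def .
      then show ?thesis unfolding E_def[abs_def] by (auto intro!: derivative_eq_intros)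
    qed
    have Ebound: "\<bar>2 * D s * D' s + 2 * t s * t' s\<bar> \<le> (4 * N) * E s" if s: "s \<in> {0..b'}" for s
    proof -
      note m = trajectory_mem[OF c s] and m' = trajectory_mem[OF c' s]
      have feq: "f (c s) = f (c' s)" using trajectory_level[OF c s] trajectory_level[OF c' s] f0 by simp
      define n where "n = norm (c' s - c s)"
      have n2: "n\<^sup>2 \<le> 9 * K\<^sup>2 * g s"
        unfolding n_def g_def by (rule norm_sq_le_gauge2[OF in_R[OF m] in_R[OF m']])
      have "norm (vx k (c' s) - vx k (c s)) \<le> L * n" "norm (vy k (c' s) - vy k (c s)) \<le> L * n"
        unfolding n_def by (rule v_lipschitz[OF m' m])+
      then have v: "(norm (vx k (c' s) - vx k (c s)))\<^sup>2 \<le> L\<^sup>2 * n\<^sup>2" "(norm (vy k (c' s) - vy k (c s)))\<^sup>2 \<le> L\<^sup>2 * n\<^sup>2"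
        by (auto simp flip: power_mult_distrib intro: power_mono)
      have i: "\<bar>2 * (a \<bullet> e)\<bar> \<le> (norm a)\<^sup>2 + (norm e)\<^sup>2" for a e :: "real^'n"
        using Cauchy_Schwarz_ineq2[of a e] sum_squares_bound[of "norm a" "norm e"] by (simp add: abs_mult)
      have "\<bar>D' s\<bar> \<le> D s + 2 * (L\<^sup>2 * n\<^sup>2)"
        using i[of "hx (c' s) - hx (c s)" "vx k (c' s) - vx k (c s)"]
          i[of "hy (c' s) - hy (c s)" "vy k (c' s) - vy k (c s)"] v
        unfolding D'_def D_def hdist2_def by linarith
      also have "\<dots> \<le> g s + 2 * (L\<^sup>2 * (9 * K\<^sup>2 * g s))"
        using n2 g by (intro add_mono mult_left_mono) auto
      also have "\<dots> = (1 + 18 * L\<^sup>2 * K\<^sup>2) * g s" by (simp add: algebra_simps)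
      also have "\<dots> \<le> N * g s" using g K c0 by (intro mult_right_mono) (auto simp: N_def)
      finally have D': "\<bar>D' s\<bar> \<le> N * g s" .
      have q: "\<bar>x / y\<bar> \<le> 10 * K ^ 3 * g s / c0" if "\<bar>x\<bar> \<le> 10 * K ^ 3 * g s" "c0 \<le> \<bar>y\<bar>" for x y
        using that c0(1) order_trans[OF abs_ge_zero that(1)] unfolding abs_divide by (intro frac_le)
      have "\<bar>- (A (c s) \<bullet> (hx (c' s) - hx (c s)) + B (c s) \<bullet> (hy (c' s) - hy (c s))) / A (c s) $ k\<bar> \<le> 10 * K ^ 3 * g s / c0"
        using horizontal_increment_le[OF in_R[OF m] in_R[OF m'] feq] c0(2)[OF m] by (intro q) (auto simp: g_def)
      moreover have "\<bar>- (A (c' s) \<bullet> (hx (c' s) - hx (c s)) + B (c' s) \<bullet> (hy (c' s) - hy (c s))) / A (c' s) $ k\<bar> \<le> 10 * K ^ 3 * g s / c0"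
      proof (rule q[OF _ c0(2)[OF m']])
        have "- (A (c' s) \<bullet> (hx (c' s) - hx (c s)) + B (c' s) \<bullet> (hy (c' s) - hy (c s))) =
           A (c' s) \<bullet> (hx (c s) - hx (c' s)) + B (c' s) \<bullet> (hy (c s) - hy (c' s))"
          by (simp add: inner_diff_right)
        then show "\<bar>- (A (c' s) \<bullet> (hx (c' s) - hx (c s)) + B (c' s) \<bullet> (hy (c' s) - hy (c s)))\<bar> \<le> 10 * K ^ 3 * g s"
          using horizontal_increment_le[OF in_R[OF m'] in_R[OF m] feq[symmetric]] gauge2_swap[of "c s" "c' s"]
          by (simp add: g_def)
      qed
      moreover have "\<bar>(x + y) / 2\<bar> \<le> z" if "\<bar>x\<bar> \<le> z" "\<bar>y\<bar> \<le> z" for x y z :: real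
        using that by (auto simp: abs_le_iff field_simps)
      ultimately have "\<bar>t' s\<bar> \<le> 10 * K ^ 3 * g s / c0" unfolding t'_def by blast
      also have "\<dots> = (10 * K ^ 3 / c0) * g s" by simp
      also have "\<dots> \<le> N * g s" using g K c0 by (intro mult_right_mono) (auto simp: N_def)
      finally have t': "\<bar>t' s\<bar> \<le> N * g s" .
      \<comment> \<open>Both derivatives are at most \<open>N * g s\<close> and \<open>g s\<close>
        is the sum of \<open>D s\<close> and the absolute value of \<open>t s\<close>, so the square
        of \<open>g s\<close> appears, at most \<open>2 * E s\<close>.\<close>
      have "\<bar>D s * D' s + t s * t' s\<bar> \<le> D s * \<bar>D' s\<bar> + \<bar>t s\<bar> * \<bar>t' s\<bar>"
        using abs_triangle_ineq[of "D s * D' s" "t s * t' s"] g by (simp add: abs_mult)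
      also have "\<dots> \<le> D s * (N * g s) + \<bar>t s\<bar> * (N * g s)"
        using D' t' g by (intro add_mono mult_left_mono) auto
      also have "\<dots> = N * (g s)\<^sup>2" by (simp add: g power2_eq_square algebra_simps)
      also have "\<dots> \<le> N * (2 * E s)"
        using norm_add_sq[of "D s" "\<bar>t s\<bar>"] g N by (intro mult_left_mono) (auto simp: E_def)
      finally show ?thesis by (simp add: abs_mult flip: distrib_left mult.assoc)
    qed
    have gE: "E s \<le> (g s)\<^sup>2" "(g s)\<^sup>2 \<le> 2 * E s" for s
      using norm_add_sq[of "D s" "\<bar>t s\<bar>"] g[of s] by (auto simp: E_def power2_sum)
    have ex: "exp (4 * N * s) \<le> exp (4 * N * b)" using s b' N by (simp add: mult_left_mono)
    have fin: "x \<le> M * y" if "x\<^sup>2 \<le> 2 * exp (4 * N * b) * y\<^sup>2" "y \<ge> 0" for x y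
    proof (rule power2_le_imp_le)
      have "2 * exp (4 * N * b) \<le> M * M" using M1 by (simp add: M_def)
      then show "x\<^sup>2 \<le> (M * y)\<^sup>2" using that(1)
        by (smt (verit) mult_right_mono power_mult_distrib power2_eq_square zero_le_power2)
    qed (use that M1 in auto)
    have G: "E s \<le> exp (4 * N * s) * E 0" "E 0 \<le> exp (4 * N * s) * E s"
      using gronwall_two_sided[OF Eder Ebound s] by auto
    have step: "(g u)\<^sup>2 \<le> 2 * exp (4 * N * b) * (g v)\<^sup>2" if "E u \<le> exp (4 * N * s) * E v" for u v
    proof -
      have "(g u)\<^sup>2 \<le> 2 * (exp (4 * N * s) * E v)" using gE(2)[of u] that by linarith
      also have "\<dots> \<le> 2 * (exp (4 * N * b) * (g v)\<^sup>2)"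
        using ex gE(1)[of v] by (intro mult_left_mono mult_mono) (auto simp: E_def)
      finally show ?thesis by simp
    qed
    show ?thesis using fin[OF step[OF G(1)]] fin[OF step[OF G(2)]] g(3) by (simp add: g_def)
  qed
  note main = this
  show ?thesis
  proof (intro exI[of _ M] conjI[of "1 \<le> M"] allI impI)
    show "1 \<le> M" by (rule M1)
  qed (rule main)
qed

text \<open>On a slice the projection loses only the \<open>x_k\<close> increment \<open>X\<close>.
  Since \<open>A p $ k\<close> is at least \<open>c0\<close> in absolute value,
  \<open>horizontal_increment_le\<close> bounds \<open>X\<close> by the remaining increments plus a
  multiple of the full gauge, which again contains \<open>X\<^sup>2\<close>.\<close>

lemma slice_gauge:
  assumes j: "bij_betw (j :: 'm::finite \<Rightarrow> 'n) UNIV (UNIV - {k})"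
  shows "\<exists>C\<ge>1. \<forall>p\<in>cball p0 r. \<forall>q\<in>cball p0 r. \<forall>h. f p = f q \<longrightarrow> hy p $ k = h \<longrightarrow> hy q $ k = h \<longrightarrow>
    gauge2 (slice_map j k h p) (slice_map j k h q) \<le> gauge2 p q \<and>
    gauge2 p q \<le> C * gauge2 (slice_map j k h p) (slice_map j k h q)"
proof -
  define C2 where "C2 = 10 * K ^ 3"
  \<comment> \<open>Arises from squaring the bound on \<open>(c0 / 2) * X\<close>:
    \<open>4 * K\<^sup>2\<close> from the linear terms, the other summand from \<open>C2 * g\<close>
    together with the a priori bound \<open>8 * K\<^sup>2\<close> on \<open>g\<close>.\<close>
  define C where "C = (4 / c0\<^sup>2) * (4 * K\<^sup>2 + 16 * K\<^sup>2 * C2\<^sup>2)"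
  have C: "C \<ge> 0" by (simp add: C_def)
  have "gauge2 (slice_map j k h p) (slice_map j k h q) \<le> gauge2 p q \<and>
    gauge2 p q \<le> (1 + C) * gauge2 (slice_map j k h p) (slice_map j k h q)"
    if p: "p \<in> cball p0 r" and q: "q \<in> cball p0 r" and feq: "f p = f q" and k: "hy p $ k = h" "hy q $ k = h" for p q h
  proof -
    define g where "g = gauge2 (slice_map j k h p) (slice_map j k h q)"
    define X where "X = \<bar>hx q $ k - hx p $ k\<bar>"
    define a where "a = norm (drop_coord j (hx q - hx p))"
    define e where "e = norm (drop_coord j (hy q - hy p))"
    have gg: "gauge2 p q = g + X\<^sup>2"
      using slice_hdist2[OF j k] slice_tau[OF j k] by (simp add: g_def gauge2_def X_def)
    have ga: "g = a\<^sup>2 + e\<^sup>2 + \<bar>tau p q\<bar>"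
      using slice_tau[OF j k] by (simp add: g_def gauge2_def hdist2_def slice_map_def a_def e_def drop_coord_diff)
    have g0: "g \<ge> 0" by (simp add: g_def)
    have pq: "norm (q - p) \<le> 2 * r" using p q dist_triangle3[of q p p0] by (auto simp: dist_norm)
    have "X \<le> norm (hx (q - p))" using component_le_norm_cart[of "hx (q - p)" k] by (simp add: X_def)
    then have X: "X \<le> 2 * r" using comp_norm_le(1)[of "q - p"] pq by linarith
    have "norm (q - p) \<le> 2 * K" using bp[OF in_R[OF p]] bp[OF in_R[OF q]] norm_triangle_ineq4[of q p] by linarith
    then have "(norm (q - p))\<^sup>2 \<le> (2 * K)\<^sup>2" by (rule power_mono) simp
    moreover have "hdist2 p q \<le> (norm (q - p))\<^sup>2" by (simp add: norm_heis_sq)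
    ultimately have "hdist2 p q \<le> 4 * K\<^sup>2" by (simp add: power_mult_distrib)
    then have "gauge2 p q \<le> 8 * K\<^sup>2"
      using tau_le[OF in_R[OF p] in_R[OF q]] unfolding gauge2_def by linarith
    moreover have "g \<le> gauge2 p q" by (simp add: gg)
    ultimately have gK: "g \<le> 8 * K\<^sup>2" by linarith
    have "A p \<bullet> (hx q - hx p) + B p \<bullet> (hy q - hy p) = drop_coord j (A p) \<bullet> drop_coord j (hx q - hx p)
       + drop_coord j (B p) \<bullet> drop_coord j (hy q - hy p) + A p $ k * (hx q $ k - hx p $ k)"
      using k by (simp add: inner_drop_coord[OF j])
    moreover have "\<bar>A p \<bullet> (hx q - hx p) + B p \<bullet> (hy q - hy p)\<bar> \<le> C2 * gauge2 p q"
      unfolding C2_def by (rule horizontal_increment_le[OF in_R[OF p] in_R[OF q] feq])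
    moreover have "\<bar>drop_coord j (A p) \<bullet> drop_coord j (hx q - hx p)\<bar> \<le> K * a"
      unfolding a_def using bA[OF in_R[OF p]] norm_drop_coord_le[OF j, of "A p"] K
      by (intro order_trans[OF Cauchy_Schwarz_ineq2] mult_mono) auto
    moreover have "\<bar>drop_coord j (B p) \<bullet> drop_coord j (hy q - hy p)\<bar> \<le> K * e"
      unfolding e_def using bB[OF in_R[OF p]] norm_drop_coord_le[OF j, of "B p"] K
      by (intro order_trans[OF Cauchy_Schwarz_ineq2] mult_mono) auto
    moreover have "c0 * X \<le> \<bar>A p $ k * (hx q $ k - hx p $ k)\<bar>"
      unfolding X_def abs_mult using c0(2)[OF p] by (intro mult_right_mono) auto
    ultimately have "c0 * X \<le> K * a + K * e + C2 * (g + X\<^sup>2)" unfolding gg by linarith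
    \<comment> \<open>Absorption: smallness of the ball hides the quadratic term in half of the left
      side.\<close>
    moreover have "C2 * X\<^sup>2 \<le> (c0 / 2) * X"
    proof -
      have "C2 * X\<^sup>2 = (C2 * X) * X" by (simp add: power2_eq_square)
      also have "\<dots> \<le> (C2 * (2 * r)) * X" using X K by (intro mult_right_mono mult_left_mono) (auto simp: C2_def X_def)
      also have "\<dots> \<le> (c0 / 2) * X" using small by (intro mult_right_mono) (auto simp: C2_def X_def)
      finally show ?thesis .
    qed
    ultimately have cX: "(c0 / 2) * X \<le> K * (a + e) + C2 * g" unfolding distrib_left by linarith
    have "(c0 / 2) * X \<le> norm (K * (a + e) + C2 * g)"
      using order_trans[OF cX abs_ge_self] by simp
    then have "((c0 / 2) * X)\<^sup>2 \<le> (norm (K * (a + e) + C2 * g))\<^sup>2"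
      using c0(1) by (intro power_mono) (auto simp: X_def)
    also have "\<dots> \<le> 2 * (K * (a + e))\<^sup>2 + 2 * (C2 * g)\<^sup>2"
      using norm_add_sq[of "K * (a + e)" "C2 * g"] by simp
    also have "\<dots> = K\<^sup>2 * (2 * (a + e)\<^sup>2) + 2 * C2\<^sup>2 * (g * g)" by (simp add: power_mult_distrib power2_eq_square)
    also have "\<dots> \<le> K\<^sup>2 * (4 * g) + 2 * C2\<^sup>2 * ((8 * K\<^sup>2) * g)"
    proof (rule add_mono)
      have "2 * (a + e)\<^sup>2 \<le> 4 * g" using sum_squares_bound[of a e] unfolding power2_sum ga by simp
      then show "K\<^sup>2 * (2 * (a + e)\<^sup>2) \<le> K\<^sup>2 * (4 * g)" by (rule mult_left_mono) simp
      show "2 * C2\<^sup>2 * (g * g) \<le> 2 * C2\<^sup>2 * ((8 * K\<^sup>2) * g)"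
        by (rule mult_left_mono[OF mult_right_mono[OF gK g0]]) simp
    qed
    finally have fin: "((c0 / 2) * X)\<^sup>2 \<le> K\<^sup>2 * (4 * g) + 2 * C2\<^sup>2 * ((8 * K\<^sup>2) * g)" .
    have "X\<^sup>2 = (4 / c0\<^sup>2) * ((c0 / 2) * X)\<^sup>2"
      using c0(1) by (simp add: power_mult_distrib power_divide)
    also have "\<dots> \<le> (4 / c0\<^sup>2) * (K\<^sup>2 * (4 * g) + 2 * C2\<^sup>2 * ((8 * K\<^sup>2) * g))"
      by (rule mult_left_mono[OF fin]) simp
    also have "\<dots> = (4 / c0\<^sup>2) * ((4 * K\<^sup>2 + 16 * K\<^sup>2 * C2\<^sup>2) * g)"
      by (rule arg_cong[of _ _ "\<lambda>z. (4 / c0\<^sup>2) * z"]) algebra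
    also have "\<dots> = C * g" by (simp only: C_def mult.assoc)
    finally have "X\<^sup>2 \<le> C * g" .
    then show ?thesis using gg by (simp add: g_def algebra_simps)
  qed
  note main = this
  show ?thesis
  proof (intro exI[of _ "1 + C"] conjI[of "1 \<le> 1 + C"] ballI allI impI)
    show "1 \<le> 1 + C" using C by simp
  qed (rule main)
qed

text \<open>The chart sends a point to the projection of its landing point on the slice, together
  with its initial height.\<close>

lemma straightening:
  assumes j: "bij_betw (j :: 'm::finite \<Rightarrow> 'n) UNIV (UNIV - {k})"
  shows "\<exists>\<rho>>0. \<exists>(F :: 'n heis \<Rightarrow> 'm heis_line) C. C \<ge> 1 \<and> (\<forall>p\<in>ball p0 \<rho>. \<forall>q\<in>ball p0 \<rho>. f p = 0 \<longrightarrow> f q = 0 \<longrightarrow>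
     line_gauge2 (F p) (F q) \<le> C * gauge2 p q \<and> gauge2 p q \<le> C * line_gauge2 (F p) (F q))"
proof -
  have "bdd_lipschitz_on (cball p0 r) (field k)" by (rule field_bdd_lipschitz[OF r(2) c0])
  then obtain a where a: "a > 0" "\<And>p. p \<in> cball p0 (r / 2) \<Longrightarrow> \<exists>c. trajectory (field k) (cball p0 r) a c \<and> c 0 = p"
    using ball_trajectory_exists r(1) by blast
  then obtain c where c: "\<And>p. p \<in> cball p0 (r / 2) \<Longrightarrow> trajectory (field k) (cball p0 r) a (c p)"
      "\<And>p. p \<in> cball p0 (r / 2) \<Longrightarrow> c p 0 = p"
    by metis
  \<comment> \<open>The flow lowers \<open>y_k\<close> at unit speed and heights in the ball of
    radius \<rho> differ from that of \<open>p0\<close> by less than \<open>a / 2\<close>; hence all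
    flow times down to \<open>h0\<close> lie between 0 and \<open>a\<close>.\<close>
  define h0 where "h0 = hy p0 $ k - a / 2"
  define \<rho> where "\<rho> = min (r / 2) (a / 2)"
  have \<rho>: "\<rho> > 0" using a r by (simp add: \<rho>_def)
  define e where "e p = c p (hy p $ k - h0)" for p
  define F where "F p = (slice_map j k h0 (e p), hy p $ k)" for p
  obtain M where M: "M \<ge> 1" and traj: "\<And>c c' b' s. b' \<le> a \<Longrightarrow> trajectory (field k) (cball p0 r) b' c \<Longrightarrow>
     trajectory (field k) (cball p0 r) b' c' \<Longrightarrow> f (c 0) = f (c' 0) \<Longrightarrow> s \<in> {0..b'} \<Longrightarrow>
    gauge2 (c s) (c' s) \<le> M * gauge2 (c 0) (c' 0) \<and> gauge2 (c 0) (c' 0) \<le> M * gauge2 (c s) (c' s)"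
    using two_trajectories[of a] a(1) by (metis less_imp_le)
  obtain Cs where Cs: "Cs \<ge> 1" and slice: "\<And>p q h. p \<in> cball p0 r \<Longrightarrow> q \<in> cball p0 r \<Longrightarrow> f p = f q \<Longrightarrow> hy p $ k = h \<Longrightarrow> hy q $ k = h \<Longrightarrow>
    gauge2 (slice_map j k h p) (slice_map j k h q) \<le> gauge2 p q \<and>
    gauge2 p q \<le> Cs * gauge2 (slice_map j k h p) (slice_map j k h q)"
    using slice_gauge[OF j] by metis
  \<comment> \<open>The first entry serves the upper bound for the chart, the second the lower
    one.\<close>
  define C where "C = max (1 + 3 * M + 9 * M * L\<^sup>2) (3 * (M * Cs + 3 * L\<^sup>2))"
  have main: "line_gauge2 (F p) (F q) \<le> C * gauge2 p q \<and> gauge2 p q \<le> C * line_gauge2 (F p) (F q)"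
    if p: "p \<in> ball p0 \<rho>" and q: "q \<in> ball p0 \<rho>" and f: "f p = 0" "f q = 0" and le: "hy p $ k \<le> hy q $ k" for p q
  proof -
    have t: "0 \<le> hy w $ k - h0" "hy w $ k - h0 \<le> a" "w \<in> cball p0 (r / 2)" if "w \<in> ball p0 \<rho>" for w
    proof -
      have "\<bar>hy (w - p0) $ k\<bar> \<le> norm (hy (w - p0))" by (rule component_le_norm_cart)
      also have "\<dots> \<le> norm (w - p0)" by (rule comp_norm_le)
      also have "\<dots> < a / 2" using that by (simp add: \<rho>_def dist_norm norm_minus_commute)
      finally have "\<bar>hy w $ k - hy p0 $ k\<bar> < a / 2" by simp
      then show "0 \<le> hy w $ k - h0" "hy w $ k - h0 \<le> a" unfolding h0_def by linarith+
      show "w \<in> cball p0 (r / 2)" using that by (simp add: \<rho>_def)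
    qed
    note tp = t[OF p] and tq = t[OF q]
    note cp = c[OF tp(3)] and cq = c[OF tq(3)]
    define h where "h = hy q $ k - hy p $ k"
    define s where "s = hy p $ k - h0"
    have hs: "0 \<le> h" "0 \<le> s" "h + s = hy q $ k - h0" "h + s \<le> a" "h \<le> a" "s \<le> a"
      using le tp tq by (auto simp: h_def s_def)
    \<comment> \<open>The higher point \<open>q\<close> flows to the height of \<open>p\<close>;
      from there \<open>p\<close> and \<open>m\<close> travel to the slice in the same time
      \<open>s\<close>. Both \<open>p\<close> and \<open>m\<close> lie in the zero set of
      \<open>f\<close>.\<close>
    define m where "m = c q h"
    have tr1: "trajectory (field k) (cball p0 r) s (c p)" using cp(1) hs by (auto intro: trajectory_restrict)
    have tr2: "trajectory (field k) (cball p0 r) s (\<lambda>u. c q (u + h))"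
      using cq(1) hs by (intro trajectory_shift) auto
    have fm: "f m = 0" unfolding m_def using trajectory_level[OF cq(1), of h] hs cq(2) f by simp
    have ep: "e p = c p s" and eq: "e q = c q (s + h)" using hs by (auto simp: e_def s_def h_def)
    have mem: "e p \<in> cball p0 r" "e q \<in> cball p0 r"
      unfolding ep eq using trajectory_mem[OF cp(1), of s] trajectory_mem[OF cq(1), of "s + h"] hs by auto
    have fe: "f (e p) = 0" "f (e q) = 0"
      unfolding ep eq using trajectory_level[OF cp(1), of s] trajectory_level[OF cq(1), of "s + h"] hs cp(2) cq(2) f by auto
    have ye: "hy (e p) $ k = h0" "hy (e q) $ k = h0"
      unfolding ep eq using trajectory_hy_k[OF cp(1), of s] trajectory_hy_k[OF cq(1), of "s + h"] hs cp(2) cq(2)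
      by (auto simp: s_def h_def)
    have T: "gauge2 (e p) (e q) \<le> M * gauge2 p m" "gauge2 p m \<le> M * gauge2 (e p) (e q)"
      using traj[OF hs(6) tr1 tr2, of s] f fm hs cp(2) by (auto simp: ep eq m_def)
    have qm: "gauge2 q m \<le> 3 * L\<^sup>2 * h\<^sup>2"
      using trajectory_gauge2[OF cq(1), of h] hs cq(2) by (simp add: m_def)
    define g where "g = gauge2 (slice_map j k h0 (e p)) (slice_map j k h0 (e q))"
    have g0: "g \<ge> 0" by (simp add: g_def)
    have S: "g \<le> gauge2 (e p) (e q)" "gauge2 (e p) (e q) \<le> Cs * g"
      using slice[OF mem _ ye] fe by (auto simp: g_def)
    have lg: "line_gauge2 (F p) (F q) = g + h\<^sup>2" by (simp add: line_gauge2_def F_def g_def h_def)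
    have h2: "h\<^sup>2 \<le> gauge2 p q"
    proof -
      have "\<bar>h\<bar> \<le> norm (hy q - hy p)" using component_le_norm_cart[of "hy q - hy p" k] by (simp add: h_def)
      then have "h\<^sup>2 \<le> (norm (hy q - hy p))\<^sup>2" by (metis abs_ge_zero power2_abs power_mono)
      then show ?thesis unfolding gauge2_def hdist2_def by (smt (verit) zero_le_power2)
    qed
    have "gauge2 p q \<le> 3 * (gauge2 p m + gauge2 q m)"
      using gauge2_triangle[of p q m] by (simp add: gauge2_swap[of m])
    also have "\<dots> \<le> 3 * (M * (Cs * g) + 3 * L\<^sup>2 * h\<^sup>2)"
      using T(2) qm order_trans[OF T(2) mult_left_mono[OF S(2)]] M by auto
    also have "\<dots> \<le> 3 * ((M * Cs + 3 * L\<^sup>2) * (g + h\<^sup>2))"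
      using g0 M Cs by (simp add: algebra_simps)
    also have "\<dots> \<le> C * (g + h\<^sup>2)" unfolding mult.assoc[symmetric]
      using g0 by (intro mult_right_mono) (auto simp: C_def)
    finally have 1: "gauge2 p q \<le> C * line_gauge2 (F p) (F q)" by (simp add: lg)
    have "gauge2 p m \<le> 3 * (gauge2 p q + 3 * L\<^sup>2 * h\<^sup>2)"
      using gauge2_triangle[of p m q] qm by simp
    also have "\<dots> \<le> 3 * (gauge2 p q + 3 * L\<^sup>2 * gauge2 p q)"
      using h2 by (intro mult_left_mono add_mono) auto
    finally have pm: "gauge2 p m \<le> (3 + 9 * L\<^sup>2) * gauge2 p q" by (simp add: algebra_simps)
    have "g \<le> M * gauge2 p m" using S(1) T(1) by simp
    also have "\<dots> \<le> M * ((3 + 9 * L\<^sup>2) * gauge2 p q)" using pm M by (intro mult_left_mono) auto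
    finally have "g + h\<^sup>2 \<le> (1 + 3 * M + 9 * M * L\<^sup>2) * gauge2 p q" using h2 by (simp add: algebra_simps)
    also have "\<dots> \<le> C * gauge2 p q" by (intro mult_right_mono) (auto simp: C_def)
    finally show ?thesis using 1 by (simp add: lg)
  qed
  \<comment> \<open>The estimate was proved with \<open>q\<close> the higher point; symmetry gives
    the other order.\<close>
  have sym: "line_gauge2 (F p) (F q) = line_gauge2 (F q) (F p)" for p q
    by (simp add: line_gauge2_def gauge2_swap[of "fst (F p)"] power2_commute)
  have "line_gauge2 (F p) (F q) \<le> C * gauge2 p q \<and> gauge2 p q \<le> C * line_gauge2 (F p) (F q)"
    if "p \<in> ball p0 \<rho>" "q \<in> ball p0 \<rho>" "f p = 0" "f q = 0" for p q
    using main[OF that] main[OF that(2,1,4,3)] sym[of p q] gauge2_swap[of p q] linear[of "hy p $ k" "hy q $ k"] by auto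
  moreover have "C \<ge> 1" using M by (auto simp: C_def le_max_iff_disj)
  ultimately show ?thesis using \<rho> by blast
qed

end

lemma (in horizontal_taylor) straightening_of_x_component:
  assumes j: "bij_betw (j :: 'm::finite \<Rightarrow> 'n) UNIV (UNIV - {k})" and nz: "A p0 $ k \<noteq> 0"
  shows "\<exists>\<rho>>0. \<exists>(F :: 'n heis \<Rightarrow> 'm heis_line) C. C \<ge> 1 \<and> (\<forall>p\<in>ball p0 \<rho>. \<forall>q\<in>ball p0 \<rho>. f p = 0 \<longrightarrow> f q = 0 \<longrightarrow>
     line_gauge2 (F p) (F q) \<le> C * gauge2 p q \<and> gauge2 p q \<le> C * line_gauge2 (F p) (F q))"
proof -
  obtain J where J: "J > 0" "\<And>x y. x \<in> cball p0 R \<Longrightarrow> y \<in> cball p0 R \<Longrightarrow> norm (A x - A y) \<le> J * dist x y"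
    by (rule bdd_lipschitz_onE[OF lipA]) blast
  define c0 where "c0 = \<bar>A p0 $ k\<bar> / 2"
  \<comment> \<open>The second entry keeps \<open>A p $ k\<close> above half of its absolute value
    at \<open>p0\<close>, the third yields the smallness condition of
    \<open>char_field\<close>.\<close>
  define r where "r = min R (min (c0 / J) (c0 / (40 * K ^ 3)))"
  have K3: "40 * K ^ 3 > 0" using K by simp
  have c0: "c0 > 0" using nz by (simp add: c0_def)
  have "r \<le> c0 / J" "r \<le> c0 / (40 * K ^ 3)" by (simp_all add: r_def)
  then have r: "0 < r" "r \<le> R" "J * r \<le> c0" "40 * K ^ 3 * r \<le> c0"
  proof -
    show "0 < r" using R c0 J(1) K3 by (simp add: r_def)
    show "r \<le> R" by (simp add: r_def)
    show "J * r \<le> c0" using mult_left_mono[OF \<open>r \<le> c0 / J\<close>, of J] J(1) by simp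
    show "40 * K ^ 3 * r \<le> c0" using mult_left_mono[OF \<open>r \<le> c0 / (40 * K ^ 3)\<close>, of "40 * K ^ 3"] K3 by simp
  qed
  have low: "c0 \<le> \<bar>A p $ k\<bar>" if "p \<in> cball p0 r" for p
  proof -
    have "\<bar>(A p - A p0) $ k\<bar> \<le> norm (A p - A p0)" by (rule component_le_norm_cart)
    also have "\<dots> \<le> J * dist p p0" using that r R by (intro J(2)) auto
    also have "\<dots> \<le> J * r" using that J(1) by (intro mult_left_mono) (auto simp: dist_commute)
    finally have "\<bar>A p $ k - A p0 $ k\<bar> \<le> c0" using r by simp
    then show ?thesis using abs_triangle_ineq2_sym[of "A p0 $ k" "A p $ k"] unfolding c0_def by linarith
  qed
  obtain L where L: "L > 0" "\<And>x. x \<in> cball p0 r \<Longrightarrow> norm (field k x) \<le> L"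
    "\<And>x y. x \<in> cball p0 r \<Longrightarrow> y \<in> cball p0 r \<Longrightarrow> norm (field k x - field k y) \<le> L * dist x y"
    by (rule bdd_lipschitz_onE[OF field_bdd_lipschitz[OF r(2) c0 low]]) blast+
  interpret char_field f A B T p0 R K k r c0 L
    by unfold_locales (use r c0 low L in auto)
  show ?thesis by (rule straightening[OF j])
qed
text \<open>
  An automorphism exchanging the roles of \<open>A\<close> and \<open>B\<close>, which reduces the case \<open>B p0 \<noteq> 0\<close> to
  \<open>A p0 \<noteq> 0\<close>.
\<close>

definition quarter_turn :: "'n::finite heis \<Rightarrow> 'n heis" where
  "quarter_turn p = (hy p, - hx p, ht p)"

definition quarter_turn_inv :: "'n::finite heis \<Rightarrow> 'n heis" where
  "quarter_turn_inv p = (- hy p, hx p, ht p)"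

lemma quarter_turn_inverse [simp]:
  "quarter_turn_inv (quarter_turn p) = p" "quarter_turn (quarter_turn_inv p) = p"
  by (simp_all add: quarter_turn_def quarter_turn_inv_def)

lemma gauge2_quarter_turn: "gauge2 (quarter_turn p) (quarter_turn q) = gauge2 p q"
proof -
  have "norm (- hx q + hx p) = norm (hx q - hx p)" by (simp add: norm_minus_commute)
  then show ?thesis
    by (simp add: gauge2_def hdist2_def tau_def quarter_turn_def field_simps)
qed

lemma tau_quarter_turn_inv: "tau (quarter_turn_inv p) (quarter_turn_inv q) = tau p q"
  by (simp add: tau_def quarter_turn_inv_def field_simps)

lemma norm_quarter_turn_inv: "norm (quarter_turn_inv p) = norm p"
  by (cases p) (simp add: quarter_turn_inv_def norm_Pair)

lemma quarter_turn_inv_diff: "quarter_turn_inv p - quarter_turn_inv q = quarter_turn_inv (p - q)"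
  by (simp add: quarter_turn_inv_def)

lemma quarter_turn_inv_dist: "dist (quarter_turn_inv p) (quarter_turn_inv q) = dist p q"
  by (simp add: dist_norm quarter_turn_inv_diff norm_quarter_turn_inv)

lemma quarter_turn_dist: "dist (quarter_turn p) (quarter_turn q) = dist p q"
  using quarter_turn_inv_dist[of "quarter_turn p" "quarter_turn q"] by simp

context horizontal_taylor
begin

text \<open>Chain rule: under the inverse turn an \<open>x\<close> increment becomes a
  \<open>y\<close> increment and a \<open>y\<close> increment a negative \<open>x\<close> increment,
  so \<open>B\<close> and \<open>- A\<close> take the places of \<open>A\<close> and
  \<open>B\<close>. The turn preserves \<open>tau\<close> and Euclidean norms, hence
  \<open>R\<close> and \<open>K\<close>.\<close>

lemma quarter_turned:
  "horizontal_taylor (\<lambda>p. f (quarter_turn_inv p)) (\<lambda>p. B (quarter_turn_inv p))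
     (\<lambda>p. - A (quarter_turn_inv p)) (\<lambda>p. T (quarter_turn_inv p)) (quarter_turn p0) R K"
proof -
  have mem: "quarter_turn_inv p \<in> cball p0 R" if "p \<in> cball (quarter_turn p0) R" for p
    using that quarter_turn_dist[of p0 "quarter_turn_inv p"] by simp
  have lip: "bdd_lipschitz_on (cball (quarter_turn p0) R) (\<lambda>p. g (quarter_turn_inv p))"
    if g: "bdd_lipschitz_on (cball p0 R) g" for g :: "'n heis \<Rightarrow> 'z::real_normed_vector"
  proof -
    obtain J where J: "J > 0" "\<And>x. x \<in> cball p0 R \<Longrightarrow> norm (g x) \<le> J"
      "\<And>x y. x \<in> cball p0 R \<Longrightarrow> y \<in> cball p0 R \<Longrightarrow> norm (g x - g y) \<le> J * dist x y"
      by (rule bdd_lipschitz_onE[OF g]) blast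
    show ?thesis
    proof (rule bdd_lipschitz_onI)
      show "norm (g (quarter_turn_inv x)) \<le> J" if "x \<in> cball (quarter_turn p0) R" for x
        by (rule J(2)[OF mem[OF that]])
      show "norm (g (quarter_turn_inv x) - g (quarter_turn_inv y)) \<le> J * dist x y"
        if "x \<in> cball (quarter_turn p0) R" "y \<in> cball (quarter_turn p0) R" for x y
        using J(3)[OF mem[OF that(1)] mem[OF that(2)]] by (simp only: quarter_turn_inv_dist)
    qed (use J(1) in simp)
  qed
  show ?thesis
  proof
    show "bdd_lipschitz_on (cball (quarter_turn p0) R) (\<lambda>p. - A (quarter_turn_inv p))"
      by (intro bounded_linear.bdd_lipschitz_on[OF bounded_linear_minus[OF bounded_linear_ident]] lip lipA)
    fix p assume p: "p \<in> cball (quarter_turn p0) R"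
    note m = mem[OF p]
    show "norm (B (quarter_turn_inv p)) \<le> K" "norm (- A (quarter_turn_inv p)) \<le> K" "\<bar>T (quarter_turn_inv p)\<bar> \<le> K"
      using bA[OF m] bB[OF m] bT[OF m] by simp_all
    show "norm p \<le> K" using bp[OF m] by (simp add: norm_quarter_turn_inv)
    fix q assume q: "q \<in> cball (quarter_turn p0) R"
    have "A (quarter_turn_inv p) \<bullet> (hx (quarter_turn_inv q) - hx (quarter_turn_inv p)) = - A (quarter_turn_inv p) \<bullet> (hy q - hy p)"
      "B (quarter_turn_inv p) \<bullet> (hy (quarter_turn_inv q) - hy (quarter_turn_inv p)) = B (quarter_turn_inv p) \<bullet> (hx q - hx p)"
      by (simp_all add: quarter_turn_inv_def inner_diff_right)
    then show "\<bar>f (quarter_turn_inv q) - f (quarter_turn_inv p) - B (quarter_turn_inv p) \<bullet> (hx q - hx p) -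
       - A (quarter_turn_inv p) \<bullet> (hy q - hy p) - T (quarter_turn_inv p) * tau p q\<bar> \<le> K * (norm (q - p))\<^sup>2"
      using taylor[OF m mem[OF q]]
      by (simp add: tau_quarter_turn_inv quarter_turn_inv_diff norm_quarter_turn_inv algebra_simps)
  qed (use R K lip lipA lipB lipT in auto)
qed

lemma straightening_noncharacteristic:
  assumes m: "CARD('m::finite) = CARD('n) - 1" and nz: "A p0 \<noteq> 0 \<or> B p0 \<noteq> 0"
  shows "\<exists>\<rho>>0. \<exists>(F :: 'n heis \<Rightarrow> 'm heis_line) C. C \<ge> 1 \<and> (\<forall>p\<in>ball p0 \<rho>. \<forall>q\<in>ball p0 \<rho>. f p = 0 \<longrightarrow> f q = 0 \<longrightarrow>
     line_gauge2 (F p) (F q) \<le> C * gauge2 p q \<and> gauge2 p q \<le> C * line_gauge2 (F p) (F q))"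
proof -
  have j: "\<exists>j :: 'm \<Rightarrow> 'n. bij_betw j UNIV (UNIV - {k})" for k
    by (rule finite_same_card_bij) (use m in \<open>auto simp: card_Diff_singleton\<close>)
  show ?thesis
  proof (cases "A p0 = 0")
    case False
    then obtain k where k: "A p0 $ k \<noteq> 0" by (auto simp: vec_eq_iff)
    then show ?thesis using j[of k] straightening_of_x_component by blast
  next
    case True
    then obtain k where k: "B p0 $ k \<noteq> 0" using nz by (auto simp: vec_eq_iff)
    interpret q: horizontal_taylor "\<lambda>p. f (quarter_turn_inv p)" "\<lambda>p. B (quarter_turn_inv p)"
     "\<lambda>p. - A (quarter_turn_inv p)" "\<lambda>p. T (quarter_turn_inv p)" "quarter_turn p0" R K
      by (rule quarter_turned)
    obtain j :: "'m \<Rightarrow> 'n" where j: "bij_betw j UNIV (UNIV - {k})" using j by blast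
    have "B (quarter_turn_inv (quarter_turn p0)) $ k \<noteq> 0" using k by simp
    from q.straightening_of_x_component[OF j this] obtain \<rho> and F :: "'n heis \<Rightarrow> 'm heis_line" and C
      where F: "\<rho> > 0" "C \<ge> 1" and FC: "\<And>p q. p\<in>ball (quarter_turn p0) \<rho> \<Longrightarrow> q\<in>ball (quarter_turn p0) \<rho> \<Longrightarrow>
        f (quarter_turn_inv p) = 0 \<Longrightarrow> f (quarter_turn_inv q) = 0 \<Longrightarrow>
     line_gauge2 (F p) (F q) \<le> C * gauge2 p q \<and> gauge2 p q \<le> C * line_gauge2 (F p) (F q)"
      by blast
    show ?thesis
    proof (rule exI[of _ \<rho>], rule conjI[OF F(1)], rule exI[of _ "\<lambda>p. F (quarter_turn p)"], rule exI[of _ C],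
        rule conjI[OF F(2)], intro ballI impI)
      fix p q assume "p \<in> ball p0 \<rho>" "q \<in> ball p0 \<rho>" "f p = 0" "f q = 0"
      then show "line_gauge2 (F (quarter_turn p)) (F (quarter_turn q)) \<le> C * gauge2 p q \<and>
          gauge2 p q \<le> C * line_gauge2 (F (quarter_turn p)) (F (quarter_turn q))"
        using FC[of "quarter_turn p" "quarter_turn q"] by (simp add: quarter_turn_dist gauge2_quarter_turn)
    qed
  qed
qed

text \<open>With \<open>A\<close> and \<open>B\<close> vanishing at \<open>p\<close>, the expansion
  bounds \<open>tau p q\<close> by the squared Euclidean distance, which itself contains a vertical
  part. On a small ball that part is absorbed, and the horizontal increments remain.\<close>

lemma characteristic_gauge:
  assumes nz: "T p0 \<noteq> 0"
  shows "\<exists>\<rho>>0. \<rho> \<le> R \<and> (\<exists>C>0. \<forall>p\<in>ball p0 \<rho>. \<forall>q\<in>ball p0 \<rho>. f p = f q \<longrightarrow> A p = 0 \<longrightarrow> B p = 0 \<longrightarrow>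
     gauge2 p q \<le> C * hdist2 p q)"
proof -
  obtain J where J: "J > 0" "\<And>x y. x \<in> cball p0 R \<Longrightarrow> y \<in> cball p0 R \<Longrightarrow> norm (T x - T y) \<le> J * dist x y"
    by (rule bdd_lipschitz_onE[OF lipT]) blast
  define c where "c = \<bar>T p0\<bar> / 2"
  have c: "c > 0" using nz by (simp add: c_def)
  \<comment> \<open>The second entry keeps \<open>T\<close> above \<open>c\<close> in absolute
    value; the third gives \<open>tau\<close> at most half of the Euclidean distance
    \<open>n\<close>, so that twice its square is at most half of \<open>n\<^sup>2\<close>.\<close>
  define r where "r = min R (min (c / J) (c / (4 * K)))"
  have K0: "4 * K > 0" using K by simp
  have r: "r > 0" "r \<le> R" using R c J(1) K0 by (auto simp: r_def)
  have "r \<le> c / J" "r \<le> c / (4 * K)" by (simp_all add: r_def)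
  then have rJ: "J * r \<le> c" and rK: "4 * K * r \<le> c"
    using mult_left_mono[of r "c / J" J] mult_left_mono[of r "c / (4 * K)" "4 * K"] J(1) K0 by simp_all
  define C where "C = 1 + 2 * (K / c) * (1 + K\<^sup>2)"
  have C: "C > 0" using K c by (auto simp: C_def intro!: add_pos_nonneg)
  have main: "gauge2 p q \<le> C * hdist2 p q"
    if p: "p \<in> ball p0 r" and q: "q \<in> ball p0 r" and f: "f p = f q" and AB: "A p = 0" "B p = 0" for p q
  proof -
    have pR: "p \<in> cball p0 R" and qR: "q \<in> cball p0 R" using p q r by auto
    have "norm (T p - T p0) \<le> J * dist p p0" using pR R by (intro J(2)) auto
    also have "\<dots> \<le> J * r" using p J(1) by (intro mult_left_mono) (auto simp: dist_commute)
    finally have "norm (T p - T p0) \<le> c" using rJ by linarith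
    then have Tp: "c \<le> \<bar>T p\<bar>" using abs_triangle_ineq2_sym[of "T p0" "T p"] unfolding c_def real_norm_def by linarith
    define n where "n = norm (q - p)"
    have n2: "n \<le> 2 * r"
      using p q dist_triangle3[of q p p0] unfolding n_def dist_norm[symmetric] mem_ball by linarith
    have n0: "n \<ge> 0" by (simp add: n_def)
    have "\<bar>T p * tau p q\<bar> \<le> K * n\<^sup>2" using taylor[OF pR qR] f AB by (simp add: n_def)
    moreover have "c * \<bar>tau p q\<bar> \<le> \<bar>T p * tau p q\<bar>" unfolding abs_mult using Tp by (intro mult_right_mono) auto
    ultimately have ct: "c * \<bar>tau p q\<bar> \<le> K * n\<^sup>2" by linarith
    have "K * n\<^sup>2 = (K * n) * n" by (simp add: power2_eq_square)
    also have "\<dots> \<le> (K * (2 * r)) * n" using n2 n0 K by (intro mult_right_mono mult_left_mono) auto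
    also have "\<dots> \<le> (c / 2) * n" using rK n0 by (intro mult_right_mono) auto
    finally have "c * \<bar>tau p q\<bar> \<le> c * (n / 2)" using ct by simp
    then have "\<bar>tau p q\<bar> \<le> n / 2" using c by simp
    then have "(tau p q)\<^sup>2 \<le> (n / 2)\<^sup>2" using power_mono[of "\<bar>tau p q\<bar>" "n / 2" 2] by simp
    then have "2 * (tau p q)\<^sup>2 \<le> n\<^sup>2 / 2" by (simp add: power_divide)
    moreover have "n\<^sup>2 \<le> hdist2 p q + (2 * (tau p q)\<^sup>2 + K\<^sup>2 * hdist2 p q)"
      using ht_diff_sq_le[OF pR, of q] unfolding n_def norm_heis_sq by linarith
    ultimately have n_le: "n\<^sup>2 \<le> 2 * ((1 + K\<^sup>2) * hdist2 p q)" unfolding distrib_right mult_1 by argo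
    have "\<bar>tau p q\<bar> \<le> (K / c) * n\<^sup>2" using ct c by (simp add: field_simps)
    also have "\<dots> \<le> (K / c) * (2 * ((1 + K\<^sup>2) * hdist2 p q))" using n_le K c by (intro mult_left_mono) auto
    finally have "\<bar>tau p q\<bar> \<le> (2 * (K / c) * (1 + K\<^sup>2)) * hdist2 p q" by (simp only: mult_ac)
    then show ?thesis unfolding gauge2_def C_def distrib_right by linarith
  qed
  show ?thesis
    by (rule exI[of _ r], rule conjI[OF r(1)], rule conjI[OF r(2)], rule exI[of _ C], rule conjI[OF C],
        intro ballI impI, rule main)
qed

end

section \<open>Taylor expansion of smooth functions\<close>

lemma bdd_lipschitz_on_sum:
  assumes "finite I" "\<And>i. i \<in> I \<Longrightarrow> bdd_lipschitz_on S (g i)"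
  shows "bdd_lipschitz_on S (\<lambda>x. \<Sum>i\<in>I. g i x)"
  using assms by (induction I) (auto intro: bdd_lipschitz_on_add bdd_lipschitz_on_const)

text \<open>\<open>Ck_on\<close> gives continuity of the derivative one direction at a time, so the
  operator norm is bounded through the finitely many basis directions and compactness of the
  ball.\<close>

lemma C1_bdd_lipschitz_on_cball:
  fixes g :: "'a::euclidean_space \<Rightarrow> real"
  assumes "Ck_on (Suc 0) U g" "cball p0 R \<subseteq> U"
  shows "bdd_lipschitz_on (cball p0 R) g"
proof -
  define D where "D p = frechet_derivative g (at p)" for p
  have der: "(g has_derivative D p) (at p)" if "p \<in> U" for p
    using assms(1) that unfolding D_def by (auto simp: frechet_derivative_works)
  have "\<exists>M. \<forall>p\<in>cball p0 R. norm (D p b) \<le> M" for b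
  proof -
    have "continuous_on (cball p0 R) (\<lambda>p. D p b)"
      using assms unfolding D_def by (auto intro: continuous_on_subset)
    then have "bounded ((\<lambda>p. D p b) ` cball p0 R)"
      by (intro compact_imp_bounded compact_continuous_image compact_cball)
    then show ?thesis unfolding bounded_iff by auto
  qed
  then obtain M where M: "\<And>b p. p \<in> cball p0 R \<Longrightarrow> norm (D p b) \<le> M b" by metis
  define L where "L = (\<Sum>b\<in>Basis. \<bar>M b\<bar>)"
  have L: "L \<ge> 0" by (simp add: L_def sum_nonneg)
  have bound: "norm (D p v) \<le> L * norm v" if p: "p \<in> cball p0 R" for p v
  proof -
    interpret bounded_linear "D p" by (rule has_derivative_bounded_linear[OF der]) (use p assms in auto)
    have "D p v = (\<Sum>b\<in>Basis. (v \<bullet> b) *\<^sub>R D p b)"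
      by (subst euclidean_representation[of v, symmetric]) (simp add: sum scaleR)
    also have "norm \<dots> \<le> (\<Sum>b\<in>Basis. norm v * \<bar>M b\<bar>)"
    proof (rule sum_norm_le)
      fix b :: 'a assume b: "b \<in> Basis"
      have "norm (D p b) \<le> \<bar>M b\<bar>" using M[OF p, of b] by linarith
      then show "norm ((v \<bullet> b) *\<^sub>R D p b) \<le> norm v * \<bar>M b\<bar>"
        using Basis_le_norm[OF b, of v] unfolding norm_scaleR by (intro mult_mono) auto
    qed
    finally show ?thesis by (simp add: L_def sum_distrib_left mult.commute)
  qed
  have lip: "norm (g x - g y) \<le> L * dist x y" if "x \<in> cball p0 R" "y \<in> cball p0 R" for x y
    unfolding dist_norm
  proof (rule differentiable_bound[OF convex_cball _ _ that])
    fix p assume p: "p \<in> cball p0 R"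
    show "(g has_derivative D p) (at p within cball p0 R)"
      by (rule has_derivative_at_withinI[OF der[OF subsetD[OF assms(2) p]]])
    show "onorm (D p) \<le> L" using bound[OF p] L by (intro onorm_bound)
  qed
  have "continuous_on (cball p0 R) g"
    using der assms(2) by (intro continuous_at_imp_continuous_on) (auto intro: has_derivative_continuous)
  then have "bounded (g ` cball p0 R)" by (intro compact_imp_bounded compact_continuous_image compact_cball)
  moreover have "L-lipschitz_on (cball p0 R) g"
    using lip L by (auto simp: lipschitz_on_def dist_norm simp del: mem_cball)
  ultimately show ?thesis unfolding bdd_lipschitz_on_def by blast
qed

definition grad :: "('a::euclidean_space \<Rightarrow> real) \<Rightarrow> 'a \<Rightarrow> 'a" where
  "grad f p = (\<Sum>b\<in>Basis. frechet_derivative f (at p) b *\<^sub>R b)"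

lemma frechet_derivative_eq_grad:
  assumes "f differentiable (at p)"
  shows "frechet_derivative f (at p) v = grad f p \<bullet> v"
proof -
  interpret bounded_linear "frechet_derivative f (at p)"
    using assms by (intro has_derivative_bounded_linear) (simp add: frechet_derivative_works)
  have "frechet_derivative f (at p) v = (\<Sum>b\<in>Basis. (v \<bullet> b) * frechet_derivative f (at p) b)"
    by (subst euclidean_representation[of v, symmetric]) (simp add: sum scaleR)
  then show ?thesis by (simp only: grad_def inner_sum_left inner_scaleR_left inner_commute[of v] mult.commute)
qed

text \<open>The gradient is Lipschitz, being built from functions of class C1; the remainder
  estimate is the mean value inequality on the segment from \<open>p\<close> to
  \<open>q\<close>.\<close>

lemma C2_taylor:
  fixes f :: "'a::euclidean_space \<Rightarrow> real"
  assumes "Ck_on (Suc (Suc 0)) U f" "cball p0 R \<subseteq> U"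
  shows "bdd_lipschitz_on (cball p0 R) (grad f)"
    "\<exists>L>0. \<forall>p\<in>cball p0 R. \<forall>q\<in>cball p0 R. \<bar>f q - f p - grad f p \<bullet> (q - p)\<bar> \<le> L * (norm (q - p))\<^sup>2"
proof -
  have "bdd_lipschitz_on (cball p0 R) (\<lambda>p. frechet_derivative f (at p) b)" for b
    using assms by (intro C1_bdd_lipschitz_on_cball[of U]) auto
  then show lip: "bdd_lipschitz_on (cball p0 R) (grad f)"
    unfolding grad_def[abs_def]
    by (intro bdd_lipschitz_on_sum finite_Basis bounded_linear.bdd_lipschitz_on[OF bounded_linear_scaleR_left])
  obtain L where L: "L > 0" "\<And>x y. x \<in> cball p0 R \<Longrightarrow> y \<in> cball p0 R \<Longrightarrow> norm (grad f x - grad f y) \<le> L * dist x y"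
    by (rule bdd_lipschitz_onE[OF lip]) blast
  have diff: "f differentiable (at x)" if "x \<in> cball p0 R" for x using assms that by auto
  have "\<bar>f q - f p - grad f p \<bullet> (q - p)\<bar> \<le> L * (norm (q - p))\<^sup>2" if p: "p \<in> cball p0 R" and q: "q \<in> cball p0 R" for p q
  proof -
    have seg: "closed_segment p q \<subseteq> cball p0 R" using p q by (simp add: closed_segment_subset)
    have "norm (f q - f p - frechet_derivative f (at p) (q - p)) \<le> norm (q - p) * (L * norm (q - p))"
    proof (rule differentiable_bound_linearization[where S = "closed_segment p q"])
      show "p + t *\<^sub>R (q - p) \<in> closed_segment p q" if "t \<in> {0..1}" for t
      proof -
        have "p + t *\<^sub>R (q - p) = (1 - t) *\<^sub>R p + t *\<^sub>R q" by (simp add: algebra_simps)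
        then show ?thesis using that unfolding closed_segment_def by auto
      qed
      fix x assume x: "x \<in> closed_segment p q"
      then have xc: "x \<in> cball p0 R" using seg by blast
      show "(f has_derivative frechet_derivative f (at x)) (at x within closed_segment p q)"
        using diff[OF xc] by (rule has_derivative_at_withinI[OF iffD1[OF frechet_derivative_works]])
      show "onorm (frechet_derivative f (at x) - frechet_derivative f (at p)) \<le> L * norm (q - p)"
      proof (rule onorm_bound)
        fix v
        have "norm ((frechet_derivative f (at x) - frechet_derivative f (at p)) v) = \<bar>(grad f x - grad f p) \<bullet> v\<bar>"
          using frechet_derivative_eq_grad[OF diff[OF xc]] frechet_derivative_eq_grad[OF diff[OF p]]
          by (simp add: inner_diff_left)
        also have "\<dots> \<le> norm (grad f x - grad f p) * norm v" by (rule Cauchy_Schwarz_ineq2)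
        also have "\<dots> \<le> (L * norm (q - p)) * norm v"
        proof (rule mult_right_mono)
          have "dist x p \<le> norm (q - p)"
            using segment_bound(1)[OF x] by (simp add: dist_norm norm_minus_commute)
          then show "norm (grad f x - grad f p) \<le> L * norm (q - p)"
            using L(1) by (intro order_trans[OF L(2)[OF xc p]] mult_left_mono) auto
        qed simp
        finally show "norm ((frechet_derivative f (at x) - frechet_derivative f (at p)) v) \<le> (L * norm (q - p)) * norm v" .
      qed (use L in simp)
    qed simp
    then show ?thesis
      using frechet_derivative_eq_grad[OF diff[OF p]] by (simp add: power2_eq_square mult_ac)
  qed
  then show "\<exists>L>0. \<forall>p\<in>cball p0 R. \<forall>q\<in>cball p0 R. \<bar>f q - f p - grad f p \<bullet> (q - p)\<bar> \<le> L * (norm (q - p))\<^sup>2"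
    using L(1) by blast
qed

text \<open>The Euclidean expansion rewritten in the left-invariant frame: replacing the increment
  of \<open>ht\<close> by \<open>tau\<close> through \<open>ht_diff_eq\<close> moves half of the
  bracket into the horizontal coefficients, which turn into the derivatives along the left-invariant
  fields.\<close>

lemma smooth_horizontal_taylor:
  fixes f :: "'n::finite heis \<Rightarrow> real"
  assumes "open U" "p0 \<in> U" "Ck_on (Suc (Suc 0)) U f"
  shows "\<exists>R K. cball p0 R \<subseteq> U \<and> horizontal_taylor f
    (\<lambda>p. hx (grad f p) + (- 1 / 2 * ht (grad f p)) *\<^sub>R hy p) (\<lambda>p. hy (grad f p) + (1 / 2 * ht (grad f p)) *\<^sub>R hx p)
    (\<lambda>p. ht (grad f p)) p0 R K"
proof -
  obtain R where R: "R > 0" "cball p0 R \<subseteq> U" using assms(1,2) open_contains_cball by blast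
  note lip = C2_taylor(1)[OF assms(3) R(2)]
  obtain L where L: "L > 0" "\<And>p q. p\<in>cball p0 R \<Longrightarrow> q\<in>cball p0 R \<Longrightarrow> \<bar>f q - f p - grad f p \<bullet> (q - p)\<bar> \<le> L * (norm (q - p))\<^sup>2"
    using C2_taylor(2)[OF assms(3) R(2)] by blast
  note id = bdd_lipschitz_on_id[OF bounded_cball]
  note l1 = bounded_linear.bdd_lipschitz_on[OF bounded_linear_fst] and l2 = bounded_linear.bdd_lipschitz_on[OF bounded_linear_snd]
  note T = l2[OF l2[OF lip]]
  define A where "A p = hx (grad f p) + (- 1 / 2 * ht (grad f p)) *\<^sub>R hy p" for p
  define B where "B p = hy (grad f p) + (1 / 2 * ht (grad f p)) *\<^sub>R hx p" for p
  have A: "bdd_lipschitz_on (cball p0 R) A" unfolding A_def[abs_def]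
    by (intro bdd_lipschitz_on_add bounded_bilinear.bdd_lipschitz_on[OF bounded_bilinear_scaleR]
        bounded_linear.bdd_lipschitz_on[OF bounded_linear_mult_right] T l1[OF lip] l1[OF l2[OF id]])
  have B: "bdd_lipschitz_on (cball p0 R) B" unfolding B_def[abs_def]
    by (intro bdd_lipschitz_on_add bounded_bilinear.bdd_lipschitz_on[OF bounded_bilinear_scaleR]
        bounded_linear.bdd_lipschitz_on[OF bounded_linear_mult_right] T l1[OF l2[OF lip]] l1[OF id])
  obtain K1 where K1: "K1 > 0" "\<And>x. x \<in> cball p0 R \<Longrightarrow> norm (A x) \<le> K1" by (rule bdd_lipschitz_onE[OF A]) blast
  obtain K2 where K2: "K2 > 0" "\<And>x. x \<in> cball p0 R \<Longrightarrow> norm (B x) \<le> K2" by (rule bdd_lipschitz_onE[OF B]) blast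
  obtain K3 where K3: "K3 > 0" "\<And>x. x \<in> cball p0 R \<Longrightarrow> norm (ht (grad f x)) \<le> K3" by (rule bdd_lipschitz_onE[OF T]) blast
  obtain K4 where K4: "K4 > 0" "\<And>x. x \<in> cball p0 R \<Longrightarrow> norm x \<le> K4" by (rule bdd_lipschitz_onE[OF id]) blast
  define K where "K = 1 + K1 + K2 + K3 + K4 + L"
  have "horizontal_taylor f A B (\<lambda>p. ht (grad f p)) p0 R K"
  proof
    show "R > 0" by (rule R)
    show "1 \<le> K" using K1 K2 K3 K4 L by (simp add: K_def)
    fix p assume p: "p \<in> cball p0 R"
    show "norm (A p) \<le> K" "norm (B p) \<le> K" "\<bar>ht (grad f p)\<bar> \<le> K" "norm p \<le> K"
      using K1(2)[OF p] K2(2)[OF p] K3(2)[OF p] K4(2)[OF p] K1(1) K2(1) K3(1) K4(1) L(1)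
      unfolding K_def real_norm_def by linarith+
    fix q assume q: "q \<in> cball p0 R"
    have "grad f p \<bullet> (q - p) = hx (grad f p) \<bullet> (hx q - hx p) + hy (grad f p) \<bullet> (hy q - hy p) + ht (grad f p) * (ht q - ht p)"
      by (simp add: inner_prod_def)
    also have "\<dots> = A p \<bullet> (hx q - hx p) + B p \<bullet> (hy q - hy p) + ht (grad f p) * tau p q"
      unfolding ht_diff_eq A_def B_def by (simp add: inner_add_left inner_diff_left field_simps)
    finally have e: "f q - f p - A p \<bullet> (hx q - hx p) - B p \<bullet> (hy q - hy p) - ht (grad f p) * tau p q = f q - f p - grad f p \<bullet> (q - p)"
      by simp
    have "L * (norm (q - p))\<^sup>2 \<le> K * (norm (q - p))\<^sup>2"
      using K1 K2 K3 K4 by (intro mult_right_mono) (auto simp: K_def)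
    then show "\<bar>f q - f p - A p \<bullet> (hx q - hx p) - B p \<bullet> (hy q - hy p) - ht (grad f p) * tau p q\<bar> \<le> K * (norm (q - p))\<^sup>2"
      unfolding e using L(2)[OF p q] by linarith
  qed (rule A B T)+
  then show ?thesis using R(2) unfolding A_def[abs_def] B_def[abs_def] by blast
qed

section \<open>Null sets for the Hausdorff measure\<close>

lemma hausdorff_content_finite_cover:
  assumes I: "finite I" and cover: "Z \<subseteq> (\<Union>i\<in>I. P i)"
    and diam: "\<And>i p q. i \<in> I \<Longrightarrow> p \<in> P i \<Longrightarrow> q \<in> P i \<Longrightarrow> d p q \<le> e"
    and e: "0 \<le> e" "e \<le> \<delta>" and s: "0 \<le> s"
  shows "hausdorff_content d s \<delta> Z \<le> ennreal (real (card I) * e powr s)"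
proof -
  obtain h where h: "bij_betw h {..<card I} I"
    using ex_bij_betw_nat_finite[OF I] by (auto simp: atLeast0LessThan)
  \<comment> \<open>Padding a finite cover by empty sets is free: their diameter is 0 and
    \<open>0 powr s\<close> is 0.\<close>
  define C where "C n = (if n < card I then P (h n) else {})" for n
  have hI: "h n \<in> I" if "n < card I" for n using bij_betwE[OF h] that by auto
  have dd: "dist_diam d (C n) \<le> ennreal e" for n
    unfolding dist_diam_def C_def using diam[OF hI]
    by (auto intro!: SUP_least ennreal_leI)
  have Z: "Z \<subseteq> (\<Union>n. C n)"
  proof
    fix z assume "z \<in> Z"
    then obtain i where i: "i \<in> I" "z \<in> P i" using cover by auto
    have "i \<in> h ` {..<card I}" using bij_betw_imp_surj_on[OF h] i(1) by simp
    then obtain n where "n < card I" "h n = i" by auto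
    then show "z \<in> (\<Union>n. C n)" using i(2) by (auto simp: C_def)
  qed
  have "hausdorff_content d s \<delta> Z \<le> (\<Sum>n. ennreal (enn2real (dist_diam d (C n)) powr s))"
    unfolding hausdorff_content_def
    using Z dd order_trans[OF dd ennreal_leI[OF e(2)]] by (intro INF_lower) auto
  also have "\<dots> = (\<Sum>n<card I. ennreal (enn2real (dist_diam d (C n)) powr s))"
    by (rule suminf_finite) (auto simp: C_def dist_diam_def bot_ennreal)
  also have "\<dots> \<le> (\<Sum>n<card I. ennreal (e powr s))"
    using dd e s by (intro sum_mono ennreal_leI powr_mono2 enn2real_leI) auto
  also have "\<dots> = ennreal (real (card I) * e powr s)"
    by (simp add: ennreal_mult ennreal_of_nat_eq_real_of_nat)
  finally show ?thesis .
qed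

lemma hausdorff_measure_eq_0I:
  assumes "\<And>\<delta> \<epsilon>. \<delta> > 0 \<Longrightarrow> \<epsilon> > 0 \<Longrightarrow> hausdorff_content d s \<delta> A \<le> ennreal \<epsilon>"
  shows "hausdorff_measure d s A = 0"
proof -
  have "hausdorff_content d s \<delta> A \<le> 0" if "\<delta> > 0" for \<delta>
    by (rule ennreal_le_epsilon) (use assms[OF that] in auto)
  then show ?thesis unfolding hausdorff_measure_def by (simp add: SUP_eq_iff)
qed

lemma hausdorff_measure_empty:
  assumes "0 \<le> s"
  shows "hausdorff_measure d s {} = 0"
proof (rule hausdorff_measure_eq_0I)
  fix \<delta> \<epsilon> :: real assume "\<delta> > 0"
  then show "hausdorff_content d s \<delta> {} \<le> ennreal \<epsilon>"
    using hausdorff_content_finite_cover[of "{}" "{}" "\<lambda>_. {}" d 0 \<delta> s] assms by simp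
qed

lemma hausdorff_content_eq_0D:
  assumes "hausdorff_measure d s A = 0" "\<delta> > 0"
  shows "hausdorff_content d s \<delta> A = 0"
proof -
  have "hausdorff_content d s \<delta> A \<le> hausdorff_measure d s A"
    unfolding hausdorff_measure_def using assms(2) by (intro SUP_upper) auto
  then show ?thesis using assms(1) by simp
qed

lemma hausdorff_measure_null_subset:
  assumes "hausdorff_measure d s B = 0" "A \<subseteq> B"
  shows "hausdorff_measure d s A = 0"
proof (rule hausdorff_measure_eq_0I)
  fix \<delta> \<epsilon> :: real assume "\<delta> > 0"
  have "hausdorff_content d s \<delta> A \<le> hausdorff_content d s \<delta> B"
    unfolding hausdorff_content_def using assms(2) by (intro INF_superset_mono) auto
  then show "hausdorff_content d s \<delta> A \<le> ennreal \<epsilon>"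
    using hausdorff_content_eq_0D[OF assms(1) \<open>\<delta> > 0\<close>] by simp
qed

lemma hausdorff_measure_null_UN:
  assumes "\<And>i :: nat. hausdorff_measure d s (A i) = 0"
  shows "hausdorff_measure d s (\<Union>i. A i) = 0"
proof (rule hausdorff_measure_eq_0I)
  fix \<delta> \<epsilon> :: real assume \<delta>: "\<delta> > 0" and \<epsilon>: "\<epsilon> > 0"
  define w where "w C = (\<Sum>n. ennreal (enn2real (dist_diam d (C n)) powr s))" for C :: "nat \<Rightarrow> 'a set"
  have "\<exists>C. A i \<subseteq> (\<Union>n. C n) \<and> (\<forall>n. dist_diam d (C n) \<le> ennreal \<delta>) \<and> w C < ennreal (\<epsilon> * (1 / 2) ^ Suc i)" for i
  proof -
    have "hausdorff_content d s \<delta> (A i) < ennreal (\<epsilon> * (1 / 2) ^ Suc i)"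
      using hausdorff_content_eq_0D[OF assms \<delta>, of i] \<epsilon> by simp
    then show ?thesis unfolding hausdorff_content_def INF_less_iff w_def by auto
  qed
  then obtain C where C: "\<And>i. A i \<subseteq> (\<Union>n. C i n)" "\<And>i n. dist_diam d (C i n) \<le> ennreal \<delta>"
    "\<And>i. w (C i) < ennreal (\<epsilon> * (1 / 2) ^ Suc i)"
    by metis
  define B where "B k = (case prod_decode k of (i, n) \<Rightarrow> C i n)" for k
  have "(\<Union>i. A i) \<subseteq> (\<Union>k. B k)"
  proof
    fix x assume "x \<in> (\<Union>i. A i)"
    then obtain i n where "x \<in> C i n" using C(1) by blast
    then have "x \<in> B (prod_encode (i, n))" by (simp add: B_def)
    then show "x \<in> (\<Union>k. B k)" by blast
  qed
  moreover have "\<forall>k. dist_diam d (B k) \<le> ennreal \<delta>"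
    using C(2) by (simp add: B_def split: prod.split)
  ultimately have "hausdorff_content d s \<delta> (\<Union>i. A i) \<le> w B"
    unfolding hausdorff_content_def w_def by (intro INF_lower) auto
  also have "w B = (\<Sum>k. (\<lambda>(i, n). ennreal (enn2real (dist_diam d (C i n)) powr s)) (prod_decode k))"
    by (simp add: w_def B_def case_prod_unfold)
  also have "\<dots> = (\<Sum>i. w (C i))"
    by (rule suminf_ennreal_2dimen) (simp add: w_def)
  also have "\<dots> \<le> (\<Sum>i. ennreal (\<epsilon> * (1 / 2) ^ Suc i))"
    using C(3) by (intro suminf_le) (auto intro: less_imp_le)
  also have "\<dots> = ennreal \<epsilon>"
    using sums_mult[OF power_half_series, of \<epsilon>] \<epsilon> by (intro suminf_ennreal_eq) auto
  finally show "hausdorff_content d s \<delta> (\<Union>i. A i) \<le> ennreal \<epsilon>" .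
qed

text \<open>A bounded \<open>N\<close>-dimensional set is covered by \<open>(2m + 1)\<^sup>N\<close> cells of diameter \<open>O(1/m)\<close>.\<close>

lemma hausdorff_measure_null_of_dimension:
  fixes d :: "'a \<Rightarrow> 'a \<Rightarrow> real" and \<pi> :: "'a \<Rightarrow> 'e::euclidean_space"
  assumes bdd: "\<And>p. p \<in> Z \<Longrightarrow> norm (\<pi> p) \<le> b" and b: "b > 0"
    and lip: "\<And>p q. p \<in> Z \<Longrightarrow> q \<in> Z \<Longrightarrow> d p q \<le> C * norm (\<pi> p - \<pi> q)" and C: "C > 0"
  shows "hausdorff_measure d (real (DIM('e) + 1)) Z = 0"
proof (rule hausdorff_measure_eq_0I)
  fix \<delta> \<epsilon> :: real assume \<delta>: "\<delta> > 0" and \<epsilon>: "\<epsilon> > 0"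
  define N where "N = DIM('e)"
  \<comment> \<open>Within a cell each of the \<open>N\<close> coordinates varies by at most
    \<open>b / m\<close>; with the l1 bound on the norm and the constant \<open>C\<close>, the cell
    has diameter at most \<open>D / m\<close>.\<close>
  define D where "D = C * (real N * b)"
  have D: "D > 0" using C b by (simp add: D_def N_def)
  \<comment> \<open>The first condition brings the cells below \<delta>. For the second,
    \<open>(3 * m) ^ N\<close> cells of diameter \<open>D / m\<close> at exponent
    \<open>N + 1\<close> leave one factor \<open>1 / m\<close>.\<close>
  obtain m :: nat where m: "real m > D / \<delta>" "real m > 3 ^ N * D ^ (N + 1) / \<epsilon>" "m > 0"
  proof -
    obtain m :: nat where "real m > max (D / \<delta>) (3 ^ N * D ^ (N + 1) / \<epsilon>)" using reals_Archimedean2 by blast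
    moreover from this have "real m > 0" using D \<delta> by (smt (verit) divide_pos_pos max.cobounded1)
    ultimately show ?thesis using that by auto
  qed
  define idx where "idx p = (\<lambda>e\<in>Basis. \<lfloor>(\<pi> p \<bullet> e) * m / b\<rfloor>)" for p
  define I where "I = (Basis :: 'e set) \<rightarrow>\<^sub>E {- int m..int m}"
  define P where "P i = {p \<in> Z. idx p = i}" for i
  have idx: "idx p \<in> I" if "p \<in> Z" for p
    unfolding I_def idx_def
  proof (intro restrict_PiE_iff[THEN iffD2] ballI)
    fix e :: 'e assume e: "e \<in> Basis"
    have le: "\<bar>\<pi> p \<bullet> e\<bar> \<le> b" using Basis_le_norm[OF e, of "\<pi> p"] bdd[OF that] by linarith
    have "\<bar>(\<pi> p \<bullet> e) * m / b\<bar> = \<bar>\<pi> p \<bullet> e\<bar> * m / b" using b by (simp add: abs_mult)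
    also have "\<dots> \<le> b * m / b" using le b by (intro divide_right_mono mult_right_mono) auto
    also have "\<dots> = m" using b by simp
    finally have "- real m \<le> (\<pi> p \<bullet> e) * m / b" "(\<pi> p \<bullet> e) * m / b \<le> m" unfolding abs_le_iff by linarith+
    then show "\<lfloor>(\<pi> p \<bullet> e) * m / b\<rfloor> \<in> {- int m..int m}"
      unfolding atLeastAtMost_iff le_floor_iff floor_le_iff by simp
  qed
  have "hausdorff_content d (real (N + 1)) \<delta> Z \<le> ennreal (real (card I) * (D / m) powr real (N + 1))"
  proof (rule hausdorff_content_finite_cover)
    show "finite I" unfolding I_def by (intro finite_PiE) auto
    show "Z \<subseteq> (\<Union>i\<in>I. P i)" using idx by (auto simp: P_def)
    show "0 \<le> D / m" using D by simp
    show "D / m \<le> \<delta>" using m \<delta> D by (simp add: field_simps)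
    fix i p q assume "p \<in> P i" "q \<in> P i"
    then have pq: "p \<in> Z" "q \<in> Z" "idx p = idx q" by (auto simp: P_def)
    have "\<bar>(\<pi> p - \<pi> q) \<bullet> e\<bar> \<le> b / m" if e: "e \<in> Basis" for e
    proof -
      have "\<lfloor>(\<pi> p \<bullet> e) * m / b\<rfloor> = \<lfloor>(\<pi> q \<bullet> e) * m / b\<rfloor>"
        using fun_cong[OF pq(3), of e] e by (simp add: idx_def)
      then have "\<bar>(\<pi> p \<bullet> e) * m / b - (\<pi> q \<bullet> e) * m / b\<bar> \<le> 1" by linarith
      also have "(\<pi> p \<bullet> e) * m / b - (\<pi> q \<bullet> e) * m / b = ((\<pi> p - \<pi> q) \<bullet> e) * (m / b)"
        by (simp add: inner_diff_left algebra_simps diff_divide_distrib)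
      finally have "\<bar>(\<pi> p - \<pi> q) \<bullet> e\<bar> * (m / b) \<le> 1" using b by (simp add: abs_mult)
      then show ?thesis using b m(3) by (simp add: field_simps)
    qed
    then have "(\<Sum>e\<in>Basis. \<bar>(\<pi> p - \<pi> q) \<bullet> e\<bar>) \<le> real N * (b / m)"
      unfolding N_def by (rule sum_bounded_above)
    then have "norm (\<pi> p - \<pi> q) \<le> real N * (b / m)"
      using norm_le_l1[of "\<pi> p - \<pi> q"] by linarith
    then have "C * norm (\<pi> p - \<pi> q) \<le> C * (real N * (b / m))" using C by (intro mult_left_mono) auto
    then show "d p q \<le> D / m" using lip[OF pq(1,2)] by (simp add: D_def)
  qed simp
  also have "\<dots> \<le> ennreal \<epsilon>"
  proof (rule ennreal_leI)
    have "card I = card {- int m..int m} ^ N" unfolding I_def N_def by (subst card_PiE) auto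
    also have "card {- int m..int m} = 2 * m + 1" by simp
    finally have "real (card I) = (2 * real m + 1) ^ N" by (simp add: add.commute)
    also have "\<dots> \<le> (3 * real m) ^ N" using m(3) by (intro power_mono) auto
    finally have card: "real (card I) \<le> (3 * real m) ^ N" .
    have "(D / m) powr real (N + 1) = (D / m) ^ (N + 1)"
      using D m(3) by (intro powr_realpow) simp
    then have "real (card I) * (D / m) powr real (N + 1) \<le> (3 * real m) ^ N * (D / m) ^ (N + 1)"
      using card D by (simp only:) (rule mult_right_mono, auto)
    also have "(3 * real m) ^ N * (D / m) ^ (N + 1) = 3 ^ N * D ^ (N + 1) / m"
      using m(3) by (simp add: power_mult_distrib power_divide)
    also have "\<dots> \<le> \<epsilon>" using m(2,3) \<epsilon> by (simp add: field_simps)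
    finally show "real (card I) * (D / m) powr real (N + 1) \<le> \<epsilon>" .
  qed
  finally show "hausdorff_content d (real (DIM('e) + 1)) \<delta> Z \<le> ennreal \<epsilon>" by (simp add: N_def)
qed

section \<open>Rectifiability\<close>

lemma bi_Lipschitz_of_gauges:
  assumes d: "\<And>p q. gauge2 p q \<le> C1 * (d p q)\<^sup>2 \<and> (d p q)\<^sup>2 \<le> C1 * gauge2 p q" "C1 \<ge> 1" "\<And>p q. d p q \<ge> 0"
    and d': "\<And>p q. line_gauge2 p q \<le> C2 * (d' p q)\<^sup>2 \<and> (d' p q)\<^sup>2 \<le> C2 * line_gauge2 p q" "C2 \<ge> 1" "\<And>p q. d' p q \<ge> 0"
    and F: "\<And>p q. p \<in> W \<Longrightarrow> q \<in> W \<Longrightarrow> line_gauge2 (F p) (F q) \<le> C * gauge2 p q \<and> gauge2 p q \<le> C * line_gauge2 (F p) (F q)" "C \<ge> 1"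
  shows "bi_Lipschitz_on d d' W F"
proof -
  define L2 where "L2 = C1 * C2 * C"
  have "1 * 1 * 1 \<le> C1 * C2 * C" using d(2) d'(2) F(2) by (intro mult_mono) auto
  then have L2: "L2 \<ge> 1" by (simp add: L2_def)
  \<comment> \<open>\<open>L2\<close> bounds the ratio of the squared distances; being at least 1 it
    is below its own square, so it also serves for the distances.\<close>
  define L where "L = L2"
  have "d p q / L \<le> d' (F p) (F q) \<and> d' (F p) (F q) \<le> L * d p q" if pq: "p \<in> W" "q \<in> W" for p q
  proof -
    have c: "C1 \<ge> 0" "C2 \<ge> 0" "C \<ge> 0" using d(2) d'(2) F(2) by auto
    have up: "x \<le> L * y" if "x\<^sup>2 \<le> L2 * y\<^sup>2" "y \<ge> 0" for x y :: real
    proof (rule power2_le_imp_le)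
      have "L2 * y\<^sup>2 \<le> L\<^sup>2 * y\<^sup>2" unfolding L_def using L2 by (intro mult_right_mono) (auto simp: power2_eq_square)
      then show "x\<^sup>2 \<le> (L * y)\<^sup>2" using that(1) by (simp add: power_mult_distrib)
    qed (use that L2 L_def in auto)
    have "(d' (F p) (F q))\<^sup>2 \<le> C2 * line_gauge2 (F p) (F q)" using d'(1) by blast
    also have "\<dots> \<le> C2 * (C * gauge2 p q)" using F(1)[OF pq] c by (intro mult_left_mono) auto
    also have "\<dots> \<le> C2 * (C * (C1 * (d p q)\<^sup>2))" using d(1)[of p q] c by (intro mult_left_mono) auto
    also have "\<dots> = L2 * (d p q)\<^sup>2" by (simp only: L2_def mult_ac)
    finally have 1: "d' (F p) (F q) \<le> L * d p q" using d(3) by (intro up)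
    have "(d p q)\<^sup>2 \<le> C1 * gauge2 p q" using d(1) by blast
    also have "\<dots> \<le> C1 * (C * line_gauge2 (F p) (F q))" using F(1)[OF pq] c by (intro mult_left_mono) auto
    also have "\<dots> \<le> C1 * (C * (C2 * (d' (F p) (F q))\<^sup>2))" using d'(1) c by (intro mult_left_mono) auto
    also have "\<dots> = L2 * (d' (F p) (F q))\<^sup>2" by (simp only: L2_def mult_ac)
    finally have "d p q \<le> L * d' (F p) (F q)" using d'(3) by (intro up)
    then have "d p q / L \<le> d' (F p) (F q)" using L2 by (simp add: L_def divide_le_eq mult.commute)
    then show ?thesis using 1 by simp
  qed
  then show ?thesis unfolding bi_Lipschitz_on_def using L2 L_def by blast
qed

text \<open>A noncharacteristic point has a chart neighbourhood, which contains no exceptional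
  points at all. Near a characteristic point the exceptional points are all characteristic, and
  those are projected to the horizontal coordinates.\<close>

lemma hypersurface_local_structure:
  fixes S :: "'n::finite heis set"
    and d :: "'n heis \<Rightarrow> 'n heis \<Rightarrow> real"
    and d' :: "('m::finite) heis_line \<Rightarrow> 'm heis_line \<Rightarrow> real"
  assumes m: "CARD('m) = CARD('n) - 1"
    and d: "left_inv_homogeneous_dist heis_mult heis_dil d"
    and d': "left_inv_homogeneous_dist heis_line_mult heis_line_dil d'"
    and S: "smooth_hypersurface S" and p0: "p0 \<in> S"
  defines "good W \<equiv> \<exists>F. bi_Lipschitz_on d d' (S \<inter> W) F"
  shows "\<exists>W. open W \<and> p0 \<in> W \<and>
    hausdorff_measure d (real (2 * CARD('n) + 1)) {p \<in> S \<inter> W. \<not> (\<exists>V. open V \<and> p \<in> V \<and> good V)} = 0"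
proof -
  interpret md: Metric_space UNIV d using d by (simp add: left_inv_homogeneous_dist_def)
  interpret md': Metric_space UNIV d' using d' by (simp add: left_inv_homogeneous_dist_def)
  obtain C1 where C1: "C1 \<ge> 1" "\<And>p q. gauge2 p q \<le> C1 * (d p q)\<^sup>2 \<and> (d p q)\<^sup>2 \<le> C1 * gauge2 p q"
    using heis_dist_gauge[OF d] by blast
  obtain C2 where C2: "C2 \<ge> 1" "\<And>p q. line_gauge2 p q \<le> C2 * (d' p q)\<^sup>2 \<and> (d' p q)\<^sup>2 \<le> C2 * line_gauge2 p q"
    using heis_line_dist_gauge[OF d'] by blast
  obtain U f where U: "open U" "p0 \<in> U" "smooth_on U f" "S \<inter> U = {q \<in> U. f q = 0}"
    "\<And>q. q \<in> S \<inter> U \<Longrightarrow> frechet_derivative f (at q) \<noteq> (\<lambda>v. 0)"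
    using S p0 unfolding smooth_hypersurface_def by meson
  have C2f: "Ck_on (Suc (Suc 0)) U f" using U(3) unfolding smooth_on_def by blast
  define A where "A p = hx (grad f p) + (- 1 / 2 * ht (grad f p)) *\<^sub>R hy p" for p
  define B where "B p = hy (grad f p) + (1 / 2 * ht (grad f p)) *\<^sub>R hx p" for p
  have good: "\<exists>V. open V \<and> p \<in> V \<and> good V" if p: "p \<in> S \<inter> U" and nz: "A p \<noteq> 0 \<or> B p \<noteq> 0" for p
  proof -
    obtain R K where "cball p R \<subseteq> U" and ht: "horizontal_taylor f A B (\<lambda>p. ht (grad f p)) p R K"
      using smooth_horizontal_taylor[OF U(1) _ C2f, of p] p unfolding A_def[abs_def] B_def[abs_def] by blast
    interpret horizontal_taylor f A B "\<lambda>p. ht (grad f p)" p R K by (rule ht)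
    obtain \<rho> and F :: "'n heis \<Rightarrow> 'm heis_line" and C where F: "\<rho> > 0" "C \<ge> 1"
      "\<And>x y. x \<in> ball p \<rho> \<Longrightarrow> y \<in> ball p \<rho> \<Longrightarrow> f x = 0 \<Longrightarrow> f y = 0 \<Longrightarrow>
       line_gauge2 (F x) (F y) \<le> C * gauge2 x y \<and> gauge2 x y \<le> C * line_gauge2 (F x) (F y)"
      using straightening_noncharacteristic[OF m nz] by blast
    have f0: "f x = 0" if "x \<in> S \<inter> (U \<inter> ball p \<rho>)" for x using that U(4) by blast
    have "bi_Lipschitz_on d d' (S \<inter> (U \<inter> ball p \<rho>)) F"
      by (rule bi_Lipschitz_of_gauges[OF C1(2,1) _ C2(2,1) _ F(3) F(2)])
        (simp_all add: f0 del: mem_ball)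
    then have "good (U \<inter> ball p \<rho>)" unfolding good_def by blast
    then show ?thesis using U(1) p F(1) by (intro exI[of _ "U \<inter> ball p \<rho>"]) (simp add: open_Int)
  qed
  have p0U: "p0 \<in> S \<inter> U" using p0 U(2) by simp
  show ?thesis
  proof (cases "A p0 = 0 \<and> B p0 = 0")
    case False
    then have "\<exists>V. open V \<and> p0 \<in> V \<and> good V" using good[OF p0U] by blast
    then obtain V where V: "open V" "p0 \<in> V" "good V" by blast
    have "{p \<in> S \<inter> V. \<not> (\<exists>V. open V \<and> p \<in> V \<and> good V)} = {}" using V by blast
    then have "hausdorff_measure d (real (2 * CARD('n) + 1)) {p \<in> S \<inter> V. \<not> (\<exists>V. open V \<and> p \<in> V \<and> good V)} = 0"
      by (simp only: hausdorff_measure_empty of_nat_0_le_iff)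
    then show ?thesis using V by blast
  next
    case True
    have diff: "f differentiable (at p0)" using C2f U(2) by simp
    \<comment> \<open>The gradient is nonzero on the hypersurface, so when both horizontal parts
      vanish its vertical component cannot.\<close>
    have nzT: "ht (grad f p0) \<noteq> 0"
    proof
      assume "ht (grad f p0) = 0"
      then have "grad f p0 = 0" using True by (simp add: A_def B_def prod_eq_iff)
      then show False using U(5)[OF p0U] frechet_derivative_eq_grad[OF diff] by (auto simp: fun_eq_iff)
    qed
    obtain R K where RU: "cball p0 R \<subseteq> U" and ht: "horizontal_taylor f A B (\<lambda>p. ht (grad f p)) p0 R K"
      using smooth_horizontal_taylor[OF U(1,2) C2f] unfolding A_def[abs_def] B_def[abs_def] by blast
    interpret horizontal_taylor f A B "\<lambda>p. ht (grad f p)" p0 R K by (rule ht)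
    obtain \<rho> C where \<rho>: "\<rho> > 0" "\<rho> \<le> R" "C > 0" and gC: "\<And>p q. p \<in> ball p0 \<rho> \<Longrightarrow> q \<in> ball p0 \<rho> \<Longrightarrow>
       f p = f q \<Longrightarrow> A p = 0 \<Longrightarrow> B p = 0 \<Longrightarrow> gauge2 p q \<le> C * hdist2 p q"
      using characteristic_gauge[OF nzT] by blast
    define Z where "Z = {p \<in> S \<inter> ball p0 \<rho>. A p = 0 \<and> B p = 0}"
    have bU: "ball p0 \<rho> \<subseteq> U" using RU \<rho>(2) by (auto simp: subset_iff)
    define \<pi> where "\<pi> p = (hx p, hy p)" for p :: "'n heis"
    have \<pi>: "(norm (\<pi> p - \<pi> q))\<^sup>2 = hdist2 p q" for p q
      by (simp add: \<pi>_def hdist2_def norm_Pair norm_minus_commute)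
    \<comment> \<open>The target of the projection has dimension \<open>2 * CARD('n)\<close>, one
      less than the exponent.\<close>
    have "hausdorff_measure d (real (DIM((real^'n) \<times> (real^'n)) + 1)) Z = 0"
    proof (rule hausdorff_measure_null_of_dimension[where \<pi> = \<pi> and b = "2 * K" and C = "sqrt (C1 * C)"])
      show "2 * K > 0" "sqrt (C1 * C) > 0" using K C1(1) \<rho>(3) by simp_all
      show "norm (\<pi> p) \<le> 2 * K" if "p \<in> Z" for p
      proof -
        have "p \<in> cball p0 R" using that \<rho>(2) by (simp add: Z_def)
        then have "norm p \<le> K" by (rule bp)
        then show ?thesis using comp_norm_le[of p] norm_Pair_le[of "hx p" "hy p"] unfolding \<pi>_def by linarith
      qed
      show "d p q \<le> sqrt (C1 * C) * norm (\<pi> p - \<pi> q)" if "p \<in> Z" "q \<in> Z" for p q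
      proof (rule power2_le_imp_le)
        have "f p = 0" "f q = 0" using that U(4) bU unfolding Z_def by blast+
        then have "gauge2 p q \<le> C * hdist2 p q" using that gC by (simp add: Z_def)
        then have "C1 * gauge2 p q \<le> C1 * (C * hdist2 p q)" using C1(1) by (intro mult_left_mono) auto
        then have "(d p q)\<^sup>2 \<le> C1 * C * hdist2 p q" using C1(2)[of p q] by simp
        then show "(d p q)\<^sup>2 \<le> (sqrt (C1 * C) * norm (\<pi> p - \<pi> q))\<^sup>2"
          using C1(1) \<rho>(3) unfolding power_mult_distrib \<pi> by simp
      qed (use C1(1) \<rho>(3) in simp)
    qed
    then have "hausdorff_measure d (real (2 * CARD('n) + 1)) Z = 0" by simp
    moreover have "{p \<in> S \<inter> ball p0 \<rho>. \<not> (\<exists>V. open V \<and> p \<in> V \<and> good V)} \<subseteq> Z"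
    proof (rule subsetI)
      fix p assume p: "p \<in> {p \<in> S \<inter> ball p0 \<rho>. \<not> (\<exists>V. open V \<and> p \<in> V \<and> good V)}"
      then have "p \<in> S \<inter> U" using bU by blast
      then have "A p = 0 \<and> B p = 0" using good[of p] p by blast
      then show "p \<in> Z" using p by (simp add: Z_def)
    qed
    ultimately have "hausdorff_measure d (real (2 * CARD('n) + 1)) {p \<in> S \<inter> ball p0 \<rho>. \<not> (\<exists>V. open V \<and> p \<in> V \<and> good V)} = 0"
      by (rule hausdorff_measure_null_subset)
    then show ?thesis using \<rho>(1) by (intro exI[of _ "ball p0 \<rho>"] conjI open_ball centre_in_ball[THEN iffD2])
  qed
qed

text \<open>Globalization: countably many chart domains cover all points with a chart neighbourhood,
  the remaining points form a countable union of null sets, and the charts, which go from the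
  hypersurface to the model group, are inverted.\<close>

theorem theorem1p2:
  fixes S :: "('n::finite) heis set"
    and d :: "'n heis \<Rightarrow> 'n heis \<Rightarrow> real"
    and d' :: "('m::finite) heis_line \<Rightarrow> 'm heis_line \<Rightarrow> real"
  assumes "CARD('n) \<ge> 2" and "CARD('m) = CARD('n) - 1"
    and "left_inv_homogeneous_dist heis_mult heis_dil d"
    and "left_inv_homogeneous_dist heis_line_mult heis_line_dil d'"
    and "smooth_hypersurface S"
  shows "\<exists>(U :: nat \<Rightarrow> 'm heis_line set) (f :: nat \<Rightarrow> 'm heis_line \<Rightarrow> 'n heis).
    (\<forall>i. f i ` U i \<subseteq> S \<and> bi_Lipschitz_on d' d (U i) (f i)) \<and>
    hausdorff_measure d (real (2 * CARD('n) + 1)) (S - (\<Union>i. f i ` U i)) = 0"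
proof -
  interpret md: Metric_space UNIV d using assms(3) by (simp add: left_inv_homogeneous_dist_def)
  interpret md': Metric_space UNIV d' using assms(4) by (simp add: left_inv_homogeneous_dist_def)
  define good where "good W \<longleftrightarrow> (\<exists>F. bi_Lipschitz_on d d' (S \<inter> W) F)" for W
  define bad where "bad = {p. \<not> (\<exists>V. open V \<and> p \<in> V \<and> good V)}"
  define s where "s = real (2 * CARD('n) + 1)"
  \<comment> \<open>The Lindelof property of the Euclidean topology in sequence form, applied below
    to chart domains and to sets with null exceptional part; inserting the empty set makes the
    enumeration possible for an empty family.\<close>
  have enum: "\<exists>V :: nat \<Rightarrow> 'n heis set. (\<forall>i. V i \<in> insert {} \<F>) \<and> (\<Union>i. V i) = \<Union>\<F>"
    if op: "\<And>W. W \<in> \<F> \<Longrightarrow> open W" for \<F> :: "'n heis set set"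
  proof -
    obtain \<G> where \<G>: "\<G> \<subseteq> \<F>" "countable \<G>" "\<Union>\<G> = \<Union>\<F>" using Lindelof[OF op] by metis
    have "range (from_nat_into (insert {} \<G>)) = insert {} \<G>"
      using \<G>(2) by (intro range_from_nat_into) auto
    then have "(\<Union>i. from_nat_into (insert {} \<G>) i) = \<Union>\<F>" "\<forall>i. from_nat_into (insert {} \<G>) i \<in> insert {} \<F>"
      using \<G> by (simp, blast)
    then show ?thesis by blast
  qed
  obtain V :: "nat \<Rightarrow> 'n heis set" where V: "\<And>i. V i \<in> insert {} {W. open W \<and> good W}" "(\<Union>i. V i) = \<Union>{W. open W \<and> good W}"
    using enum[of "{W. open W \<and> good W}"] by auto
  \<comment> \<open>Any map is bi-Lipschitz on the empty set, so the padding entries of the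
    enumeration are harmless.\<close>
  have "good {}" unfolding good_def bi_Lipschitz_on_def by (intro exI[of _ undefined] exI[of _ 1]) simp
  then have "\<exists>F. bi_Lipschitz_on d d' (S \<inter> V i) F" for i using V(1)[of i] unfolding good_def by auto
  then obtain F where F: "\<And>i. bi_Lipschitz_on d d' (S \<inter> V i) (F i)" by metis
  have inj: "inj_on (F i) (S \<inter> V i)" for i
  proof (rule inj_onI)
    fix p q assume pq: "p \<in> S \<inter> V i" "q \<in> S \<inter> V i" "F i p = F i q"
    obtain L where L: "L \<ge> 1" "d p q / L \<le> d' (F i p) (F i q)"
      using F[of i] pq(1,2) unfolding bi_Lipschitz_on_def by blast
    then have "d p q \<le> 0" using pq(3) by (simp add: divide_le_eq)
    then show "p = q" using md.nonneg[of p q] by auto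
  qed
  \<comment> \<open>The lower Lipschitz bound makes each chart injective, so its inverse is defined
    on the image and has the same constant.\<close>
  define U where "U i = F i ` (S \<inter> V i)" for i
  define f where "f i = inv_into (S \<inter> V i) (F i)" for i
  have img: "f i ` U i = S \<inter> V i" for i unfolding f_def U_def using inj by (simp add: inv_into_image_cancel)
  have lip: "bi_Lipschitz_on d' d (U i) (f i)" for i
  proof -
    obtain L where L: "L \<ge> 1" "\<And>p q. p \<in> S \<inter> V i \<Longrightarrow> q \<in> S \<inter> V i \<Longrightarrow> d p q / L \<le> d' (F i p) (F i q) \<and> d' (F i p) (F i q) \<le> L * d p q"
      using F[of i] unfolding bi_Lipschitz_on_def by blast
    show ?thesis unfolding bi_Lipschitz_on_def
    proof (intro exI[of _ L] conjI[OF L(1)] ballI)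
      fix u v assume "u \<in> U i" "v \<in> U i"
      then obtain p q where pq: "p \<in> S \<inter> V i" "q \<in> S \<inter> V i" "u = F i p" "v = F i q" unfolding U_def by blast
      have "f i u = p" "f i v = q" unfolding f_def pq(3,4) using inj pq(1,2) by (simp_all add: inv_into_f_f)
      then show "d' u v / L \<le> d (f i u) (f i v) \<and> d (f i u) (f i v) \<le> L * d' u v"
        using L(2)[OF pq(1,2)] L(1) unfolding pq(3,4) by (simp add: divide_le_eq mult.commute)
    qed
  qed
  have rest: "S - (\<Union>i. f i ` U i) \<subseteq> S \<inter> bad"
  proof
    fix p assume p: "p \<in> S - (\<Union>i. f i ` U i)"
    then have "p \<notin> (\<Union>i. V i)" unfolding img by blast
    then show "p \<in> S \<inter> bad" using p unfolding V(2) bad_def by blast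
  qed
  have null: "hausdorff_measure d s (S \<inter> bad) = 0"
  proof -
    \<comment> \<open>The local lemma says that these open sets cover \<open>S\<close>; a countable
      subcover then bounds \<open>S \<inter> bad\<close> by a countable union of null sets.\<close>
    define \<N> where "\<N> = {W. open W \<and> hausdorff_measure d s (S \<inter> W \<inter> bad) = 0}"
    obtain N :: "nat \<Rightarrow> 'n heis set" where N: "\<And>i. N i \<in> insert {} \<N>" "(\<Union>i. N i) = \<Union>\<N>"
      using enum[of \<N>] unfolding \<N>_def by auto
    have "S \<subseteq> \<Union>\<N>"
    proof
      fix p assume p: "p \<in> S"
      have "\<exists>W. open W \<and> p \<in> W \<and> hausdorff_measure d s {p \<in> S \<inter> W. \<not> (\<exists>V. open V \<and> p \<in> V \<and> good V)} = 0"
        unfolding s_def good_def by (rule hypersurface_local_structure[OF assms(2-5) p])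
      moreover have "{p \<in> S \<inter> W. \<not> (\<exists>V. open V \<and> p \<in> V \<and> good V)} = S \<inter> W \<inter> bad" for W
        unfolding bad_def by blast
      ultimately show "p \<in> \<Union>\<N>" unfolding \<N>_def by auto
    qed
    then have sub: "S \<inter> bad \<subseteq> (\<Union>i. S \<inter> N i \<inter> bad)" using N(2) by blast
    have "hausdorff_measure d s (S \<inter> N i \<inter> bad) = 0" for i
      using N(1)[of i] unfolding \<N>_def by (auto simp: hausdorff_measure_empty s_def)
    then show ?thesis using hausdorff_measure_null_subset[OF hausdorff_measure_null_UN sub] by blast
  qed
  show ?thesis
  proof (rule exI[of _ U], rule exI[of _ f], intro conjI allI)
    show "f i ` U i \<subseteq> S" for i unfolding img by blast
    show "bi_Lipschitz_on d' d (U i) (f i)" for i by (rule lip)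
    show "hausdorff_measure d (real (2 * CARD('n) + 1)) (S - (\<Union>i. f i ` U i)) = 0"
      using hausdorff_measure_null_subset[OF null rest] by (simp only: s_def)
  qed
qed

end
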